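(* There exist a smooth map $T:\mathbb{T}^3\to\mathbb{T}^3$ of the three-dimensional torus and a $T$-invariant probability measure $\mu$, absolutely continuous with respect to Lebesgue measure with continuous positive density, such that $(\mathbb{T}^3,T,\mu)$ is mixing and, for every $x_0\in\mathbb{T}^3$, $$\liminf_{r\to 0}\frac{\log\tau_r(x,x_0)}{-\log r}=\infty$$ holds for $\mu$-almost every $x\in\mathbb{T}^3$.
   Context: $\tau_r(x,x_0)=\min\{n\ge 1: T^n(x)\in B_r(x_0)\}$ is the hitting time of the ball of radius $r$ centered at $x_0$; if $\tau_r(x,x_0)$ is undefined for some $r$, the lower limit above is set equal to $\infty$. $\mathbb{T}^3=\mathbb{R}^3/\mathbb{Z}^3$ carries the sup distance $\mathrm{dist}(x,y)=\max_i\|x_i-y_i\|$, where $\|t\|$ is the distance of $t$ from the nearest integer. *)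

theory Defs
  imports "HOL-Probability.Probability"
begin

subsection \<open>The torus with the sup distance\<close>

definition torus_rel :: "real^3 \<Rightarrow> real^3 \<Rightarrow> bool" where
  "torus_rel x y \<longleftrightarrow> (\<forall>i. x $ i - y $ i \<in> \<int>)"

quotient_type torus3 = "real^3" / torus_rel
  morphisms rep_torus3 to_torus3
proof (rule equivpI)
  show "reflp torus_rel" by (auto intro!: reflpI simp: torus_rel_def)
  show "symp torus_rel"
    by (rule sympI) (metis torus_rel_def Ints_minus minus_diff_eq)
  show "transp torus_rel"
  proof (rule transpI)
    fix x y z assume "torus_rel x y" "torus_rel y z"
    then have "(x $ i - y $ i) + (y $ i - z $ i) \<in> \<int>" for i
      unfolding torus_rel_def by (intro Ints_add) auto
    then show "torus_rel x z" by (simp add: torus_rel_def)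
  qed
qed

definition dist_int :: "real \<Rightarrow> real" where
  "dist_int t = \<bar>t - of_int (round t)\<bar>"

lemma dist_int_le: "dist_int t \<le> \<bar>t - of_int m\<bar>"
  unfolding dist_int_def by (rule round_diff_minimal)

lemma dist_int_nonneg: "0 \<le> dist_int t"
  by (simp add: dist_int_def)

lemma dist_int_le_abs: "dist_int t \<le> \<bar>t\<bar>"
  using dist_int_le[of t 0] by simp

lemma dist_int_triangle: "dist_int (s + t) \<le> dist_int s + dist_int t"
  using dist_int_le[of "s + t" "round s + round t"] by (simp add: dist_int_def)

lemma dist_int_minus: "dist_int (- t) = dist_int t"
  using dist_int_le[of "- t" "- round t"] dist_int_le[of t "- round (- t)"]
  by (simp add: dist_int_def)

lemma dist_int_Ints: "n \<in> \<int> \<Longrightarrow> dist_int n = 0"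
  by (auto elim!: Ints_cases simp: dist_int_def)

lemma dist_int_eq_0_iff: "dist_int t = 0 \<longleftrightarrow> t \<in> \<int>"
proof
  assume "dist_int t = 0"
  then have "t = of_int (round t)" by (simp add: dist_int_def)
  then show "t \<in> \<int>" by (metis Ints_of_int)
qed (rule dist_int_Ints)

lemma dist_int_cong: "s - t \<in> \<int> \<Longrightarrow> dist_int s = dist_int t"
  using dist_int_triangle[of t "s - t"] dist_int_triangle[of s "t - s"]
    dist_int_minus[of "s - t"] dist_int_Ints[of "s - t"] by simp

instantiation torus3 :: metric_space
begin

lift_definition dist_torus3 :: "torus3 \<Rightarrow> torus3 \<Rightarrow> real"
  is "\<lambda>x y. Max (range (\<lambda>i. dist_int (x $ i - y $ i)))"
proof -
  fix x x' y y' assume "torus_rel x x'" "torus_rel y y'"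
  then have "(x $ i - x' $ i) - (y $ i - y' $ i) \<in> \<int>" for i
    unfolding torus_rel_def using Ints_diff by blast
  then have "dist_int (x $ i - y $ i) = dist_int (x' $ i - y' $ i)" for i
    by (intro dist_int_cong) (simp add: algebra_simps)
  then show "Max (range (\<lambda>i. dist_int (x $ i - y $ i))) =
             Max (range (\<lambda>i. dist_int (x' $ i - y' $ i)))" by simp
qed

definition uniformity_torus3 :: "(torus3 \<times> torus3) filter" where
  "uniformity_torus3 = (INF e\<in>{0<..}. principal {(x, y). dist x y < e})"

definition open_torus3 :: "torus3 set \<Rightarrow> bool" where
  "open_torus3 U \<longleftrightarrow> (\<forall>x\<in>U. eventually (\<lambda>(x', y). x' = x \<longrightarrow> y \<in> U) uniformity)"

instance
proof
  fix x y z :: torus3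
  show "dist x y = 0 \<longleftrightarrow> x = y"
  proof transfer
    fix x y :: "real^3"
    let ?d = "\<lambda>i. dist_int (x $ i - y $ i)"
    have "Max (range ?d) = 0 \<longleftrightarrow> (\<forall>i. ?d i = 0)"
    proof
      assume *: "Max (range ?d) = 0"
      have "?d i \<le> Max (range ?d)" for i by (rule Max_ge) simp_all
      with * have "?d i \<le> 0" for i by simp
      then show "\<forall>i. ?d i = 0" by (intro allI antisym dist_int_nonneg)
    qed simp
    then show "Max (range ?d) = 0 \<longleftrightarrow> torus_rel x y"
      by (simp add: torus_rel_def dist_int_eq_0_iff)
  qed
  show "dist x y \<le> dist x z + dist y z"
  proof transfer
    fix x y z :: "real^3"
    let ?d = "\<lambda>x y i. dist_int (x $ i - y $ i)"
    have "?d x y i \<le> Max (range (?d x z)) + Max (range (?d y z))" for i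
    proof -
      have "?d x y i \<le> ?d x z i + ?d y z i"
        using dist_int_triangle[of "x $ i - z $ i" "z $ i - y $ i"]
          dist_int_minus[of "y $ i - z $ i"] by simp
      also have "\<dots> \<le> Max (range (?d x z)) + Max (range (?d y z))"
        by (intro add_mono Max_ge) auto
      finally show ?thesis .
    qed
    then show "Max (range (?d x y)) \<le> Max (range (?d x z)) + Max (range (?d y z))"
      by (intro Max.boundedI) auto
  qed
qed (simp_all add: uniformity_torus3_def open_torus3_def)

end

lemma dist_to_torus3:
  "dist (to_torus3 x) (to_torus3 y) = Max (range (\<lambda>i. dist_int (x $ i - y $ i)))"
  by transfer simp

lemma dist_to_torus3_le: "dist (to_torus3 x) (to_torus3 y) \<le> dist x y"
  unfolding dist_to_torus3
proof (rule Max.boundedI)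
  fix a assume "a \<in> range (\<lambda>i. dist_int (x $ i - y $ i))"
  moreover have "dist_int (x $ i - y $ i) \<le> dist x y" for i
    using dist_int_le_abs[of "x $ i - y $ i"] dist_vec_nth_le[of x i y]
    by (simp add: dist_real_def)
  ultimately show "a \<le> dist x y" by auto
qed auto

lemma continuous_on_to_torus3: "continuous_on A to_torus3"
  unfolding continuous_on_iff by (meson dist_to_torus3_le le_less_trans)

lemma measurable_to_torus3 [measurable]: "to_torus3 \<in> borel_measurable borel"
  by (rule borel_measurable_continuous_onI[OF continuous_on_to_torus3])

subsection \<open>Lebesgue measure on the torus, as a Borel measure\<close>

definition torus3_lborel :: "torus3 measure" where
  "torus3_lborel =
     distr (restrict_space lborel {x :: real^3. \<forall>i. 0 \<le> x $ i \<and> x $ i < 1}) borel to_torus3"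

lemma sets_torus3_lborel [simp]: "sets torus3_lborel = sets borel"
  by (simp add: torus3_lborel_def)

lemma space_torus3_lborel [simp]: "space torus3_lborel = UNIV"
  by (simp add: torus3_lborel_def)

subsection \<open>Smooth maps of the torus\<close>

primrec Ck_on :: "nat \<Rightarrow> 'a::real_normed_vector set \<Rightarrow> ('a \<Rightarrow> 'b::real_normed_vector) \<Rightarrow> bool" where
  "Ck_on 0 U f \<longleftrightarrow> continuous_on U f"
| "Ck_on (Suc k) U f \<longleftrightarrow>
     (\<forall>x\<in>U. f differentiable (at x)) \<and>
     (\<forall>v. Ck_on k U (\<lambda>x. frechet_derivative f (at x) v))"

text \<open>Only meant for open \<open>U\<close>, since the derivatives are taken in the full space.\<close>

definition smooth_on :: "'a::real_normed_vector set \<Rightarrow> ('a \<Rightarrow> 'b::real_normed_vector) \<Rightarrow> bool" where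
  "smooth_on U f \<longleftrightarrow> (\<forall>k. Ck_on k U f)"

text \<open>The local inverses of \<open>to_torus3\<close> are the charts of the torus, so smoothness of a self-map
  means that it is given near every point by a smooth map of \<open>real^3\<close>.\<close>

definition smooth_torus3_map :: "(torus3 \<Rightarrow> torus3) \<Rightarrow> bool" where
  "smooth_torus3_map T \<longleftrightarrow>
     (\<forall>p. \<exists>U (f :: real^3 \<Rightarrow> real^3). open U \<and> p \<in> U \<and> smooth_on U f \<and>
        (\<forall>u\<in>U. T (to_torus3 u) = to_torus3 (f u)))"

subsection \<open>Measure-preserving and mixing maps\<close>

definition invariant_measure :: "('a \<Rightarrow> 'a) \<Rightarrow> 'a measure \<Rightarrow> bool" where
  "invariant_measure T M \<longleftrightarrow> T \<in> measurable M M \<and> distr M M T = M"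

definition mixing :: "('a \<Rightarrow> 'a) \<Rightarrow> 'a measure \<Rightarrow> bool" where
  "mixing T M \<longleftrightarrow>
     (\<forall>A\<in>sets M. \<forall>B\<in>sets M.
        (\<lambda>n. measure M ((T ^^ n) -` A \<inter> B)) \<longlonglongrightarrow> measure M A * measure M B)"

subsection \<open>Hitting times\<close>

definition hits :: "('a::metric_space \<Rightarrow> 'a) \<Rightarrow> real \<Rightarrow> 'a \<Rightarrow> 'a \<Rightarrow> bool" where
  "hits T r x x0 \<longleftrightarrow> (\<exists>n\<ge>1. (T ^^ n) x \<in> ball x0 r)"

text \<open>A meaningful value only if \<open>hits T r x x0\<close>.\<close>

definition hitting_time :: "('a::metric_space \<Rightarrow> 'a) \<Rightarrow> real \<Rightarrow> 'a \<Rightarrow> 'a \<Rightarrow> nat" where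
  "hitting_time T r x x0 = (LEAST n. 1 \<le> n \<and> (T ^^ n) x \<in> ball x0 r)"

definition lower_hitting_exponent :: "('a::metric_space \<Rightarrow> 'a) \<Rightarrow> 'a \<Rightarrow> 'a \<Rightarrow> ereal" where
  "lower_hitting_exponent T x x0 =
     (if \<forall>r>0. hits T r x x0
      then Liminf (at_right 0) (\<lambda>r. ereal (ln (real (hitting_time T r x x0)) / (- ln r)))
      else \<infinity>)"

end

theory Submission imports Defs begin

text \<open>\<open>T\<close> is the time-one map of a reparametrised linear flow in a Liouville direction
  \<open>v = (1, \<alpha>, \<beta>)\<close>, following Fayad. The denominators \<open>q\<^sub>n\<close> of the good rational
  approximations belong alternately to \<open>\<alpha>\<close> (\<open>n\<close> even) and to \<open>\<beta>\<close> (\<open>n\<close> odd) and grow like an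
  exponential tower, so that there are integer vectors \<open>k\<^sub>n\<close> of size about \<open>q\<^sub>n\<close> for which
  \<open>\<delta>\<^sub>n = k\<^sub>n \<bullet> v\<close> is about \<open>q\<^sub>n / q\<^sub>n\<^sub>+\<^sub>2\<close>. The flow has velocity \<open>v / \<rho>\<close>, where \<open>\<rho>\<close> is one plus the sum
  of the \<open>2 ^ -q\<^sub>n cos (2 \<pi> k\<^sub>n \<bullet> p)\<close>; it preserves \<open>\<rho>\<close> times Lebesgue measure.

  Mixing: by Stone-Weierstrass it suffices to consider observables \<open>e / \<rho>\<close> with a nontrivial
  character \<open>e\<close>. They are coboundaries of the flow. At times between \<open>2 ^ (3 q\<^sub>n)\<close> and \<open>2 ^ (3 q\<^sub>n\<^sub>+\<^sub>1)\<close>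
  the \<open>n\<close>-th term of \<open>\<rho>\<close> makes the flow stretch segments in the second (\<open>n\<close> even) or third (\<open>n\<close> odd)
  coordinate direction along the orbits, by an amount that is large off a set of small measure,
  and integration by parts in that direction shows that the correlations are small.

  Hitting times: the orbit of \<open>p\<close> stays on the line \<open>p + s v\<close>, along which \<open>k\<^sub>n \<bullet> p\<close> changes only by
  \<open>s \<delta>\<^sub>n\<close>. Hence a visit to the \<open>r\<close>-ball around \<open>x\<^sub>0\<close> before a time of order \<open>q\<^sub>n\<^sub>+\<^sub>2 / q\<^sub>n ^ 3\<close> forces
  \<open>k\<^sub>n \<bullet> (p - x\<^sub>0)\<close> to be within \<open>3 / q\<^sub>n\<^sup>2\<close> of an integer as soon as \<open>r \<le> 1 / q\<^sub>n ^ 3\<close>; by Borel-Cantelli this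
  happens for only finitely many \<open>n\<close>. For \<open>r > 1 / q\<^sub>n\<^sub>+\<^sub>1 ^ 3\<close> that time exceeds every power of \<open>1 / r\<close>, and
  these ranges of \<open>r\<close> leave no gap.\<close>

subsection \<open>Periodic functions on the unit cube\<close>

text \<open>Two frequencies alternate because a single one would leave idle times. The
  \<open>n\<close>-th term contributes to the stretch linearly in time only up to about
  \<open>1 / \<delta> n\<close>, which is \<open>q (n + 2) / q n\<close> up to a factor 2. After
  that it merely oscillates, while the next term of the same parity, with amplitude
  \<open>2 ^ -q (n + 2)\<close>, is still negligible. The term \<open>n + 1\<close> bridges the gap.
  The windows of time come from two demands. The stretch is of order
  \<open>q n * t / 2 ^ q n\<close>, and integration by parts leaves an error of order
  \<open>t\<close> over its square, so \<open>t\<close> must exceed \<open>2 ^ (2 * q n)\<close>;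
  the exponent 3 leaves a margin. At the upper end \<open>\<delta> n * t\<close> must still be
  small, so that the \<open>n\<close>-th term has hardly rotated. The amplitudes lie between two
  constraints: below every power of \<open>1 / q n\<close> for smoothness, and far above
  \<open>\<delta> n\<close>, so that each term acts long before it starts to rotate. The dominant
  part of the stretch vanishes where \<open>sin (2 * pi * (res n \<bullet> p))\<close> does. Lower
  bounds therefore hold only outside thin strips, and the weight in the integration by parts has to
  be regularised there.\<close>

definition cube3 :: "(real^3) set" where
  "cube3 = {x. \<forall>i. 0 \<le> x $ i \<and> x $ i < 1}"

definition int_vec :: "(real^3) set" where
  "int_vec = {m. \<forall>i. m $ i \<in> \<int>}"

text \<open>Functions on the torus are handled through their lifts, so that the derivatives of
  \<open>real^3\<close> apply to them.\<close>

definition periodic :: "(real^3 \<Rightarrow> 'a) \<Rightarrow> bool" where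
  "periodic f \<longleftrightarrow> (\<forall>x. \<forall>m\<in>int_vec. f (x + m) = f x)"

definition cube_measure :: "(real^3) measure" where
  "cube_measure = restrict_space lborel cube3"

lemma torus3_lborel_eq: "torus3_lborel = distr cube_measure borel to_torus3"
  by (simp add: torus3_lborel_def cube_measure_def cube3_def)

lemma countable_int_vec: "countable int_vec"
proof -
  have "int_vec \<subseteq> range (\<lambda>z::int^3. \<chi> i. real_of_int (z $ i))"
  proof
    fix m assume "m \<in> int_vec"
    then have "m = (\<chi> i. real_of_int ((\<chi> i. \<lfloor>m $ i\<rfloor>) $ i))"
      by (auto simp: int_vec_def vec_eq_iff)
    then show "m \<in> range (\<lambda>z::int^3. \<chi> i. real_of_int (z $ i))" by blast
  qed
  then show ?thesis by (rule countable_subset) simp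
qed

lemma int_vec_uminus: "m \<in> int_vec \<Longrightarrow> - m \<in> int_vec"
  by (auto simp: int_vec_def)

lemma int_vec_add: "m \<in> int_vec \<Longrightarrow> l \<in> int_vec \<Longrightarrow> m + l \<in> int_vec"
  by (auto simp: int_vec_def)

lemma int_vec_diff: "m \<in> int_vec \<Longrightarrow> l \<in> int_vec \<Longrightarrow> m - l \<in> int_vec"
  by (auto simp: int_vec_def)

lemma int_vec_inner: "m \<in> int_vec \<Longrightarrow> l \<in> int_vec \<Longrightarrow> m \<bullet> l \<in> \<int>"
  by (auto simp: int_vec_def inner_vec_def intro!: Ints_sum Ints_mult)

lemma periodicD: "periodic f \<Longrightarrow> m \<in> int_vec \<Longrightarrow> f (x + m) = f x"
  by (simp add: periodic_def)

lemma to_torus3_eq_iff: "to_torus3 x = to_torus3 y \<longleftrightarrow> x - y \<in> int_vec"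
  by (simp add: torus3.abs_eq_iff torus_rel_def int_vec_def)

lemma to_torus3_rep [simp]: "to_torus3 (rep_torus3 z) = z"
  using Quotient3_abs_rep[OF Quotient3_torus3] .

lemma periodic_rep: "periodic f \<Longrightarrow> f (rep_torus3 (to_torus3 x)) = f x"
proof -
  assume f: "periodic f"
  have "rep_torus3 (to_torus3 x) - x \<in> int_vec"
    by (simp flip: to_torus3_eq_iff)
  from periodicD[OF f this, of x] show ?thesis by simp
qed

definition floor_vec :: "real^3 \<Rightarrow> real^3" where
  "floor_vec x = (\<chi> i. of_int \<lfloor>x $ i\<rfloor>)"

text \<open>The half-open cube is a fundamental domain of the integer lattice, with
  \<open>floor_vec x\<close> as the unique lattice vector to subtract.\<close>

lemma diff_in_cube3_iff:
  assumes "m \<in> int_vec"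
  shows "x - m \<in> cube3 \<longleftrightarrow> m = floor_vec x"
proof
  assume *: "x - m \<in> cube3"
  show "m = floor_vec x"
    unfolding vec_eq_iff
  proof
    fix i
    obtain z where z: "m $ i = of_int z" using assms by (auto simp: int_vec_def elim!: Ints_cases)
    have "0 \<le> x $ i - m $ i" "x $ i - m $ i < 1" using * by (auto simp: cube3_def)
    with z have "\<lfloor>x $ i\<rfloor> = z" by linarith
    with z show "m $ i = floor_vec x $ i" by (simp add: floor_vec_def)
  qed
next
  assume "m = floor_vec x"
  then show "x - m \<in> cube3" by (auto simp: cube3_def floor_vec_def) linarith
qed

lemma floor_vec_int: "floor_vec x \<in> int_vec"
  by (simp add: floor_vec_def int_vec_def)

lemma exists_cube_rep: obtains p where "p \<in> cube3" "z = to_torus3 p"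
proof
  let ?x = "rep_torus3 z"
  show "?x - floor_vec ?x \<in> cube3" using diff_in_cube3_iff[OF floor_vec_int] by blast
  have "to_torus3 (?x - floor_vec ?x) = to_torus3 ?x"
    using int_vec_uminus[OF floor_vec_int[of ?x]] by (subst to_torus3_eq_iff) simp
  then show "z = to_torus3 (?x - floor_vec ?x)" by (simp only: to_torus3_rep)
qed

lemma borel_cube3 [measurable]: "cube3 \<in> sets borel"
proof -
  have "cube3 = {x \<in> space borel. \<forall>i. 0 \<le> x $ i \<and> x $ i < 1}" by (simp add: cube3_def)
  also have "\<dots> \<in> sets borel" by measurable
  finally show ?thesis .
qed

lemma emeasure_cube3: "emeasure lborel cube3 = 1"
proof (rule antisym)
  have 1: "cube3 \<subseteq> cbox 0 1" "box 0 1 \<subseteq> cube3"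
    by (auto simp: cube3_def mem_box_cart less_imp_le)
  have one: "(1::real^3) \<bullet> b = 1" if "b \<in> Basis" for b
    using that by (auto simp: Basis_vec_def inner_axis)
  have 2: "emeasure lborel (cbox 0 (1::real^3)) = 1" "emeasure lborel (box 0 (1::real^3)) = 1"
    by (simp_all add: emeasure_lborel_cbox_eq emeasure_lborel_box_eq one)
  show "emeasure lborel cube3 \<le> 1"
    using emeasure_mono[OF 1(1), of lborel] 2 by simp
  show "1 \<le> emeasure lborel cube3"
    using emeasure_mono[OF 1(2), of lborel] 2 by simp
qed

lemma space_cube_measure [simp]: "space cube_measure = cube3"
  by (simp add: cube_measure_def space_restrict_space)

interpretation cube: prob_space cube_measure
  by (rule prob_spaceI)
     (simp add: cube_measure_def space_restrict_space emeasure_restrict_space emeasure_cube3)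

lemma borel_measurable_cube_measure:
  "f \<in> borel_measurable borel \<Longrightarrow> f \<in> borel_measurable cube_measure"
  by (simp add: cube_measure_def measurable_restrict_space1)

text \<open>The translated cube is cut along the lattice and its pieces are moved back: the sum over
  \<open>m\<close> of \<open>indicator cube3 (x - m)\<close> equals 1 and is inserted into the
  integral, each summand is shifted by \<open>m\<close>, and the sum over the translates of the
  other indicator collapses to 1.\<close>

lemma nn_integral_periodic_translate:
  fixes f :: "real^3 \<Rightarrow> ennreal"
  assumes [measurable]: "f \<in> borel_measurable borel" and per: "periodic f"
  shows "(\<integral>\<^sup>+x. f (x + w) \<partial>cube_measure) = (\<integral>\<^sup>+x. f x \<partial>cube_measure)"
proof -
  have restr: "(\<integral>\<^sup>+x. g x \<partial>cube_measure) = (\<integral>\<^sup>+x. g x * indicator cube3 x \<partial>lborel)" for g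
    unfolding cube_measure_def by (subst nn_integral_restrict_space) auto
  have shift: "(\<integral>\<^sup>+x. g (x + u) \<partial>lborel) = (\<integral>\<^sup>+x. g x \<partial>lborel)"
    if [measurable]: "g \<in> borel_measurable borel" for g :: "real^3 \<Rightarrow> ennreal" and u
  proof -
    have "(\<integral>\<^sup>+x. g x \<partial>lborel) = (\<integral>\<^sup>+x. g x \<partial>distr lborel borel ((+) u))"
      by (simp add: lborel_distr_plus)
    also have "\<dots> = (\<integral>\<^sup>+x. g (x + u) \<partial>lborel)"
      by (subst nn_integral_distr) (auto simp: add.commute)
    finally show ?thesis by simp
  qed
  have one: "(\<integral>\<^sup>+m. indicator cube3 (x - m) \<partial>count_space int_vec) = (1::ennreal)" for x
  proof -
    have "(\<integral>\<^sup>+m. indicator cube3 (x - m) \<partial>count_space int_vec)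
        = (\<integral>\<^sup>+m. indicator {floor_vec x} m \<partial>count_space int_vec)"
      by (intro nn_integral_cong) (auto simp: indicator_def diff_in_cube3_iff)
    also have "\<dots> = 1"
      using floor_vec_int by (subst nn_integral_indicator) auto
    finally show ?thesis .
  qed
  have one': "(\<integral>\<^sup>+m. indicator cube3 (x + m) \<partial>count_space int_vec) = (1::ennreal)" for x
  proof -
    have "(\<integral>\<^sup>+m. indicator cube3 (x + m) \<partial>count_space int_vec)
        = (\<integral>\<^sup>+m. indicator {- floor_vec x} m \<partial>count_space int_vec)"
    proof (intro nn_integral_cong)
      fix m assume "m \<in> space (count_space int_vec)"
      then have "- m \<in> int_vec" by (simp add: int_vec_uminus)
      from diff_in_cube3_iff[OF this, of x]
      have "x + m \<in> cube3 \<longleftrightarrow> m = - floor_vec x" by (metis diff_minus_eq_add minus_minus)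
      then show "indicator cube3 (x + m) = (indicator {- floor_vec x} m :: ennreal)"
        by (simp add: indicator_def)
    qed
    also have "\<dots> = 1"
      using int_vec_uminus[OF floor_vec_int] by (subst nn_integral_indicator) auto
    finally show ?thesis .
  qed
  let ?I = "\<lambda>x. indicator cube3 x :: ennreal"
  have "(\<integral>\<^sup>+x. f (x + w) \<partial>cube_measure) = (\<integral>\<^sup>+x. f (x + w) * ?I x \<partial>lborel)" by (rule restr)
  also have "\<dots> = (\<integral>\<^sup>+x. f x * ?I (x - w) \<partial>lborel)"
    using shift[of "\<lambda>x. f x * ?I (x - w)" w] by simp
  also have "\<dots> = (\<integral>\<^sup>+x. \<integral>\<^sup>+m. f x * ?I (x - w) * ?I (x - m) \<partial>count_space int_vec \<partial>lborel)"
    by (simp add: nn_integral_cmult one)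
  also have "\<dots> = (\<integral>\<^sup>+m. \<integral>\<^sup>+x. f x * ?I (x - w) * ?I (x - m) \<partial>lborel \<partial>count_space int_vec)"
    by (rule nn_integral_count_space_nn_integral[OF countable_int_vec]) simp
  also have "\<dots> = (\<integral>\<^sup>+m. \<integral>\<^sup>+x. f x * ?I (x - w + m) * ?I x \<partial>lborel \<partial>count_space int_vec)"
  proof (rule nn_integral_cong)
    fix m assume "m \<in> space (count_space int_vec)"
    then have m: "f (x + m) = f x" for x using per by (simp add: periodicD)
    show "(\<integral>\<^sup>+x. f x * ?I (x - w) * ?I (x - m) \<partial>lborel) =
          (\<integral>\<^sup>+x. f x * ?I (x - w + m) * ?I x \<partial>lborel)"
      using shift[of "\<lambda>x. f x * ?I (x - w) * ?I (x - m)" m]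
      by (simp add: m algebra_simps)
  qed
  also have "\<dots> = (\<integral>\<^sup>+x. \<integral>\<^sup>+m. f x * ?I (x - w + m) * ?I x \<partial>count_space int_vec \<partial>lborel)"
    by (rule nn_integral_count_space_nn_integral[OF countable_int_vec, symmetric]) simp
  also have "\<dots> = (\<integral>\<^sup>+x. f x * ?I x \<partial>lborel)"
  proof (intro nn_integral_cong)
    fix x :: "real^3"
    have "(\<integral>\<^sup>+m. f x * ?I (x - w + m) * ?I x \<partial>count_space int_vec)
        = (\<integral>\<^sup>+m. (f x * ?I x) * ?I ((x - w) + m) \<partial>count_space int_vec)"
      by (simp add: mult_ac)
    also have "\<dots> = f x * ?I x"
      using one'[of "x - w"] by (subst nn_integral_cmult) auto
    finally show "(\<integral>\<^sup>+m. f x * ?I (x - w + m) * ?I x \<partial>count_space int_vec) = f x * ?I x" .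
  qed
  finally show ?thesis by (simp add: restr)
qed

lemma cube_integrable_bounded:
  fixes f :: "real^3 \<Rightarrow> real"
  assumes [measurable]: "f \<in> borel_measurable borel" and "\<And>x. \<bar>f x\<bar> \<le> C"
  shows "integrable cube_measure f"
  using assms(2)
  by (intro cube.integrable_const_bound[where B = C] AE_I2 borel_measurable_cube_measure) auto

lemma integral_periodic_translate:
  fixes f :: "real^3 \<Rightarrow> real"
  assumes [measurable]: "f \<in> borel_measurable borel" and per: "periodic f"
    and bd: "\<And>x. \<bar>f x\<bar> \<le> C"
  shows "(\<integral>x. f (x + w) \<partial>cube_measure) = (\<integral>x. f x \<partial>cube_measure)"
proof -
  have nn: "0 \<le> f x + C" for x using bd[of x] by linarith
  have int: "integrable cube_measure f" "integrable cube_measure (\<lambda>x. f (x + w))"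
    using bd by (auto intro!: cube_integrable_bounded)
  \<comment> \<open>Adding the bound \<open>C\<close> makes the integrand nonnegative.\<close>
  have "(\<integral>x. f (x + w) + C \<partial>cube_measure) = enn2real (\<integral>\<^sup>+x. ennreal (f (x + w) + C) \<partial>cube_measure)"
    using nn by (intro integral_eq_nn_integral borel_measurable_cube_measure) auto
  also have "\<dots> = enn2real (\<integral>\<^sup>+x. ennreal (f x + C) \<partial>cube_measure)"
    using per by (subst nn_integral_periodic_translate[where f = "\<lambda>x. ennreal (f x + C)"])
      (auto simp: periodic_def)
  also have "\<dots> = (\<integral>x. f x + C \<partial>cube_measure)"
    using nn by (intro integral_eq_nn_integral[symmetric] borel_measurable_cube_measure) auto
  finally show ?thesis using int by (simp add: cube.prob_space)
qed

text \<open>Difference quotients along \<open>w\<close> integrate to zero by translation invariance,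
  are bounded by \<open>B\<close> by the mean value theorem, and converge to the derivative. This is
  the only form of integration by parts in the development: it is applied to products of periodic
  functions.\<close>

lemma integral_directional_derivative:
  fixes f :: "real^3 \<Rightarrow> real"
  assumes per: "periodic f" and bdf: "\<And>x. \<bar>f x\<bar> \<le> C"
    and der: "\<And>x. (f has_derivative f' x) (at x)" and bd: "\<And>x. \<bar>f' x w\<bar> \<le> B"
  shows "(\<integral>x. f' x w \<partial>cube_measure) = 0"
proof -
  have cont: "continuous_on UNIV f"
    using der has_derivative_continuous by (blast intro: continuous_at_imp_continuous_on)
  then have [measurable]: "f \<in> borel_measurable borel"
    by (rule borel_measurable_continuous_onI)
  let ?h = "\<lambda>n. inverse (real (Suc n))"
  define D where "D n x = (f (x + ?h n *\<^sub>R w) - f x) * real (Suc n)" for n x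
  have line: "((\<lambda>t. f (x + t *\<^sub>R w)) has_field_derivative f' (x + t *\<^sub>R w) w) (at t)" for x t
  proof -
    have "((\<lambda>t. x + t *\<^sub>R w) has_derivative (\<lambda>t. t *\<^sub>R w)) (at t)"
      by (auto intro!: derivative_eq_intros)
    from has_derivative_compose[OF this der]
    show ?thesis
      unfolding has_field_derivative_def
      by (rule has_derivative_eq_rhs)
        (simp add: linear_cmul[OF has_derivative_linear[OF der]] fun_eq_iff mult.commute)
  qed
  have [measurable]: "D n \<in> borel_measurable borel" for n
    unfolding D_def by measurable
  have bD: "\<bar>D n x\<bar> \<le> B" for n x
  proof -
    obtain z where z: "f (x + ?h n *\<^sub>R w) - f (x + 0 *\<^sub>R w) = (?h n - 0) * f' (x + z *\<^sub>R w) w"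
      using MVT2[of 0 "?h n" "\<lambda>t. f (x + t *\<^sub>R w)", OF _ line] by auto
    then have "D n x = f' (x + z *\<^sub>R w) w"
      by (simp add: D_def field_simps del: of_nat_Suc)
    then show ?thesis using bd by simp
  qed
  have lim: "(\<lambda>n. D n x) \<longlonglongrightarrow> f' x w" for x
  proof -
    have "((\<lambda>t. (f (x + (0 + t) *\<^sub>R w) - f (x + 0 *\<^sub>R w)) / t) \<longlongrightarrow> f' (x + 0 *\<^sub>R w) w) (at 0)"
      using line[of x 0] unfolding DERIV_def by simp
    then have *: "((\<lambda>t. (f (x + t *\<^sub>R w) - f x) / t) \<longlongrightarrow> f' x w) (at 0)" by simp
    have "filterlim ?h (at 0) sequentially"
      unfolding filterlim_at using LIMSEQ_inverse_real_of_nat by auto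
    from filterlim_compose[OF * this] show ?thesis
      by (simp add: D_def field_simps del: of_nat_Suc)
  qed
  have zero: "(\<integral>x. D n x \<partial>cube_measure) = 0" for n
  proof -
    have i: "integrable cube_measure f" "integrable cube_measure (\<lambda>x. f (x + ?h n *\<^sub>R w))"
      using bdf by (auto intro!: cube_integrable_bounded simp del: of_nat_Suc)
    show ?thesis
      unfolding D_def using i integral_periodic_translate[OF _ per bdf, of "?h n *\<^sub>R w"]
      by (simp del: of_nat_Suc)
  qed
  have "(\<lambda>n. \<integral>x. D n x \<partial>cube_measure) \<longlonglongrightarrow> (\<integral>x. f' x w \<partial>cube_measure)"
  proof (rule integral_dominated_convergence[where w = "\<lambda>_. B"])
    have "(\<lambda>x. f' x w) \<in> borel_measurable borel"
      by (rule borel_measurable_LIMSEQ_real[where u = D]) (use lim in auto)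
    then show "(\<lambda>x. f' x w) \<in> borel_measurable cube_measure"
      by (rule borel_measurable_cube_measure)
  qed (use lim bD in \<open>auto intro!: borel_measurable_cube_measure\<close>)
  then show ?thesis by (simp add: zero LIMSEQ_const_iff)
qed

lemma sin_add_2pi_Ints: "z \<in> \<int> \<Longrightarrow> sin (t + 2 * pi * z) = sin t"
  by (auto elim!: Ints_cases simp: sin_add sin_int_2pin cos_int_2pin)

lemma cos_add_2pi_Ints: "z \<in> \<int> \<Longrightarrow> cos (t + 2 * pi * z) = cos t"
  by (auto elim!: Ints_cases simp: cos_add sin_int_2pin cos_int_2pin)

lemma periodic_cos: "k \<in> int_vec \<Longrightarrow> periodic (\<lambda>x. cos (2 * pi * (k \<bullet> x) + c))"
  unfolding periodic_def
proof (intro allI ballI)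
  fix x m assume "k \<in> int_vec" "m \<in> int_vec"
  then have "cos (2 * pi * (k \<bullet> x) + c + 2 * pi * (k \<bullet> m)) = cos (2 * pi * (k \<bullet> x) + c)"
    by (intro cos_add_2pi_Ints int_vec_inner)
  then show "cos (2 * pi * (k \<bullet> (x + m)) + c) = cos (2 * pi * (k \<bullet> x) + c)"
    by (simp add: algebra_simps)
qed

lemma periodic_sin: "k \<in> int_vec \<Longrightarrow> periodic (\<lambda>x. sin (2 * pi * (k \<bullet> x) + c))"
  unfolding periodic_def
proof (intro allI ballI)
  fix x m assume "k \<in> int_vec" "m \<in> int_vec"
  then have "sin (2 * pi * (k \<bullet> x) + c + 2 * pi * (k \<bullet> m)) = sin (2 * pi * (k \<bullet> x) + c)"
    by (intro sin_add_2pi_Ints int_vec_inner)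
  then show "sin (2 * pi * (k \<bullet> (x + m)) + c) = sin (2 * pi * (k \<bullet> x) + c)"
    by (simp add: algebra_simps)
qed

text \<open>Up to the nonzero factor \<open>2 * pi * (k \<bullet> k)\<close>, the cosine is the
  derivative of a periodic sine in the direction \<open>k\<close>.\<close>

lemma integral_cos_zero:
  assumes "k \<in> int_vec" "k \<noteq> 0"
  shows "(\<integral>x. cos (2 * pi * (k \<bullet> x) + c) \<partial>cube_measure) = 0"
proof -
  let ?f' = "\<lambda>x w. cos (2 * pi * (k \<bullet> x) + c) * (2 * pi * (k \<bullet> w))"
  have "(\<integral>x. ?f' x k \<partial>cube_measure) = 0"
  proof (rule integral_directional_derivative[where f' = ?f'])
    show "periodic (\<lambda>x. sin (2 * pi * (k \<bullet> x) + c))" by (rule periodic_sin[OF assms(1)])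
    show "((\<lambda>x. sin (2 * pi * (k \<bullet> x) + c)) has_derivative ?f' x) (at x)" for x
      by (auto intro!: derivative_eq_intros)
    show "\<bar>?f' x k\<bar> \<le> \<bar>2 * pi * (k \<bullet> k)\<bar>" for x
      unfolding abs_mult[of "cos _"] by (rule mult_left_le_one_le) auto
    show "\<bar>sin (2 * pi * (k \<bullet> x) + c)\<bar> \<le> 1" for x by simp
  qed
  with assms(2) show ?thesis by simp
qed

section \<open>Measure of strips around a family of parallel planes\<close>

lemma dist_int_ge:
  assumes "d \<le> x" "x \<le> 1 - d"
  shows "d \<le> dist_int x"
proof -
  let ?m = "round x"
  have "?m \<le> 0 \<or> 1 \<le> ?m" by linarith
  then have "real_of_int ?m \<le> 0 \<or> 1 \<le> real_of_int ?m" by linarith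
  then show ?thesis using assms unfolding dist_int_def by linarith
qed

lemma continuous_on_dist_int: "continuous_on UNIV dist_int"
proof -
  have "\<bar>dist_int s - dist_int t\<bar> \<le> \<bar>s - t\<bar>" for s t
    using dist_int_triangle[of t "s - t"] dist_int_triangle[of s "t - s"]
      dist_int_le_abs[of "s - t"] dist_int_le_abs[of "t - s"] by (auto simp: abs_le_iff)
  then show ?thesis
    unfolding continuous_on_iff dist_real_def by (meson le_less_trans)
qed

lemma borel_measurable_dist_int [measurable]: "dist_int \<in> borel_measurable borel"
  by (rule borel_measurable_continuous_onI[OF continuous_on_dist_int])

lemma dist_int_add_Ints: "z \<in> \<int> \<Longrightarrow> dist_int (t + z) = dist_int t"
  by (rule dist_int_cong) simp

text \<open>Translates of the strip along \<open>k\<close> by multiples of \<open>3 \<epsilon>\<close> are pairwise disjoint and have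
  equal measure.\<close>

lemma measure_strip_le:
  assumes k: "k \<in> int_vec" "k \<noteq> 0" and \<epsilon>: "0 < \<epsilon>"
  shows "measure cube_measure {p \<in> cube3. dist_int (k \<bullet> p - c) \<le> \<epsilon>} \<le> 6 * \<epsilon>"
proof (cases "\<epsilon> \<le> 1 / 6")
  case False
  have "measure cube_measure {p \<in> cube3. dist_int (k \<bullet> p - c) \<le> \<epsilon>} \<le> 1" by simp
  with False show ?thesis by linarith
next
  case True
  \<comment> \<open>The number of shifts by \<open>3 * \<epsilon>\<close> that fit into one period.
    Two of them differ by between \<open>3 * \<epsilon>\<close> and
    \<open>1 - 3 * \<epsilon>\<close>, whereas a common point would put the difference within
    \<open>2 * \<epsilon>\<close> of an integer.\<close>
  define J where "J = nat \<lfloor>1 / (3 * \<epsilon>)\<rfloor>"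
  have J: "real J \<le> 1 / (3 * \<epsilon>)" "1 / (3 * \<epsilon>) - 1 < real J"
    unfolding J_def using \<epsilon> by (auto simp: of_nat_nat)
  have "1 / (6 * \<epsilon>) \<le> 1 / (3 * \<epsilon>) - 1" using True \<epsilon> by (simp add: field_simps)
  with J have J': "1 / (6 * \<epsilon>) \<le> real J" by linarith
  define f :: "real^3 \<Rightarrow> real" where "f p = indicator {p. dist_int (k \<bullet> p - c) \<le> \<epsilon>} p" for p
  define w where "w j = (- (3 * \<epsilon> * real j) / (k \<bullet> k)) *\<^sub>R k" for j :: nat
  have kw: "k \<bullet> w j = - (3 * \<epsilon> * real j)" for j
    using k(2) by (simp add: w_def)
  have mf [measurable]: "f \<in> borel_measurable borel"
    unfolding f_def by measurable
  have per: "periodic f"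
    unfolding periodic_def f_def
  proof (intro allI ballI)
    fix x m assume "m \<in> int_vec"
    then have "dist_int (k \<bullet> x - c + k \<bullet> m) = dist_int (k \<bullet> x - c)"
      by (intro dist_int_add_Ints int_vec_inner k)
    then show "indicator {p. dist_int (k \<bullet> p - c) \<le> \<epsilon>} (x + m)
        = (indicator {p. dist_int (k \<bullet> p - c) \<le> \<epsilon>} x :: real)"
      by (simp add: indicator_def inner_add_right algebra_simps)
  qed
  have bd: "\<bar>f x\<bar> \<le> 1" for x by (simp add: f_def indicator_def)
  have disj: "dist_int (k \<bullet> (p + w i) - c) \<le> \<epsilon> \<Longrightarrow> dist_int (k \<bullet> (p + w j) - c) \<le> \<epsilon> \<Longrightarrow>
      i < j \<Longrightarrow> j < J \<Longrightarrow> False" for p i j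
  proof -
    assume *: "dist_int (k \<bullet> (p + w i) - c) \<le> \<epsilon>" "dist_int (k \<bullet> (p + w j) - c) \<le> \<epsilon>" "i < j" "j < J"
    have "(k \<bullet> (p + w i) - c) + - (k \<bullet> (p + w j) - c) = 3 * \<epsilon> * (real j - real i)"
      by (simp add: inner_add_right kw algebra_simps)
    then have "dist_int (3 * \<epsilon> * (real j - real i)) \<le> 2 * \<epsilon>"
      using dist_int_triangle[of "k \<bullet> (p + w i) - c" "- (k \<bullet> (p + w j) - c)"]
        dist_int_minus[of "k \<bullet> (p + w j) - c"] *(1,2) by simp
    moreover have "3 * \<epsilon> * 1 \<le> 3 * \<epsilon> * (real j - real i)"
      using *(3) \<epsilon> by (intro mult_left_mono) auto
    moreover have "3 * \<epsilon> * (real j - real i) \<le> 3 * \<epsilon> * (real J - 1)"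
      using *(4) \<epsilon> by (intro mult_left_mono) auto
    moreover have "3 * \<epsilon> * real J \<le> 1" using J(1) \<epsilon> by (simp add: field_simps)
    ultimately show False
      using dist_int_ge[of "3 * \<epsilon>" "3 * \<epsilon> * (real j - real i)"] \<epsilon> by (simp add: algebra_simps)
  qed
  have sum_le: "(\<Sum>j<J. f (p + w j)) \<le> 1" for p
  proof (cases "\<exists>i<J. f (p + w i) \<noteq> 0")
    case True
    then obtain i where i: "i < J" "f (p + w i) \<noteq> 0" by blast
    have "f (p + w j) = 0" if "j \<in> {..<J} - {i}" for j
      using that i disj[of p i j] disj[of p j i]
      by (auto simp: f_def indicator_def split: if_splits) (metis linorder_neqE_nat)
    then have "(\<Sum>j<J. f (p + w j)) = f (p + w i)"
      using i by (subst sum.remove[of _ i]) auto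
    then show ?thesis using bd[of "p + w i"] by simp
  next
    case False
    then show ?thesis by simp
  qed
  have int: "integrable cube_measure (\<lambda>p. f (p + w j))" for j
    by (rule cube_integrable_bounded[where C = 1]) (use bd in auto)
  have "real J * (\<integral>p. f p \<partial>cube_measure) = (\<Sum>j<J. \<integral>p. f (p + w j) \<partial>cube_measure)"
    using integral_periodic_translate[OF mf per bd] by simp
  also have "\<dots> = (\<integral>p. (\<Sum>j<J. f (p + w j)) \<partial>cube_measure)"
    using int by simp
  also have "\<dots> \<le> (\<integral>p. 1 \<partial>cube_measure)"
    using int sum_le by (intro integral_mono) auto
  also have "\<dots> = 1" using cube.prob_space by simp
  finally have le: "real J * (\<integral>p. f p \<partial>cube_measure) \<le> 1" .
  have "(\<integral>p. f p \<partial>cube_measure) = (\<integral>p. indicator {p \<in> cube3. dist_int (k \<bullet> p - c) \<le> \<epsilon>} p \<partial>cube_measure)"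
    by (rule Bochner_Integration.integral_cong) (auto simp: f_def indicator_def)
  also have "\<dots> = measure cube_measure {p \<in> cube3. dist_int (k \<bullet> p - c) \<le> \<epsilon>}"
    by (simp add: Int_def conj_ac)
  finally have eq: "(\<integral>p. f p \<partial>cube_measure) = \<dots>" .
  have "1 / (6 * \<epsilon>) * (\<integral>p. f p \<partial>cube_measure) \<le> real J * (\<integral>p. f p \<partial>cube_measure)"
    using J' by (intro mult_right_mono) (auto simp: eq)
  with le have "1 / (6 * \<epsilon>) * (\<integral>p. f p \<partial>cube_measure) \<le> 1" by linarith
  then show ?thesis using \<epsilon> by (simp add: eq field_simps)
qed

section \<open>Continuity, compactness and integration on the torus\<close>

lemma dist_int_le_dist_torus3:
  "dist_int (x $ i - y $ i) \<le> dist (to_torus3 x) (to_torus3 y)"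
  unfolding dist_to_torus3 by (rule Max_ge) auto

text \<open>Rounding the coordinate differences selects the lift of \<open>y\<close> closest to the
  given lift of \<open>x\<close>. Its three coordinate distances are at most
  \<open>dist y x\<close>, and their sum bounds the Euclidean distance, whence
  \<open>d / 3\<close>.\<close>

lemma continuous_on_torus3I:
  fixes f :: "torus3 \<Rightarrow> 'a::metric_space"
  assumes "continuous_on UNIV (\<lambda>p. f (to_torus3 p))"
  shows "continuous_on UNIV f"
  unfolding continuous_on_iff
proof (intro ballI allI impI)
  fix x :: torus3 and e :: real assume "0 < e"
  let ?p = "rep_torus3 x"
  obtain d where d: "0 < d" "\<And>p'. dist p' ?p < d \<Longrightarrow> dist (f (to_torus3 p')) (f (to_torus3 ?p)) < e"
    using assms \<open>0 < e\<close> unfolding continuous_on_iff by (metis UNIV_I)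
  show "\<exists>d>0. \<forall>x'\<in>UNIV. dist x' x < d \<longrightarrow> dist (f x') (f x) < e"
  proof (intro exI conjI ballI impI)
    show "0 < d / 3" using d by simp
    fix y assume y: "dist y x < d / 3"
    let ?m = "\<chi> i. real_of_int (round (rep_torus3 y $ i - ?p $ i))"
    let ?p' = "rep_torus3 y - ?m"
    have "?m \<in> int_vec" by (simp add: int_vec_def)
    then have "to_torus3 ?p' = to_torus3 (rep_torus3 y)"
      using int_vec_uminus[of ?m] by (subst to_torus3_eq_iff) simp
    then have y': "to_torus3 ?p' = y" by (simp only: to_torus3_rep)
    have "\<bar>(?p' - ?p) $ i\<bar> < d / 3" for i
    proof -
      have "\<bar>(?p' - ?p) $ i\<bar> = dist_int (rep_torus3 y $ i - ?p $ i)"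
        by (simp add: dist_int_def algebra_simps)
      also have "\<dots> \<le> dist y x"
        using dist_int_le_dist_torus3[of "rep_torus3 y" i ?p] by simp
      finally show ?thesis using y by simp
    qed
    then have "(\<Sum>i\<in>UNIV. \<bar>(?p' - ?p) $ i\<bar>) < (\<Sum>i\<in>(UNIV::3 set). d / 3)"
      by (intro sum_strict_mono) auto
    then have "dist ?p' ?p < d"
      using norm_le_l1_cart[of "?p' - ?p"] by (simp add: dist_norm)
    from d(2)[OF this] show "dist (f y) (f x) < e" unfolding y' by simp
  qed
qed

lemma compact_torus3: "compact (UNIV :: torus3 set)"
proof -
  have "z \<in> to_torus3 ` cbox 0 1" for z
  proof -
    obtain p where "p \<in> cube3" "z = to_torus3 p" by (rule exists_cube_rep)
    then show ?thesis by (auto simp: cube3_def mem_box_cart less_imp_le intro!: image_eqI[of _ _ p])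
  qed
  then have "UNIV = to_torus3 ` cbox 0 1" by auto
  then show ?thesis
    using compact_continuous_image[OF continuous_on_to_torus3 compact_cbox] by metis
qed

lemma integral_torus3_lborel:
  fixes u :: "torus3 \<Rightarrow> real"
  assumes "u \<in> borel_measurable borel"
  shows "(\<integral>x. u x \<partial>torus3_lborel) = (\<integral>p. u (to_torus3 p) \<partial>cube_measure)"
  unfolding torus3_lborel_eq using assms
  by (intro integral_distr borel_measurable_cube_measure) auto

subsection \<open>Trigonometric polynomials and continuous approximation\<close>

text \<open>The phase \<open>d\<close> turns sines, and with \<open>k = 0\<close> constants, into
  instances of one clause, and it is what the product formula for cosines produces.\<close>

inductive trig_poly :: "(real^3 \<Rightarrow> real) \<Rightarrow> bool" where
  cos: "k \<in> int_vec \<Longrightarrow> trig_poly (\<lambda>p. c * cos (2 * pi * (k \<bullet> p) + d))"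
| add: "trig_poly f \<Longrightarrow> trig_poly g \<Longrightarrow> trig_poly (\<lambda>p. f p + g p)"

lemma trig_poly_const: "trig_poly (\<lambda>p. c)"
  using trig_poly.cos[of 0 c 0] by (simp add: int_vec_def)

lemma trig_poly_mult:
  assumes "trig_poly f" "trig_poly g"
  shows "trig_poly (\<lambda>p. f p * g p)"
  using assms
proof (induction arbitrary: g)
  case (cos k c d g)
  from cos(2) show ?case
  proof induction
    case (cos l b e)
    have "c * cos (2 * pi * (k \<bullet> p) + d) * (b * cos (2 * pi * (l \<bullet> p) + e)) =
        c * b / 2 * cos (2 * pi * ((k - l) \<bullet> p) + (d - e)) +
        c * b / 2 * cos (2 * pi * ((k + l) \<bullet> p) + (d + e))" for p
    proof -
      let ?X = "2 * pi * (k \<bullet> p) + d" and ?Y = "2 * pi * (l \<bullet> p) + e"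
      have "c * cos ?X * (b * cos ?Y) = c * b * (cos ?X * cos ?Y)" by (simp only: mult_ac)
      also have "\<dots> = c * b / 2 * cos (?X - ?Y) + c * b / 2 * cos (?X + ?Y)"
        unfolding cos_times_cos by (simp add: algebra_simps add_divide_distrib)
      also have "?X - ?Y = 2 * pi * ((k - l) \<bullet> p) + (d - e)" by (simp add: algebra_simps)
      also have "?X + ?Y = 2 * pi * ((k + l) \<bullet> p) + (d + e)" by (simp add: algebra_simps)
      finally show ?thesis .
    qed
    moreover have "trig_poly (\<lambda>p. c * b / 2 * cos (2 * pi * ((k - l) \<bullet> p) + (d - e)) +
        c * b / 2 * cos (2 * pi * ((k + l) \<bullet> p) + (d + e)))"
      using \<open>k \<in> int_vec\<close> cos by (intro trig_poly.intros int_vec_add int_vec_diff)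
    ultimately show ?case by simp
  next
    case (add f g)
    from trig_poly.add[OF add.IH] show ?case by (simp add: algebra_simps)
  qed
next
  case (add f h g)
  from trig_poly.add[OF add.IH[OF add.prems]] show ?case by (simp add: algebra_simps)
qed

lemma continuous_on_trig_poly: "trig_poly f \<Longrightarrow> continuous_on A f"
  by (induction rule: trig_poly.induct) (auto intro!: continuous_intros)

text \<open>Stone-Weierstrass on the compact torus. Points that differ in coordinate
  \<open>i\<close> modulo 1 are separated by a cosine in that coordinate with phase \<open>0\<close>
  or \<open>pi / 2\<close>, since cosine and sine together determine the angle.\<close>

lemma trig_poly_dense:
  assumes "continuous_on UNIV u" "0 < e"
  shows "\<exists>g. trig_poly g \<and> (\<forall>p. \<bar>u (to_torus3 p) - g p\<bar> < e)"
proof -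
  define P where "P f \<longleftrightarrow> trig_poly (\<lambda>p. f (to_torus3 p))" for f
  have "\<exists>g. P g \<and> (\<forall>x\<in>UNIV. \<bar>u x - g x\<bar> < e)"
  proof (rule Stone_Weierstrass_HOL)
    fix x y :: torus3 assume "x \<in> UNIV \<and> y \<in> UNIV \<and> x \<noteq> y"
    then have "rep_torus3 x - rep_torus3 y \<notin> int_vec" by (simp flip: to_torus3_eq_iff)
    then obtain i where i: "rep_torus3 x $ i - rep_torus3 y $ i \<notin> \<int>" by (auto simp: int_vec_def)
    define h where "h d z = cos (2 * pi * (axis i 1 \<bullet> rep_torus3 z) + d)" for d z
    have ax: "axis i (1::real) \<in> int_vec" by (simp add: int_vec_def axis_def)
    have P: "P (h d)" for d
      unfolding P_def h_def periodic_rep[OF periodic_cos[OF ax]]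
      using trig_poly.cos[OF ax, of 1] by simp
    have "\<exists>d. h d x \<noteq> h d y"
    proof (rule ccontr)
      assume "\<not> ?thesis"
      then have eq: "h d x = h d y" for d by blast
      have "cos (2 * pi * rep_torus3 x $ i) = cos (2 * pi * rep_torus3 y $ i)"
        using eq[of 0] by (simp add: h_def inner_axis' )
      moreover have "sin (2 * pi * rep_torus3 x $ i) = sin (2 * pi * rep_torus3 y $ i)"
        using eq[of "pi / 2"] by (simp add: h_def inner_axis' cos_add)
      ultimately obtain n :: int where "2 * pi * rep_torus3 x $ i = 2 * pi * rep_torus3 y $ i + 2 * pi * n"
        using sin_cos_eq_iff by metis
      then have "2 * pi * (rep_torus3 x $ i - rep_torus3 y $ i - n) = 0" by (simp add: algebra_simps)
      then have "rep_torus3 x $ i - rep_torus3 y $ i = n" by simp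
      with i show False by simp
    qed
    then show "\<exists>f. P f \<and> f x \<noteq> f y" using P by blast
  next
    fix f assume "P f"
    then show "continuous_on UNIV f"
      unfolding P_def by (intro continuous_on_torus3I continuous_on_trig_poly)
  qed (use assms trig_poly_const in \<open>auto simp: P_def compact_torus3 intro: trig_poly.add trig_poly_mult\<close>)
  then show ?thesis unfolding P_def by blast
qed

section \<open>From continuous functions to Borel sets\<close>

lemma closed_indicator_limit:
  fixes A :: "'a::metric_space set"
  assumes "closed A"
  obtains u :: "nat \<Rightarrow> 'a \<Rightarrow> real"
  where "\<And>m. continuous_on UNIV (u m)" "\<And>m x. 0 \<le> u m x" "\<And>m x. u m x \<le> 1"
    "\<And>x. (\<lambda>m. u m x) \<longlonglongrightarrow> indicator A x"
proof (cases "A = {}")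
  case True
  then show ?thesis by (intro that[of "\<lambda>_ _. 0"]) auto
next
  case False
  show ?thesis
  proof (rule that[of "\<lambda>m x. max 0 (1 - real m * infdist x A)"])
    fix x
    show "(\<lambda>m. max 0 (1 - real m * infdist x A)) \<longlonglongrightarrow> indicator A x"
    proof (cases "x \<in> A")
      case False
      then have pos: "0 < infdist x A"
        using assms \<open>A \<noteq> {}\<close> in_closed_iff_infdist_zero infdist_nonneg
        by (metis less_eq_real_def)
      have "eventually (\<lambda>m. max 0 (1 - real m * infdist x A) = 0) sequentially"
        using eventually_ge_at_top[of "nat \<lceil>1 / infdist x A\<rceil>"]
      proof eventually_elim
        case (elim m)
        then have "1 / infdist x A \<le> real m" by linarith
        then show ?case using pos by (simp add: field_simps)
      qed
      with False show ?thesis by (auto intro: tendsto_eventually)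
    qed simp
  qed (auto intro!: continuous_intros simp: infdist_nonneg)
qed

text \<open>Induction over the sets generated by the intersection-stable class of closed sets.
  Complements replace \<open>u\<close> by \<open>1 - u\<close>; in a disjoint union all but finitely
  many members have small total measure.\<close>

lemma continuous_L1_approximation:
  fixes M :: "'a::metric_space measure"
  assumes "finite_measure M" and M: "sets M = sets borel" and A: "A \<in> sets borel" and "0 < e"
  shows "\<exists>u. continuous_on UNIV u \<and> (\<forall>x. 0 \<le> u x \<and> u x \<le> 1) \<and>
    (\<integral>x. \<bar>indicator A x - u x\<bar> \<partial>M) < (e::real)"
proof -
  interpret finite_measure M by fact
  have meas: "u \<in> borel_measurable M" if "continuous_on UNIV u" for u :: "'a \<Rightarrow> real"
    using borel_measurable_continuous_onI[OF that] measurable_cong_sets[OF M refl] by blast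
  have ind: "(indicator A :: 'a \<Rightarrow> real) \<in> borel_measurable M" if "A \<in> sets borel" for A
    using that M by simp
  have int: "integrable M (\<lambda>x. \<bar>indicator A x - u x\<bar>)"
    if "A \<in> sets borel" "continuous_on UNIV u" "\<forall>x. 0 \<le> u x \<and> u x \<le> 1" for A and u :: "'a \<Rightarrow> real"
  proof (rule integrable_const_bound[where B = 1])
    show "AE x in M. norm \<bar>indicator A x - u x\<bar> \<le> 1"
    proof (rule AE_I2)
      fix x
      have "0 \<le> u x" "u x \<le> 1" using that(3) by auto
      then show "norm \<bar>indicator A x - u x\<bar> \<le> 1" by (simp add: indicator_def abs_le_iff)
    qed
  qed (use that meas ind in auto)
  have "Int_stable {S::'a set. closed S}" by (auto simp: Int_stable_def)
  moreover have "{S::'a set. closed S} \<subseteq> Pow UNIV" by simp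
  moreover have "A \<in> sigma_sets UNIV {S::'a set. closed S}"
    using A unfolding borel_eq_closed by (simp add: sets_measure_of)
  ultimately have "\<forall>e>0. \<exists>u. continuous_on UNIV u \<and> (\<forall>x. 0 \<le> u x \<and> u x \<le> 1) \<and>
    (\<integral>x. \<bar>indicator A x - u x\<bar> \<partial>M) < (e::real)" (is "?P A")
  proof (induction rule: sigma_sets_induct_disjoint)
    case (basic A)
    then obtain u :: "nat \<Rightarrow> 'a \<Rightarrow> real"
      where u: "\<And>m. continuous_on UNIV (u m)" "\<And>m x. 0 \<le> u m x" "\<And>m x. u m x \<le> 1"
        "\<And>x. (\<lambda>m. u m x) \<longlonglongrightarrow> indicator A x"
      using closed_indicator_limit by blast
    have "(\<lambda>m. \<integral>x. \<bar>indicator A x - u m x\<bar> \<partial>M) \<longlonglongrightarrow> (\<integral>x. 0 \<partial>M)"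
    proof (rule integral_dominated_convergence[where w = "\<lambda>_. 1"])
      show "AE x in M. (\<lambda>m. \<bar>indicator A x - u m x\<bar>) \<longlonglongrightarrow> 0"
      proof (rule AE_I2)
        fix x
        have "(\<lambda>m. \<bar>indicator A x - u m x\<bar>) \<longlonglongrightarrow> \<bar>indicator A x - indicator A x\<bar>"
          by (intro tendsto_intros u)
        then show "(\<lambda>m. \<bar>indicator A x - u m x\<bar>) \<longlonglongrightarrow> 0" by simp
      qed
      show "AE x in M. norm \<bar>indicator A x - u m x\<bar> \<le> 1" for m
      proof (rule AE_I2)
        fix x
        show "norm \<bar>indicator A x - u m x\<bar> \<le> 1"
          using u(2,3)[of m x] by (simp add: indicator_def abs_le_iff)
      qed
      show "(\<lambda>x. \<bar>indicator A x - u m x\<bar>) \<in> borel_measurable M" for m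
        using meas[OF u(1)] ind[of A] basic by auto
    qed auto
    then have lim: "(\<lambda>m. \<integral>x. \<bar>indicator A x - u m x\<bar> \<partial>M) \<longlonglongrightarrow> 0" by simp
    show ?case
    proof (intro allI impI)
      fix e :: real assume "0 < e"
      with lim have "eventually (\<lambda>m. (\<integral>x. \<bar>indicator A x - u m x\<bar> \<partial>M) < e) sequentially"
        by (rule order_tendstoD)
      then obtain m where "(\<integral>x. \<bar>indicator A x - u m x\<bar> \<partial>M) < e"
        using eventually_happens sequentially_bot by blast
      with u show "\<exists>u. continuous_on UNIV u \<and> (\<forall>x. 0 \<le> u x \<and> u x \<le> 1) \<and>
          (\<integral>x. \<bar>indicator A x - u x\<bar> \<partial>M) < e" by blast
    qed
  next
    case empty
    show ?case by (auto intro!: exI[of _ "\<lambda>_. 0"])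
  next
    case (compl A)
    show ?case
    proof (intro allI impI)
      fix e :: real assume "0 < e"
      with compl obtain u where "continuous_on UNIV u" "\<forall>x. 0 \<le> u x \<and> u x \<le> 1"
        "(\<integral>x. \<bar>indicator A x - u x\<bar> \<partial>M) < e" by blast
      moreover have "(\<integral>x. \<bar>indicator (UNIV - A) x - (1 - u x)\<bar> \<partial>M) = (\<integral>x. \<bar>indicator A x - u x\<bar> \<partial>M)"
        by (rule Bochner_Integration.integral_cong) (auto simp: indicator_def abs_minus_commute)
      ultimately show "\<exists>u. continuous_on UNIV u \<and> (\<forall>x. 0 \<le> u x \<and> u x \<le> 1) \<and>
          (\<integral>x. \<bar>indicator (UNIV - A) x - u x\<bar> \<partial>M) < e"
        by (intro exI[of _ "\<lambda>x. 1 - u x"]) (auto intro!: continuous_intros)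
    qed
  next
    case (union A)
    have A: "A i \<in> sets borel" for i
      using union(2) unfolding borel_eq_closed by (auto simp: sets_measure_of)
    have lim: "(\<lambda>n. measure M (\<Union>i\<in>{n..}. A i)) \<longlonglongrightarrow> 0"
    proof -
      have "(\<Inter>n. \<Union>i\<in>{n..}. A i) = {}"
      proof safe
        fix x assume x: "x \<in> (\<Inter>n. \<Union>i\<in>{n..}. A i)"
        then obtain i where i: "x \<in> A i" by auto
        from x obtain j where "j \<ge> Suc i" "x \<in> A j" by blast
        with i union(1) show "x \<in> {}" by (auto simp: disjoint_family_on_def) (metis Suc_n_not_le_n disjoint_iff)
      qed
      moreover have "(\<lambda>n. measure M (\<Union>i\<in>{n..}. A i)) \<longlonglongrightarrow> measure M (\<Inter>n. \<Union>i\<in>{n..}. A i)"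
        using A by (intro finite_Lim_measure_decseq) (auto simp: M decseq_def intro: order_trans)
      ultimately show ?thesis by simp
    qed
    show ?case
    proof (intro allI impI)
      fix e :: real assume e: "0 < e"
      with lim have "eventually (\<lambda>n. measure M (\<Union>i\<in>{n..}. A i) < e / 2) sequentially"
        by (intro order_tendstoD) auto
      then obtain n where n: "measure M (\<Union>i\<in>{n..}. A i) < e / 2"
        using eventually_happens sequentially_bot by blast
      have "\<forall>i. \<exists>u. continuous_on UNIV u \<and> (\<forall>x. 0 \<le> u x \<and> u x \<le> 1) \<and>
          (\<integral>x. \<bar>indicator (A i) x - u x\<bar> \<partial>M) < e / (2 * real (Suc n))"
        using union(3) e by (auto simp del: of_nat_Suc)
      then obtain u where u: "\<And>i. continuous_on UNIV (u i)" "\<And>i. \<forall>x. 0 \<le> u i x \<and> u i x \<le> 1"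
        "\<And>i. (\<integral>x. \<bar>indicator (A i) x - u i x\<bar> \<partial>M) < e / (2 * real (Suc n))"
        by metis
      \<comment> \<open>Cutting the sum at 1 only brings it closer to an indicator.\<close>
      define U where "U x = min 1 (\<Sum>i<n. u i x)" for x
      have U: "continuous_on UNIV U" "\<forall>x. 0 \<le> U x \<and> U x \<le> 1"
        unfolding U_def using u(2) by (auto intro!: continuous_intros u sum_nonneg)
      let ?B = "\<Union>i\<in>{n..}. A i"
      have B: "?B \<in> sets M" using A M by auto
      have "\<bar>indicator (\<Union>i. A i) x - U x\<bar> \<le>
          (\<Sum>i<n. \<bar>indicator (A i) x - u i x\<bar>) + indicator ?B x" for x
      proof -
        have "indicator (\<Union>i. A i) x \<le> (\<Sum>i<n. indicator (A i) x) + (indicator ?B x :: real)"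
        proof (cases "x \<in> (\<Union>i. A i)")
          case True
          then obtain i where i: "x \<in> A i" by blast
          show ?thesis
          proof (cases "i < n")
            case True
            have "(indicator (A i) x :: real) \<le> (\<Sum>i<n. indicator (A i) x)"
              using True by (intro member_le_sum) auto
            with i show ?thesis by (simp add: indicator_def)
          next
            case False
            with i have "x \<in> ?B" by auto
            then show ?thesis by (simp add: indicator_def sum_nonneg)
          qed
        qed (simp add: sum_nonneg)
        moreover have "(\<Sum>i<n. indicator (A i) x) \<le> (indicator (\<Union>i. A i) x :: real)"
        proof (cases "\<exists>i<n. x \<in> A i")
          case True
          then obtain i where i: "i < n" "x \<in> A i" by blast
          then have "x \<notin> A j" if "j \<noteq> i" for j
            using union(1) that by (auto simp: disjoint_family_on_def)
          then have "(\<Sum>i<n. indicator (A i) x :: real) = (\<Sum>j<n. if j = i then 1 else 0)"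
            using i by (intro sum.cong) (auto simp: indicator_def)
          with i show ?thesis by (auto simp: indicator_def)
        qed (simp add: indicator_def)
        moreover have "\<bar>(\<Sum>i<n. indicator (A i) x) - (\<Sum>i<n. u i x)\<bar> \<le> (\<Sum>i<n. \<bar>indicator (A i) x - u i x\<bar>)"
          unfolding sum_subtractf[symmetric] by (rule sum_abs)
        moreover have "0 \<le> (indicator ?B x :: real)" "(indicator (\<Union>i. A i) x :: real) \<le> 1"
          by (auto simp: indicator_def)
        moreover have "0 \<le> (\<Sum>i<n. u i x)" using u(2) by (simp add: sum_nonneg)
        ultimately show ?thesis unfolding U_def by linarith
      qed
      then have "(\<integral>x. \<bar>indicator (\<Union>i. A i) x - U x\<bar> \<partial>M) \<le>
          (\<integral>x. (\<Sum>i<n. \<bar>indicator (A i) x - u i x\<bar>) + indicator ?B x \<partial>M)"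
        using A B u U
        by (intro integral_mono int Bochner_Integration.integrable_add Bochner_Integration.integrable_sum
            integrable_real_indicator) (auto simp: emeasure_eq_measure)
      also have "\<dots> = (\<Sum>i<n. \<integral>x. \<bar>indicator (A i) x - u i x\<bar> \<partial>M) + measure M ?B"
        using A B u
        by (subst Bochner_Integration.integral_add)
          (auto intro!: int Bochner_Integration.integral_sum Bochner_Integration.integrable_sum
            integrable_real_indicator simp: emeasure_eq_measure)
      also have "(\<Sum>i<n. \<integral>x. \<bar>indicator (A i) x - u i x\<bar> \<partial>M) \<le> (\<Sum>i<n. e / (2 * real (Suc n)))"
        by (intro sum_mono less_imp_le u)
      also have "\<dots> \<le> e / 2" using e by (simp add: field_simps)
      finally have "(\<integral>x. \<bar>indicator (\<Union>i. A i) x - U x\<bar> \<partial>M) < e" using n by simp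
      with U show "\<exists>u. continuous_on UNIV u \<and> (\<forall>x. 0 \<le> u x \<and> u x \<le> 1) \<and>
          (\<integral>x. \<bar>indicator (\<Union>i. A i) x - u x\<bar> \<partial>M) < e" by blast
    qed
  qed
  with \<open>0 < e\<close> show ?thesis by blast
qed

text \<open>Continuous functions decreasing to the indicator determine the measure of each closed
  set, and the closed sets are an intersection-stable generator.\<close>

lemma distr_eqI_continuous:
  fixes M :: "'a::metric_space measure"
  assumes "finite_measure M" and M: "sets M = sets borel" and T: "T \<in> borel_measurable borel"
    and eq: "\<And>u :: 'a \<Rightarrow> real. continuous_on UNIV u \<Longrightarrow> (\<And>x. 0 \<le> u x) \<Longrightarrow> (\<And>x. u x \<le> 1) \<Longrightarrow>
      (\<integral>x. u (T x) \<partial>M) = (\<integral>x. u x \<partial>M)"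
  shows "distr M M T = M"
proof -
  interpret finite_measure M by fact
  have [measurable]: "T \<in> measurable M M"
    using T measurable_cong_sets[OF M M] by simp
  have sp: "space M = UNIV" using sets_eq_imp_space_eq[OF M] by simp
  have closed: "measure M (T -` A) = measure M A" if cl: "closed A" for A
  proof -
    obtain u :: "nat \<Rightarrow> 'a \<Rightarrow> real"
      where u: "\<And>m. continuous_on UNIV (u m)" "\<And>m x. 0 \<le> u m x" "\<And>m x. u m x \<le> 1"
        "\<And>x. (\<lambda>m. u m x) \<longlonglongrightarrow> indicator A x"
      using closed_indicator_limit[OF cl] by blast
    have A [measurable]: "A \<in> sets M" using cl M by simp
    have [measurable]: "u m \<in> borel_measurable M" for m
      using borel_measurable_continuous_onI[OF u(1)] measurable_cong_sets[OF M refl] by blast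
    have "(\<lambda>m. \<integral>x. u m x \<partial>M) \<longlonglongrightarrow> (\<integral>x. indicator A x \<partial>M)"
      by (rule integral_dominated_convergence[where w = "\<lambda>_. 1"]) (use u in auto)
    moreover have "(\<lambda>m. \<integral>x. u m (T x) \<partial>M) \<longlonglongrightarrow> (\<integral>x. indicator A (T x) \<partial>M)"
      by (rule integral_dominated_convergence[where w = "\<lambda>_. 1"]) (use u in auto)
    ultimately have "(\<integral>x. indicator A (T x) \<partial>M) = (\<integral>x. indicator A x \<partial>M :: real)"
      using eq[OF u(1,2,3)] LIMSEQ_unique by auto
    moreover have "(\<lambda>x. indicator A (T x) :: real) = indicator (T -` A)"
      by (auto simp: indicator_def)
    ultimately show ?thesis by (simp add: sp)
  qed
  show ?thesis
  proof (rule measure_eqI_generator_eq[where E = "{S. closed S}" and \<Omega> = UNIV and A = "\<lambda>_. UNIV"])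
    show "Int_stable {S::'a set. closed S}" by (auto simp: Int_stable_def)
    show "emeasure (distr M M T) X = emeasure M X" if "X \<in> {S. closed S}" for X
      using that closed[of X] M by (subst emeasure_distr) (auto simp: emeasure_eq_measure sp)
    show "sets (distr M M T) = sigma_sets UNIV {S. closed S}" "sets M = sigma_sets UNIV {S. closed S}"
      unfolding sets_distr M by (simp_all add: borel_eq_closed sets_measure_of)
    show "emeasure (distr M M T) UNIV \<noteq> \<infinity>"
      using emeasure_distr[of T M M UNIV] M by (simp add: emeasure_eq_measure)
  qed auto
qed

subsection \<open>Reparametrised linear flows\<close>

text \<open>Weierstrass test: the bounds \<open>b\<close> make the differentiated series converge
  uniformly in operator norm. A general \<open>S\<close> is allowed because the bounds for
  \<open>H\<close> hold only on bounded sets.\<close>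

lemma has_derivative_suminf:
  fixes f :: "nat \<Rightarrow> 'a::real_normed_vector \<Rightarrow> real"
  assumes S: "open S" "convex S"
    and der: "\<And>n x. x \<in> S \<Longrightarrow> (f n has_derivative f' n x) (at x)"
    and bd: "\<And>n x h. x \<in> S \<Longrightarrow> \<bar>f' n x h\<bar> \<le> b n * norm h"
    and b: "summable b"
    and x0: "x0 \<in> S" "summable (\<lambda>n. f n x0)" and x: "x \<in> S"
  shows "((\<lambda>x. \<Sum>n. f n x) has_derivative (\<lambda>h. \<Sum>n. f' n x h)) (at x)"
proof -
  define g' where "g' x h = (\<Sum>n. f' n x h)" for x h
  have sm: "summable (\<lambda>n. f' n x h)" if "x \<in> S" for x h
    by (rule summable_comparison_test'[OF summable_mult2[OF b, of "norm h"]]) (use bd that in auto)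
  have tail: "\<forall>\<^sub>F n in sequentially. \<forall>x\<in>S. \<forall>h. norm (sum (\<lambda>i. f' i x h) {..<n} - g' x h) \<le> e * norm h"
    if "e > 0" for e
  proof -
    have "(\<lambda>n. sum b {..<n}) \<longlonglongrightarrow> suminf b" by (rule summable_LIMSEQ[OF b])
    then have "\<forall>\<^sub>F n in sequentially. dist (sum b {..<n}) (suminf b) < e"
      using that by (rule tendstoD)
    then show ?thesis
    proof eventually_elim
      case (elim n)
      show ?case
      proof (intro ballI allI)
        fix x h :: 'a assume "x \<in> S"
        have sb: "summable (\<lambda>i. b (i + n) * norm h)"
          using b by (intro summable_mult2) (simp add: summable_iff_shift)
        have sn: "summable (\<lambda>i. norm (f' (i + n) x h))"
          by (rule summable_comparison_test'[OF sb]) (use bd \<open>x \<in> S\<close> in auto)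
        have "g' x h = (\<Sum>i. f' (i + n) x h) + sum (\<lambda>i. f' i x h) {..<n}"
          unfolding g'_def by (rule suminf_split_initial_segment[OF sm[OF \<open>x \<in> S\<close>]])
        then have "norm (sum (\<lambda>i. f' i x h) {..<n} - g' x h) = norm (\<Sum>i. f' (i + n) x h)"
          by simp
        also have "\<dots> \<le> (\<Sum>i. norm (f' (i + n) x h))" by (rule summable_norm[OF sn])
        also have "\<dots> \<le> (\<Sum>i. b (i + n) * norm h)"
          using bd \<open>x \<in> S\<close> by (intro suminf_le sn sb) auto
        also have "\<dots> = (\<Sum>i. b (i + n)) * norm h"
          using b by (intro suminf_mult2[symmetric]) (simp add: summable_iff_shift)
        also have "(\<Sum>i. b (i + n)) = suminf b - sum b {..<n}"
          by (rule suminf_minus_initial_segment[OF b])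
        also have "(suminf b - sum b {..<n}) * norm h \<le> e * norm h"
          using elim by (intro mult_right_mono) (auto simp: dist_real_def)
        finally show "norm (sum (\<lambda>i. f' i x h) {..<n} - g' x h) \<le> e * norm h" .
      qed
    qed
  qed
  obtain g where g: "\<And>x. x \<in> S \<Longrightarrow> (\<lambda>n. f n x) sums g x \<and> (g has_derivative g' x) (at x within S)"
    using has_derivative_series[OF S(2) has_derivative_at_withinI[OF der] tail x0(1) summable_sums[OF x0(2)]]
    by blast
  have "(g has_derivative g' x) (at x)"
    using g[OF x] at_within_open[OF x S(1)] by simp
  then have "((\<lambda>x. \<Sum>n. f n x) has_derivative g' x) (at x)"
    by (rule has_derivative_transform_within_open[OF _ S(1) x]) (use g sums_unique in auto)
  then show ?thesis by (simp add: g'_def[abs_def])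
qed

lemma abs_sin_diff_le: "\<bar>sin x - sin y\<bar> \<le> \<bar>x - y\<bar>" for x y :: real
proof -
  have "\<bar>sin x - sin y\<bar> = 2 * \<bar>sin ((x - y) / 2)\<bar> * \<bar>cos ((x + y) / 2)\<bar>"
    by (simp add: sin_diff_sin abs_mult)
  also have "\<dots> \<le> 2 * \<bar>(x - y) / 2\<bar> * 1"
    by (intro mult_mono abs_sin_x_le_abs_x) auto
  finally show ?thesis by simp
qed

lemma sin_shift_pi_half: "sin (y + (\<phi> + pi / 2)) = cos (y + \<phi>)"
  using sin_add[of "y + \<phi>" "pi / 2"] by (simp add: add.assoc)

lemma cos_shift_pi_half: "cos (y + (\<phi> + pi / 2)) = - sin (y + \<phi>)"
  using cos_add[of "y + \<phi>" "pi / 2"] by (simp add: add.assoc)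

lemma suminf_add_mult:
  fixes f g :: "nat \<Rightarrow> real"
  assumes "summable f" "summable g"
  shows "(\<Sum>n. f n + c * g n) = suminf f + c * suminf g"
  using suminf_add[OF assms(1) summable_mult[OF assms(2), of c]] suminf_mult[OF assms(2), of c] by simp

text \<open>\<open>a_rapid\<close> makes the density smooth, \<open>a_small\<close> keeps it between
  \<open>1 / 2\<close> and \<open>3 / 2\<close>, and \<open>nonresonant\<close> permits division by
  the derivative of a character along \<open>v\<close>.\<close>

locale time_changed_flow =
  fixes v :: "real^3" and k :: "nat \<Rightarrow> real^3" and a :: "nat \<Rightarrow> real"
  assumes k_int: "k n \<in> int_vec" and k_nz: "k n \<noteq> 0"
    and nonresonant: "l \<in> int_vec \<Longrightarrow> l \<noteq> 0 \<Longrightarrow> l \<bullet> v \<noteq> 0"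
    and a_nonneg: "0 \<le> a n"
    and a_rapid: "summable (\<lambda>n. a n * (1 + norm (k n)) ^ m)"
    and a_small: "suminf a \<le> 1 / 2"
begin

definition \<omega> :: "nat \<Rightarrow> real" where "\<omega> n = 2 * pi * (k n \<bullet> v)"

lemma \<omega>_nz: "\<omega> n \<noteq> 0"
  using nonresonant[OF k_int k_nz] by (simp add: \<omega>_def)

text \<open>A pair \<open>(p, s)\<close> stands for the point \<open>p + s *\<^sub>R v\<close>, with
  base point and position on the line kept as separate variables for differentiation.\<close>

definition phase :: "nat \<Rightarrow> (real^3) \<times> real \<Rightarrow> real" where
  "phase n x = 2 * pi * (k n \<bullet> fst x) + \<omega> n * snd x"

text \<open>Stable under multiplication by factors linear in \<open>k n\<close>, that is, under
  differentiation of the series.\<close>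

definition rapid :: "(nat \<Rightarrow> real) \<Rightarrow> bool" where
  "rapid c \<longleftrightarrow> (\<forall>m. summable (\<lambda>n. \<bar>c n\<bar> * (1 + norm (k n)) ^ m))"

text \<open>Differentiating a cosine adds \<open>pi / 2\<close> to its phase, so with
  \<open>\<phi>\<close> as a parameter the family is closed under derivatives.\<close>

definition G :: "(nat \<Rightarrow> real) \<Rightarrow> real \<Rightarrow> (real^3) \<times> real \<Rightarrow> real" where
  "G c \<phi> x = (\<Sum>n. c n * cos (phase n x + \<phi>))"

text \<open>The integral of \<open>G c \<phi> (p, \<sigma>)\<close> over \<open>\<sigma>\<close> from \<open>0\<close> to \<open>s\<close>, at \<open>x = (p, s)\<close>.\<close>

definition H :: "(nat \<Rightarrow> real) \<Rightarrow> real \<Rightarrow> (real^3) \<times> real \<Rightarrow> real" where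
  "H c \<phi> x = (\<Sum>n. c n * ((sin (phase n x + \<phi>) - sin (phase n (fst x, 0) + \<phi>)) / \<omega> n))"

lemma rapid_a: "rapid a"
  using a_rapid a_nonneg by (simp add: rapid_def)

lemma rapid_mult:
  assumes "rapid c" "\<And>n. \<bar>b n\<bar> \<le> C * (1 + norm (k n))"
  shows "rapid (\<lambda>n. c n * b n)"
  unfolding rapid_def
proof
  fix m
  have s: "summable (\<lambda>n. C * (\<bar>c n\<bar> * (1 + norm (k n)) ^ Suc m))"
    using assms(1) unfolding rapid_def by (intro summable_mult) blast
  have bd: "\<bar>c n * b n\<bar> * (1 + norm (k n)) ^ m \<le> C * (\<bar>c n\<bar> * (1 + norm (k n)) ^ Suc m)" for n
  proof -
    have "\<bar>b n\<bar> * (\<bar>c n\<bar> * (1 + norm (k n)) ^ m) \<le> C * (1 + norm (k n)) * (\<bar>c n\<bar> * (1 + norm (k n)) ^ m)"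
      by (intro mult_right_mono assms(2)) auto
    then show ?thesis by (simp add: abs_mult mult_ac)
  qed
  show "summable (\<lambda>n. \<bar>c n * b n\<bar> * (1 + norm (k n)) ^ m)"
    by (rule summable_comparison_test'[OF s, of 0]) (use bd in \<open>simp add: abs_mult\<close>)
qed

lemma inner_k_le: "\<bar>2 * pi * (k n \<bullet> w)\<bar> \<le> 2 * pi * norm w * (1 + norm (k n))"
proof -
  have "\<bar>k n \<bullet> w\<bar> \<le> (1 + norm (k n)) * norm w"
    using Cauchy_Schwarz_ineq2[of "k n" w] by (simp add: algebra_simps add_increasing)
  then have "2 * pi * \<bar>k n \<bullet> w\<bar> \<le> 2 * pi * ((1 + norm (k n)) * norm w)"
    by (intro mult_left_mono) auto
  then show ?thesis by (simp add: abs_mult mult_ac)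
qed

lemma rapid_inner: "rapid c \<Longrightarrow> rapid (\<lambda>n. c n * (2 * pi * (k n \<bullet> w)))"
  by (rule rapid_mult[OF _ inner_k_le])

lemma rapid_\<omega>: "rapid c \<Longrightarrow> rapid (\<lambda>n. c n * \<omega> n)"
  unfolding \<omega>_def by (rule rapid_inner)

lemma rapid_summable: "rapid c \<Longrightarrow> summable (\<lambda>n. \<bar>c n\<bar>)"
  unfolding rapid_def by (drule spec[of _ 0]) simp

lemma summable_bounded: "rapid c \<Longrightarrow> (\<And>n. \<bar>b n\<bar> \<le> B) \<Longrightarrow> summable (\<lambda>n. c n * b n)"
  by (rule summable_comparison_test'[OF summable_mult[OF rapid_summable], of c 0 _ B])
     (auto simp: abs_mult mult.commute intro!: mult_right_mono)

lemma abs_suminf_bounded: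
  assumes "rapid c" "\<And>n. \<bar>b n\<bar> \<le> B"
  shows "\<bar>\<Sum>n. c n * b n\<bar> \<le> B * (\<Sum>n. \<bar>c n\<bar>)"
proof -
  have s: "summable (\<lambda>n. B * \<bar>c n\<bar>)" by (intro summable_mult rapid_summable assms)
  have le: "norm (c n * b n) \<le> B * \<bar>c n\<bar>" for n
    using mult_right_mono[OF assms(2)[of n], of "\<bar>c n\<bar>"] by (simp add: abs_mult mult.commute)
  have s': "summable (\<lambda>n. norm (c n * b n))"
    by (rule summable_comparison_test'[OF s, of 0]) (use le in auto)
  have "\<bar>\<Sum>n. c n * b n\<bar> \<le> (\<Sum>n. norm (c n * b n))"
    using summable_norm[OF s'] by simp
  also have "\<dots> \<le> (\<Sum>n. B * \<bar>c n\<bar>)" by (rule suminf_le[OF le s' s])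
  also have "\<dots> = B * (\<Sum>n. \<bar>c n\<bar>)" by (rule suminf_mult[OF rapid_summable[OF assms(1)]])
  finally show ?thesis .
qed

lemma phase_diff: "phase n (p, s) - phase n (p, s') = \<omega> n * (s - s')"
  by (simp add: phase_def algebra_simps)

text \<open>Small denominators do no harm: the numerator is proportionally small, and the quotient
  is bounded by the elapsed parameter uniformly in \<open>n\<close>.\<close>

lemma sin_quotient_le: "\<bar>(sin (phase n (p, s) + \<phi>) - sin (phase n (p, s') + \<phi>)) / \<omega> n\<bar> \<le> \<bar>s - s'\<bar>"
proof -
  have "\<bar>sin (phase n (p, s) + \<phi>) - sin (phase n (p, s') + \<phi>)\<bar> \<le> \<bar>\<omega> n\<bar> * \<bar>s - s'\<bar>"
    using abs_sin_diff_le[of "phase n (p, s) + \<phi>" "phase n (p, s') + \<phi>"] phase_diff[of n p s s']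
    by (simp add: abs_mult)
  then show ?thesis using \<omega>_nz by (simp add: divide_le_eq mult.commute)
qed

lemma summable_G: "rapid c \<Longrightarrow> summable (\<lambda>n. c n * cos (phase n x + \<phi>))"
  by (rule summable_bounded[where B = 1]) auto

lemma summable_H:
  "rapid c \<Longrightarrow> summable (\<lambda>n. c n * ((sin (phase n x + \<phi>) - sin (phase n (fst x, 0) + \<phi>)) / \<omega> n))"
  using sin_quotient_le[of _ "fst x" "snd x" \<phi> 0]
  by (intro summable_bounded[where B = "\<bar>snd x\<bar>"]) auto

lemma abs_G_le: "rapid c \<Longrightarrow> \<bar>G c \<phi> x\<bar> \<le> (\<Sum>n. \<bar>c n\<bar>)"
  unfolding G_def using abs_suminf_bounded[of c _ 1] by simp

lemma abs_H_le: "rapid c \<Longrightarrow> \<bar>H c \<phi> (p, s)\<bar> \<le> \<bar>s\<bar> * (\<Sum>n. \<bar>c n\<bar>)"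
  unfolding H_def using sin_quotient_le[of _ p s \<phi> 0]
  by (intro abs_suminf_bounded) auto

lemma phase_deriv_le:
  "\<bar>2 * pi * (k n \<bullet> fst h) + \<omega> n * snd h\<bar> \<le> (1 + norm (k n)) * (2 * pi * (1 + norm v)) * norm h"
proof -
  have "2 * pi * (k n \<bullet> fst h) + \<omega> n * snd h = 2 * pi * (k n \<bullet> (fst h + snd h *\<^sub>R v))"
    by (simp add: \<omega>_def algebra_simps)
  then have "\<bar>2 * pi * (k n \<bullet> fst h) + \<omega> n * snd h\<bar>
      \<le> 2 * pi * norm (fst h + snd h *\<^sub>R v) * (1 + norm (k n))"
    using inner_k_le[of n "fst h + snd h *\<^sub>R v"] by (simp only:)
  also have "\<dots> \<le> 2 * pi * ((1 + norm v) * norm h) * (1 + norm (k n))"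
  proof (intro mult_right_mono mult_left_mono)
    have "norm (fst h + snd h *\<^sub>R v) \<le> norm (fst h) + \<bar>snd h\<bar> * norm v"
      using norm_triangle_ineq[of "fst h" "snd h *\<^sub>R v"] by simp
    also have "\<dots> \<le> norm h + norm h * norm v"
      using norm_fst_le[of "fst h" "snd h"] norm_snd_le[of "snd h" "fst h"]
      by (intro add_mono mult_right_mono) auto
    finally show "norm (fst h + snd h *\<^sub>R v) \<le> (1 + norm v) * norm h" by (simp add: algebra_simps)
  qed auto
  finally show ?thesis by (simp add: mult_ac)
qed

lemma G_has_derivative:
  assumes c: "rapid c"
  shows "(G c \<phi> has_derivative (\<lambda>h. G (\<lambda>n. c n * (2 * pi * (k n \<bullet> fst h))) (\<phi> + pi / 2) x
      + snd h * G (\<lambda>n. c n * \<omega> n) (\<phi> + pi / 2) x)) (at x)"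
proof -
  let ?f' = "\<lambda>n x h. - c n * sin (phase n x + \<phi>) * (2 * pi * (k n \<bullet> fst h) + \<omega> n * snd h)"
  have "((\<lambda>x. \<Sum>n. c n * cos (phase n x + \<phi>)) has_derivative (\<lambda>h. \<Sum>n. ?f' n x h)) (at x)"
  proof (rule has_derivative_suminf[where S = UNIV and x0 = x and f' = ?f' and f = "\<lambda>n x. c n * cos (phase n x + \<phi>)"
        and b = "\<lambda>n. (\<bar>c n\<bar> * (1 + norm (k n)) ^ 1) * (2 * pi * (1 + norm v))"])
    show "((\<lambda>x. c n * cos (phase n x + \<phi>)) has_derivative ?f' n x) (at x)" for n x
      unfolding phase_def by (rule derivative_eq_intros refl | simp add: algebra_simps)+
    show "\<bar>?f' n x h\<bar> \<le> \<bar>c n\<bar> * (1 + norm (k n)) ^ 1 * (2 * pi * (1 + norm v)) * norm h" for n x h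
    proof -
      have "\<bar>?f' n x h\<bar> = \<bar>c n\<bar> * \<bar>sin (phase n x + \<phi>)\<bar> * \<bar>2 * pi * (k n \<bullet> fst h) + \<omega> n * snd h\<bar>"
        by (simp add: abs_mult)
      also have "\<dots> \<le> \<bar>c n\<bar> * 1 * ((1 + norm (k n)) * (2 * pi * (1 + norm v)) * norm h)"
        by (intro mult_mono phase_deriv_le) auto
      finally show ?thesis by (simp add: mult_ac)
    qed
    show "summable (\<lambda>n. \<bar>c n\<bar> * (1 + norm (k n)) ^ 1 * (2 * pi * (1 + norm v)))"
      using c unfolding rapid_def by (intro summable_mult2) blast
  qed (use summable_G[OF c] in auto)
  moreover have "(\<Sum>n. ?f' n x h) = G (\<lambda>n. c n * (2 * pi * (k n \<bullet> fst h))) (\<phi> + pi / 2) x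
      + snd h * G (\<lambda>n. c n * \<omega> n) (\<phi> + pi / 2) x" for h
  proof -
    have "?f' n x h = c n * (2 * pi * (k n \<bullet> fst h)) * cos (phase n x + (\<phi> + pi / 2))
        + snd h * (c n * \<omega> n * cos (phase n x + (\<phi> + pi / 2)))" for n
      unfolding cos_shift_pi_half by (simp add: algebra_simps)
    then show ?thesis
      unfolding G_def
      by (simp only: suminf_add_mult[OF summable_G[OF rapid_inner[OF c]] summable_G[OF rapid_\<omega>[OF c]]])
  qed
  ultimately show ?thesis unfolding G_def[abs_def] by simp
qed

lemma H_has_derivative:
  assumes c: "rapid c"
  shows "(H c \<phi> has_derivative (\<lambda>h. H (\<lambda>n. c n * (2 * pi * (k n \<bullet> fst h))) (\<phi> + pi / 2) x
      + snd h * G c \<phi> x)) (at x)"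
proof -
  \<comment> \<open>The sine quotients are bounded only by \<open>\<bar>snd x\<bar>\<close>, so the
    series is majorised on a ball instead of the whole space.\<close>
  define B where "B = norm x + 1"
  have x: "x \<in> ball 0 B" by (simp add: B_def)
  define D where "D n x h = (cos (phase n x + \<phi>) * (2 * pi * (k n \<bullet> fst h) + \<omega> n * snd h)
      - cos (phase n (fst x, 0) + \<phi>) * (2 * pi * (k n \<bullet> fst h))) / \<omega> n" for n x and h :: "(real^3) \<times> real"
  \<comment> \<open>Regrouped as a sine quotient, the derivative can be bounded without ever
    dividing \<open>k n\<close> by the small \<open>\<omega> n\<close>.\<close>
  have D_eq: "D n x h = (2 * pi * (k n \<bullet> fst h)) *
      ((sin (phase n x + (\<phi> + pi / 2)) - sin (phase n (fst x, 0) + (\<phi> + pi / 2))) / \<omega> n)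
      + snd h * cos (phase n x + \<phi>)" for n x h
    unfolding D_def sin_shift_pi_half using \<omega>_nz[of n] by (simp add: field_simps)
  have "((\<lambda>x. \<Sum>n. c n * ((sin (phase n x + \<phi>) - sin (phase n (fst x, 0) + \<phi>)) / \<omega> n))
     has_derivative (\<lambda>h. \<Sum>n. c n * D n x h)) (at x)"
  proof (rule has_derivative_suminf[where S = "ball 0 B" and x0 = x and f' = "\<lambda>n x h. c n * D n x h"
        and b = "\<lambda>n. (\<bar>c n\<bar> * (1 + norm (k n)) ^ 1) * (2 * pi * B + 1)"])
    show "((\<lambda>x. c n * ((sin (phase n x + \<phi>) - sin (phase n (fst x, 0) + \<phi>)) / \<omega> n))
        has_derivative (\<lambda>h. c n * D n x h)) (at x)" for n x
      unfolding D_def phase_def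
      by (rule derivative_eq_intros refl | simp add: algebra_simps \<omega>_nz)+
    show "\<bar>c n * D n x h\<bar> \<le> \<bar>c n\<bar> * (1 + norm (k n)) ^ 1 * (2 * pi * B + 1) * norm h"
      if "x \<in> ball 0 B" for n x h
    proof -
      let ?s = "(sin (phase n x + (\<phi> + pi / 2)) - sin (phase n (fst x, 0) + (\<phi> + pi / 2))) / \<omega> n"
      have B: "0 \<le> B" by (simp add: B_def)
      have "\<bar>snd x\<bar> \<le> B"
        using that norm_snd_le[of "snd x" "fst x"] by simp
      then have s: "\<bar>?s\<bar> \<le> B"
        using sin_quotient_le[of n "fst x" "snd x" "\<phi> + pi / 2" 0] by simp
      have "\<bar>D n x h\<bar> \<le> \<bar>2 * pi * (k n \<bullet> fst h)\<bar> * \<bar>?s\<bar> + \<bar>snd h\<bar> * \<bar>cos (phase n x + \<phi>)\<bar>"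
        unfolding D_eq abs_mult[symmetric] by (rule abs_triangle_ineq)
      also have "\<dots> \<le> (2 * pi * norm (fst h) * (1 + norm (k n))) * B + \<bar>snd h\<bar> * 1"
        using B by (intro add_mono mult_mono inner_k_le s) auto
      also have "\<dots> \<le> (2 * pi * norm h * (1 + norm (k n))) * B + norm h * (1 + norm (k n))"
        using B norm_fst_le[of "fst h" "snd h"] norm_snd_le[of "snd h" "fst h"]
        by (intro add_mono mult_mono) auto
      also have "\<dots> = (1 + norm (k n)) * (2 * pi * B + 1) * norm h" by (simp add: algebra_simps)
      finally show ?thesis
        using mult_left_mono[of "\<bar>D n x h\<bar>" _ "\<bar>c n\<bar>"] by (simp add: abs_mult mult.assoc)
    qed
    show "summable (\<lambda>n. \<bar>c n\<bar> * (1 + norm (k n)) ^ 1 * (2 * pi * B + 1))"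
      using c unfolding rapid_def by (intro summable_mult2) blast
  qed (use x summable_H[OF c] in auto)
  moreover have "(\<Sum>n. c n * D n x h) = H (\<lambda>n. c n * (2 * pi * (k n \<bullet> fst h))) (\<phi> + pi / 2) x
      + snd h * G c \<phi> x" for h
  proof -
    let ?s = "\<lambda>n. (sin (phase n x + (\<phi> + pi / 2)) - sin (phase n (fst x, 0) + (\<phi> + pi / 2))) / \<omega> n"
    have "c n * D n x h = c n * (2 * pi * (k n \<bullet> fst h)) * ?s n + snd h * (c n * cos (phase n x + \<phi>))" for n
      unfolding D_eq by (simp only: ring_distribs mult_ac)
    then show ?thesis
      unfolding G_def H_def
      by (simp only: suminf_add_mult[OF summable_H[OF rapid_inner[OF c]] summable_G[OF c]])
  qed
  ultimately show ?thesis unfolding H_def[abs_def] by simp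
qed

section \<open>Travel time, its inverse, and the flow\<close>

definition \<rho> :: "real^3 \<Rightarrow> real" where "\<rho> p = 1 + G a 0 (p, 0)"

text \<open>\<open>R (p, s)\<close> is the time the reparametrised flow needs from \<open>p\<close> to \<open>p + s v\<close>.\<close>

definition R :: "(real^3) \<times> real \<Rightarrow> real" where "R x = snd x + H a 0 x"

text \<open>How far along \<open>v\<close> the flow gets from \<open>p\<close> in time
  \<open>t\<close>.\<close>

definition S :: "real \<Rightarrow> real^3 \<Rightarrow> real" where "S t p = (THE s. R (p, s) = t)"

definition Flow :: "real \<Rightarrow> real^3 \<Rightarrow> real^3" where "Flow t p = p + S t p *\<^sub>R v"

lemma phase_translate: "phase n (p + s *\<^sub>R v, u) = phase n (p, s + u)"
  by (simp add: phase_def \<omega>_def algebra_simps)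

lemma G_translate: "G c \<phi> (p + s *\<^sub>R v, u) = G c \<phi> (p, s + u)"
  by (simp add: G_def phase_translate)

lemma sum_a: "(\<Sum>n. \<bar>a n\<bar>) \<le> 1 / 2"
  using a_small a_nonneg by simp

lemma \<rho>_bounds: "1 / 2 \<le> \<rho> p" "\<rho> p \<le> 3 / 2"
  using abs_G_le[OF rapid_a, of 0 "(p, 0)"] sum_a unfolding \<rho>_def by auto

lemma \<rho>_pos: "0 < \<rho> p" using \<rho>_bounds(1)[of p] by simp

text \<open>Cocycle identity: travel times add along an orbit. The group law of the flow follows
  from it.\<close>

lemma R_add: "R (p, s + u) = R (p, s) + R (p + s *\<^sub>R v, u)"
proof -
  let ?A = "\<lambda>n. a n * ((sin (phase n (p, s) + 0) - sin (phase n (fst (p, s), 0) + 0)) / \<omega> n)"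
  let ?B = "\<lambda>n. a n * ((sin (phase n (p + s *\<^sub>R v, u) + 0) - sin (phase n (fst (p + s *\<^sub>R v, u), 0) + 0)) / \<omega> n)"
  have "H a 0 (p, s) + H a 0 (p + s *\<^sub>R v, u) = (\<Sum>n. ?A n + ?B n)"
    unfolding H_def using summable_H[OF rapid_a, of "(p, s)" 0] summable_H[OF rapid_a, of "(p + s *\<^sub>R v, u)" 0]
    by (rule suminf_add)
  also have "\<dots> = H a 0 (p, s + u)"
    unfolding H_def by (intro suminf_cong) (simp add: phase_translate algebra_simps diff_divide_distrib)
  finally show ?thesis by (simp add: R_def)
qed

lemma R_0: "R (p, 0) = 0"
  by (simp add: R_def H_def)

lemma abs_R_le: "\<bar>R (p, s) - s\<bar> \<le> \<bar>s\<bar> / 2"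
proof -
  have "\<bar>H a 0 (p, s)\<bar> \<le> \<bar>s\<bar> * (1 / 2)"
    using abs_H_le[OF rapid_a] mult_left_mono[OF sum_a] by (rule order_trans) auto
  then show ?thesis by (simp add: R_def)
qed

text \<open>By the cocycle identity a difference of travel times from \<open>p\<close> is a single
  travel time from \<open>p + s' *\<^sub>R v\<close>, to which \<open>abs_R_le\<close>
  applies.\<close>

lemma R_diff_ge: "\<bar>s - s'\<bar> \<le> 2 * \<bar>R (p, s) - R (p, s')\<bar>"
proof -
  have "R (p, s) - R (p, s') = R (p + s' *\<^sub>R v, s - s')"
    using R_add[of p s' "s - s'"] by simp
  moreover have "\<bar>d\<bar> \<le> 2 * \<bar>x\<bar>" if "\<bar>x - d\<bar> \<le> \<bar>d\<bar> / 2" for x d :: real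
    using that by (auto simp: abs_if split: if_splits)
  ultimately show ?thesis using abs_R_le[of "p + s' *\<^sub>R v" "s - s'"] by metis
qed

lemma R_has_derivative:
  "(R has_derivative (\<lambda>h. H (\<lambda>n. a n * (2 * pi * (k n \<bullet> fst h))) (pi / 2) x
      + snd h * (1 + G a 0 x))) (at x)"
  unfolding R_def[abs_def]
  by (rule has_derivative_eq_rhs[OF has_derivative_add[OF has_derivative_snd[OF has_derivative_ident]
      H_has_derivative[OF rapid_a, of 0]]]) (simp add: algebra_simps)

lemma isCont_R: "isCont R x"
  using R_has_derivative by (rule has_derivative_continuous)

lemma ex1_S: "\<exists>!s. R (p, s) = t"
proof (rule ex_ex1I)
  have "continuous_on {- 2 * \<bar>t\<bar>..2 * \<bar>t\<bar>} (\<lambda>s. R (p, s))"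
    by (intro continuous_at_imp_continuous_on ballI continuous_within_compose3[OF isCont_R])
      (auto intro!: continuous_intros)
  \<comment> \<open>\<open>R (p, s)\<close> differs from \<open>s\<close> by at most half of its
    size, so the parameters of size \<open>2 * \<bar>t\<bar>\<close> bracket the time
    \<open>t\<close>.\<close>
  moreover have "R (p, - 2 * \<bar>t\<bar>) \<le> t" "t \<le> R (p, 2 * \<bar>t\<bar>)"
    using abs_R_le[of p "- 2 * \<bar>t\<bar>"] abs_R_le[of p "2 * \<bar>t\<bar>"] by (auto simp: abs_le_iff)
  ultimately show "\<exists>s. R (p, s) = t"
    using IVT'[of "\<lambda>s. R (p, s)" "- 2 * \<bar>t\<bar>" t "2 * \<bar>t\<bar>"] by auto
  show "R (p, s) = t \<Longrightarrow> R (p, s') = t \<Longrightarrow> s = s'" for s s'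
    using R_diff_ge[of s s' p] by simp
qed

lemma R_S: "R (p, S t p) = t"
  unfolding S_def by (rule theI'[OF ex1_S])

lemma S_eqI: "R (p, s) = t \<Longrightarrow> S t p = s"
  using ex1_S R_S by blast

lemma S_bounds: assumes "0 \<le> t" shows "2 / 3 * t \<le> S t p" "S t p \<le> 2 * t"
proof -
  have *: "\<bar>t - S t p\<bar> \<le> \<bar>S t p\<bar> / 2" using abs_R_le[of p "S t p"] by (simp add: R_S)
  show "2 / 3 * t \<le> S t p" "S t p \<le> 2 * t"
    using * assms unfolding abs_le_iff by (auto simp: abs_if split: if_splits)
qed

lemma S_add: "S (t + t') p = S t p + S t' (Flow t p)"
  by (rule S_eqI) (simp add: R_add R_S Flow_def[symmetric])

lemma Flow_add: "Flow t' (Flow t p) = Flow (t + t') p"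
  by (simp add: Flow_def[of t'] Flow_def[of "t + t'"] S_add algebra_simps) (simp add: Flow_def)

lemma Flow_funpow: "(Flow 1 ^^ n) p = Flow (real n) p"
proof (induction n)
  case 0
  have "S 0 p = 0" by (rule S_eqI) (rule R_0)
  then show ?case by (simp add: Flow_def)
next
  case (Suc n)
  then show ?case by (simp add: Flow_add add.commute)
qed

lemma phase_add_int: assumes "m \<in> int_vec"
  shows "sin (phase n (p + m, s) + \<phi>) = sin (phase n (p, s) + \<phi>)"
    "cos (phase n (p + m, s) + \<phi>) = cos (phase n (p, s) + \<phi>)"
proof -
  have "phase n (p + m, s) + \<phi> = (phase n (p, s) + \<phi>) + 2 * pi * (k n \<bullet> m)"
    by (simp add: phase_def algebra_simps)
  moreover have "k n \<bullet> m \<in> \<int>" by (rule int_vec_inner[OF k_int assms])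
  ultimately show "sin (phase n (p + m, s) + \<phi>) = sin (phase n (p, s) + \<phi>)"
    "cos (phase n (p + m, s) + \<phi>) = cos (phase n (p, s) + \<phi>)"
    by (simp_all only: sin_add_2pi_Ints cos_add_2pi_Ints)
qed

lemma G_add_int: "m \<in> int_vec \<Longrightarrow> G c \<phi> (p + m, s) = G c \<phi> (p, s)"
  by (simp add: G_def phase_add_int)

lemma H_add_int: "m \<in> int_vec \<Longrightarrow> H c \<phi> (p + m, s) = H c \<phi> (p, s)"
  by (simp add: H_def phase_add_int)

lemma S_add_int: "m \<in> int_vec \<Longrightarrow> S t (p + m) = S t p"
  by (simp add: S_def R_def H_add_int)

lemma Flow_add_int: "m \<in> int_vec \<Longrightarrow> Flow t (p + m) = Flow t p + m"
  by (simp add: Flow_def S_add_int)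

lemma periodic_\<rho>: "periodic \<rho>"
  by (simp add: periodic_def \<rho>_def G_add_int)

lemma periodic_comp_Flow: "periodic f \<Longrightarrow> periodic (\<lambda>p. f (Flow t p))"
  by (simp add: periodic_def Flow_add_int)

text \<open>Implicit differentiation of \<open>R (p, S t p) = t\<close>, by the inverse function
  rule for the map taking \<open>(p, s)\<close> to \<open>(p, R (p, s))\<close>. The inverse
  \<open>g\<close> exists globally, and its continuity comes from \<open>R_diff_ge\<close>.\<close>

lemma S_has_derivative:
  "(S t has_derivative (\<lambda>w. - H (\<lambda>n. a n * (2 * pi * (k n \<bullet> w))) (pi / 2) (p, S t p) / \<rho> (Flow t p))) (at p)"
proof -
  define L where "L h = H (\<lambda>n. a n * (2 * pi * (k n \<bullet> fst h))) (pi / 2) (p, S t p)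
      + snd h * (1 + G a 0 (p, S t p))" for h :: "(real^3) \<times> real"
  define r where "r = \<rho> (Flow t p)"
  have r: "1 + G a 0 (p, S t p) = r"
    by (simp add: r_def \<rho>_def Flow_def G_translate)
  have r0: "r \<noteq> 0" using \<rho>_pos[of "Flow t p"] by (simp add: r_def)
  have derR: "(R has_derivative L) (at (p, S t p))"
    unfolding L_def[abs_def] by (rule R_has_derivative)
  then have bl: "bounded_linear L" by (rule has_derivative_bounded_linear)
  define g where "g y = (fst y, S (snd y) (fst y))" for y :: "(real^3) \<times> real"
  define g' where "g' h = (fst h, (snd h - L (fst h, 0)) / r)" for h :: "(real^3) \<times> real"
  have L_split: "L (w, u) = L (w, 0) + u * r" for w u
    by (simp add: L_def r)
  have cont: "continuous (at (p, t)) g"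
  proof -
    have "((\<lambda>y. S (snd y) (fst y)) \<longlongrightarrow> S t p) (at (p, t))"
    proof (rule LIM_zero_cancel, rule Lim_null_comparison)
      show "\<forall>\<^sub>F y in at (p, t). norm (S (snd y) (fst y) - S t p) \<le> 2 * \<bar>snd y - R (fst y, S t p)\<bar>"
      proof (rule always_eventually, rule allI)
        fix y :: "(real^3) \<times> real"
        show "norm (S (snd y) (fst y) - S t p) \<le> 2 * \<bar>snd y - R (fst y, S t p)\<bar>"
          using R_diff_ge[of "S (snd y) (fst y)" "S t p" "fst y"] by (simp add: R_S)
      qed
      have "((\<lambda>y. R (fst y, S t p)) \<longlongrightarrow> R (fst (p, t), S t p)) (at (p, t))"
        by (rule isCont_tendsto_compose[OF isCont_R]) (intro tendsto_intros)
      then have "((\<lambda>y. 2 * \<bar>snd y - R (fst y, S t p)\<bar>) \<longlongrightarrow> 2 * \<bar>snd (p, t) - R (fst (p, t), S t p)\<bar>) (at (p, t))"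
        by (intro tendsto_intros)
      then show "((\<lambda>y. 2 * \<bar>snd y - R (fst y, S t p)\<bar>) \<longlongrightarrow> 0) (at (p, t))" by (simp add: R_S)
    qed
    moreover have "(fst \<longlongrightarrow> fst (p, t)) (at (p, t))" by (intro tendsto_intros)
    ultimately show ?thesis unfolding continuous_at g_def[abs_def] by (simp add: tendsto_Pair)
  qed
  have "(g has_derivative g') (at (p, t))"
  proof (rule has_derivative_inverse_basic[where f = "\<lambda>x. (fst x, R x)" and f' = "\<lambda>h. (fst h, L h)" and T = UNIV])
    show "((\<lambda>x. (fst x, R x)) has_derivative (\<lambda>h. (fst h, L h))) (at (g (p, t)))"
      using derR by (intro has_derivative_Pair has_derivative_fst has_derivative_ident) (simp add: g_def)
    show "bounded_linear g'"
    proof -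
      have "bounded_linear (\<lambda>h::(real^3) \<times> real. L (fst h, 0))"
        by (rule bounded_linear_compose[OF bl]) (intro bounded_linear_Pair bounded_linear_fst bounded_linear_zero)
      from bounded_linear_compose[OF bounded_linear_divide bounded_linear_sub[OF bounded_linear_snd this]]
      show ?thesis
        unfolding g'_def[abs_def] by (rule bounded_linear_Pair[OF bounded_linear_fst])
    qed
    show "g' \<circ> (\<lambda>h. (fst h, L h)) = id"
    proof
      fix h :: "(real^3) \<times> real"
      show "(g' \<circ> (\<lambda>h. (fst h, L h))) h = id h"
        using r0 L_split[of "fst h" "snd h"] by (simp add: g'_def)
    qed
    show "(fst (g z), R (g z)) = z" for z
      by (simp add: g_def R_S)
  qed (use cont in auto)
  then have "((\<lambda>q. g (q, t)) has_derivative (\<lambda>w. g' (w, 0))) (at p)"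
    by (rule has_derivative_compose[rotated]) (auto intro!: derivative_eq_intros)
  then have "((\<lambda>q. snd (g (q, t))) has_derivative (\<lambda>w. snd (g' (w, 0)))) (at p)"
    by (rule has_derivative_snd)
  then show ?thesis by (simp add: g_def g'_def L_def r_def)
qed

lemma Flow_eq: "Flow t = (\<lambda>p. p + S t p *\<^sub>R v)"
  by (simp add: Flow_def fun_eq_iff)

lemma Flow_has_derivative:
  "(Flow t has_derivative (\<lambda>w. w +
      (- H (\<lambda>n. a n * (2 * pi * (k n \<bullet> w))) (pi / 2) (p, S t p) / \<rho> (Flow t p)) *\<^sub>R v)) (at p)"
proof -
  have "((\<lambda>p. p + S t p *\<^sub>R v) has_derivative (\<lambda>w. w +
      (- H (\<lambda>n. a n * (2 * pi * (k n \<bullet> w))) (pi / 2) (p, S t p) / \<rho> (Flow t p)) *\<^sub>R v)) (at p)"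
    by (intro has_derivative_add has_derivative_ident has_derivative_scaleR_left S_has_derivative)
  then show ?thesis by (simp only: Flow_eq[symmetric])
qed

end

section \<open>Trigonometric polynomials of mean zero, the numerators of the coboundaries, and
  derivatives of trigonometric polynomials\<close>

inductive trig_poly0 :: "(real^3 \<Rightarrow> real) \<Rightarrow> bool" where
  cos: "k \<in> int_vec \<Longrightarrow> k \<noteq> 0 \<Longrightarrow> trig_poly0 (\<lambda>p. c * cos (2 * pi * (k \<bullet> p) + d))"
| add: "trig_poly0 f \<Longrightarrow> trig_poly0 g \<Longrightarrow> trig_poly0 (\<lambda>p. f p + g p)"

lemma trig_poly0_zero: "trig_poly0 (\<lambda>p. 0)"
proof -
  have "axis 1 1 \<in> int_vec" by (simp add: int_vec_def axis_def)
  moreover have "axis 1 1 \<noteq> (0 :: real^3)" by (simp add: axis_eq_0_iff)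
  ultimately have "trig_poly0 (\<lambda>p. 0 * cos (2 * pi * (axis 1 1 \<bullet> p) + 0))"
    by (rule trig_poly0.cos)
  then show ?thesis by simp
qed

lemma trig_poly_split: "trig_poly g \<Longrightarrow> \<exists>g0 m. trig_poly0 g0 \<and> g = (\<lambda>p. m + g0 p)"
proof (induction rule: trig_poly.induct)
  case (cos k c d)
  show ?case
  proof (cases "k = 0")
    case True
    then show ?thesis using trig_poly0_zero
      by (intro exI[of _ "\<lambda>p. 0"] exI[of _ "c * cos d"]) auto
  next
    case False
    then show ?thesis using trig_poly0.cos[OF cos False, of c d]
      by (intro exI[of _ "\<lambda>p. c * cos (2 * pi * (k \<bullet> p) + d)"] exI[of _ 0]) auto
  qed
next
  case (add f g)
  then obtain f0 m g0 l where *: "trig_poly0 f0" "f = (\<lambda>p. m + f0 p)" "trig_poly0 g0" "g = (\<lambda>p. l + g0 p)"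
    by blast
  show ?case
    using trig_poly0.add[OF *(1,3)] by (intro exI[of _ "\<lambda>p. f0 p + g0 p"] exI[of _ "m + l"]) (auto simp: *)
qed

lemma trig_poly0_imp_trig_poly: "trig_poly0 f \<Longrightarrow> trig_poly f"
  by (induction rule: trig_poly0.induct) (auto intro: trig_poly.intros)

lemma borel_trig_poly: "trig_poly f \<Longrightarrow> f \<in> borel_measurable borel"
  by (intro borel_measurable_continuous_onI continuous_on_trig_poly)

lemma trig_poly_bounded: "trig_poly f \<Longrightarrow> \<exists>B. \<forall>p. \<bar>f p\<bar> \<le> B"
proof (induction rule: trig_poly.induct)
  case (cos k c d)
  have "\<bar>c * cos (2 * pi * (k \<bullet> p) + d)\<bar> \<le> \<bar>c\<bar>" for p
    by (simp add: abs_mult mult_left_le)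
  then show ?case by blast
next
  case (add f g)
  then obtain B C where "\<And>p. \<bar>f p\<bar> \<le> B" "\<And>p. \<bar>g p\<bar> \<le> C" by blast
  then have "\<bar>f p + g p\<bar> \<le> B + C" for p by (meson abs_triangle_ineq add_mono order_trans)
  then show ?case by blast
qed

lemma trig_poly_periodic: "trig_poly f \<Longrightarrow> periodic f"
proof (induction rule: trig_poly.induct)
  case (cos k c d)
  from periodic_cos[OF cos, of d] show ?case by (simp add: periodic_def)
qed (simp add: periodic_def)

lemma trig_poly_derivative:
  "trig_poly f \<Longrightarrow> \<exists>f'. (\<forall>p. (f has_derivative f' p) (at p)) \<and> (\<forall>w. trig_poly (\<lambda>p. f' p w))"
proof (induction rule: trig_poly.induct)
  case (cos k c d)
  have "((\<lambda>p. c * cos (2 * pi * (k \<bullet> p) + d)) has_derivative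
      (\<lambda>w. (c * (2 * pi * (k \<bullet> w))) * cos (2 * pi * (k \<bullet> p) + (d + pi / 2)))) (at p)" for p
    unfolding cos_shift_pi_half
    by (rule derivative_eq_intros refl | simp add: mult_ac)+
  moreover have "trig_poly (\<lambda>p. (c * (2 * pi * (k \<bullet> w))) * cos (2 * pi * (k \<bullet> p) + (d + pi / 2)))" for w
    by (rule trig_poly.cos[OF cos])
  ultimately show ?case
    by (intro exI[of _ "\<lambda>p w. (c * (2 * pi * (k \<bullet> w))) * cos (2 * pi * (k \<bullet> p) + (d + pi / 2))"]) simp
next
  case (add f g)
  then obtain f' g' where *: "\<And>p. (f has_derivative f' p) (at p)" "\<And>w. trig_poly (\<lambda>p. f' p w)"
    "\<And>p. (g has_derivative g' p) (at p)" "\<And>w. trig_poly (\<lambda>p. g' p w)" by metis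
  show ?case
    by (intro exI[of _ "\<lambda>p w. f' p w + g' p w"] conjI allI has_derivative_add trig_poly.add *)
qed

lemma integral_trig_poly0: "trig_poly0 f \<Longrightarrow> (\<integral>p. f p \<partial>cube_measure) = 0"
proof (induction rule: trig_poly0.induct)
  case (cos k c d)
  then show ?case by (simp add: integral_cos_zero)
next
  case (add f g)
  have "integrable cube_measure f" "integrable cube_measure g"
    using trig_poly_bounded[of f] trig_poly_bounded[of g] borel_trig_poly trig_poly0_imp_trig_poly[OF add(1)]
      trig_poly0_imp_trig_poly[OF add(2)]
    by (auto intro!: cube_integrable_bounded)
  with add show ?case by simp
qed

section \<open>Smoothness of the flow\<close>

context time_changed_flow
begin

abbreviation DS :: "real \<Rightarrow> real^3 \<Rightarrow> real^3 \<Rightarrow> real" where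
  "DS t p w \<equiv> - H (\<lambda>n. a n * (2 * pi * (k n \<bullet> w))) (pi / 2) (p, S t p) / \<rho> (Flow t p)"

lemma \<rho>_Flow: "\<rho> (Flow t p) = 1 + G a 0 (p, S t p)"
  by (simp add: \<rho>_def Flow_def G_translate)

text \<open>A class of functions closed under directional derivatives, whence the smoothness of \<open>S t\<close>.\<close>

inductive orbit_function :: "real \<Rightarrow> (real^3 \<Rightarrow> real) \<Rightarrow> bool" for t where
  const: "orbit_function t (\<lambda>p. c)"
| S: "orbit_function t (S t)"
| inverse: "orbit_function t (\<lambda>p. inverse (\<rho> (Flow t p)))"
| G: "rapid c \<Longrightarrow> orbit_function t (\<lambda>p. G c \<phi> (p, S t p))"
| H: "rapid c \<Longrightarrow> orbit_function t (\<lambda>p. H c \<phi> (p, S t p))"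
| add: "orbit_function t f \<Longrightarrow> orbit_function t g \<Longrightarrow> orbit_function t (\<lambda>p. f p + g p)"
| mult: "orbit_function t f \<Longrightarrow> orbit_function t g \<Longrightarrow> orbit_function t (\<lambda>p. f p * g p)"

lemma orbit_function_DS: "orbit_function t (\<lambda>p. DS t p w)"
proof -
  have "orbit_function t (\<lambda>p. (- 1) * (H (\<lambda>n. a n * (2 * pi * (k n \<bullet> w))) (pi / 2) (p, S t p)
      * inverse (\<rho> (Flow t p))))"
    by (rule orbit_function.mult[OF orbit_function.const
          orbit_function.mult[OF orbit_function.H[OF rapid_inner[OF rapid_a]] orbit_function.inverse]])
  then show ?thesis by (simp only: divide_inverse mult_minus1 mult_minus_left mult_1)
qed

lemma graph_has_derivative: "((\<lambda>p. (p, S t p)) has_derivative (\<lambda>w. (w, DS t p w))) (at p)"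
  by (intro has_derivative_Pair has_derivative_ident S_has_derivative)

lemma G_graph_has_derivative:
  assumes "rapid c"
  shows "((\<lambda>p. G c \<phi> (p, S t p)) has_derivative (\<lambda>w. G (\<lambda>n. c n * (2 * pi * (k n \<bullet> w))) (\<phi> + pi / 2) (p, S t p)
      + DS t p w * G (\<lambda>n. c n * \<omega> n) (\<phi> + pi / 2) (p, S t p))) (at p)"
  using has_derivative_compose[OF graph_has_derivative G_has_derivative[OF assms]] by simp

lemma H_graph_has_derivative:
  assumes "rapid c"
  shows "((\<lambda>p. H c \<phi> (p, S t p)) has_derivative (\<lambda>w. H (\<lambda>n. c n * (2 * pi * (k n \<bullet> w))) (\<phi> + pi / 2) (p, S t p)
      + DS t p w * G c \<phi> (p, S t p))) (at p)"
  using has_derivative_compose[OF graph_has_derivative H_has_derivative[OF assms]] by simp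

lemma orbit_function_derivative:
  assumes "orbit_function t f"
  shows "\<exists>f'. (\<forall>p. (f has_derivative f' p) (at p)) \<and> (\<forall>w. orbit_function t (\<lambda>p. f' p w))"
  using assms
proof induction
  case (const c)
  show ?case by (rule exI[of _ "\<lambda>_ _. 0"]) (auto intro: orbit_function.intros)
next
  case S
  show ?case by (rule exI[of _ "DS t"]) (simp only: S_has_derivative orbit_function_DS simp_thms)
next
  case inverse
  define D where "D p w = G (\<lambda>n. a n * (2 * pi * (k n \<bullet> w))) (0 + pi / 2) (p, S t p)
      + DS t p w * G (\<lambda>n. a n * \<omega> n) (0 + pi / 2) (p, S t p)" for p w
  have "((\<lambda>p. 1 + G a 0 (p, S t p)) has_derivative D p) (at p)" for p
    unfolding D_def[abs_def]
    using has_derivative_add[OF has_derivative_const[of 1] G_graph_has_derivative[OF rapid_a, of 0 t p]]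
    by (simp only: add_0_left)
  then have "((\<lambda>p. \<rho> (Flow t p)) has_derivative D p) (at p)" for p
    by (simp add: \<rho>_Flow)
  then have "((\<lambda>p. inverse (\<rho> (Flow t p))) has_derivative
      (\<lambda>w. - (inverse (\<rho> (Flow t p)) * D p w * inverse (\<rho> (Flow t p))))) (at p)" for p
    using \<rho>_pos[of "Flow t p"] by (intro Deriv.has_derivative_inverse) auto
  moreover have "orbit_function t (\<lambda>p. (- 1) * (inverse (\<rho> (Flow t p)) * D p w * inverse (\<rho> (Flow t p))))" for w
    unfolding D_def
    by (rule orbit_function.mult[OF orbit_function.const orbit_function.mult[OF
          orbit_function.mult[OF orbit_function.inverse orbit_function.add[OF
            orbit_function.G[OF rapid_inner[OF rapid_a]]
            orbit_function.mult[OF orbit_function_DS orbit_function.G[OF rapid_\<omega>[OF rapid_a]]]]]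
          orbit_function.inverse]])
  ultimately show ?case
    by (intro exI[of _ "\<lambda>p w. - (inverse (\<rho> (Flow t p)) * D p w * inverse (\<rho> (Flow t p)))"]) simp
next
  case (G c \<phi>)
  show ?case
    by (rule exI[of _ "\<lambda>p w. G (\<lambda>n. c n * (2 * pi * (k n \<bullet> w))) (\<phi> + pi / 2) (p, S t p)
      + DS t p w * G (\<lambda>n. c n * \<omega> n) (\<phi> + pi / 2) (p, S t p)"], intro conjI allI, rule G_graph_has_derivative[OF G])
       (rule orbit_function.add[OF orbit_function.G[OF rapid_inner[OF G]]
          orbit_function.mult[OF orbit_function_DS orbit_function.G[OF rapid_\<omega>[OF G]]]])
next
  case (H c \<phi>)
  show ?case
    by (rule exI[of _ "\<lambda>p w. H (\<lambda>n. c n * (2 * pi * (k n \<bullet> w))) (\<phi> + pi / 2) (p, S t p)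
      + DS t p w * G c \<phi> (p, S t p)"], intro conjI allI, rule H_graph_has_derivative[OF H])
       (rule orbit_function.add[OF orbit_function.H[OF rapid_inner[OF H]]
          orbit_function.mult[OF orbit_function_DS orbit_function.G[OF H]]])
next
  case (add f g)
  then obtain f' g' where "\<And>p. (f has_derivative f' p) (at p)" "\<And>w. orbit_function t (\<lambda>p. f' p w)"
    "\<And>p. (g has_derivative g' p) (at p)" "\<And>w. orbit_function t (\<lambda>p. g' p w)" by metis
  then show ?case
    by (intro exI[of _ "\<lambda>p w. f' p w + g' p w"] conjI allI has_derivative_add orbit_function.add)
next
  case (mult f g)
  then obtain f' g' where *: "\<And>p. (f has_derivative f' p) (at p)" "\<And>w. orbit_function t (\<lambda>p. f' p w)"
    "\<And>p. (g has_derivative g' p) (at p)" "\<And>w. orbit_function t (\<lambda>p. g' p w)" by metis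
  have "orbit_function t (\<lambda>p. f p * g' p w + f' p w * g p)" for w
    by (rule orbit_function.add[OF orbit_function.mult[OF mult.hyps(1) *(4)]
          orbit_function.mult[OF *(2) mult.hyps(2)]])
  then show ?case
    using has_derivative_mult[OF *(1) *(3)]
    by (intro exI[of _ "\<lambda>p w. f p * g' p w + f' p w * g p"]) simp
qed

text \<open>The constant vector \<open>u\<close> accommodates the first derivative
  \<open>w + DS t p w *\<^sub>R v\<close> of the flow; from the next derivative on it is 0.\<close>

lemma Ck_on_orbit_function:
  assumes "orbit_function t f"
  shows "Ck_on n UNIV (\<lambda>p. u + f p *\<^sub>R (v :: real^3))"
  using assms
proof (induction n arbitrary: f u)
  case 0
  then obtain f' where "\<And>p. (f has_derivative f' p) (at p)" using orbit_function_derivative by blast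
  then have "continuous_on UNIV f"
    using has_derivative_continuous by (blast intro: continuous_at_imp_continuous_on)
  then show ?case by (auto intro!: continuous_intros)
next
  case (Suc n)
  then obtain f' where f': "\<And>p. (f has_derivative f' p) (at p)" "\<And>w. orbit_function t (\<lambda>p. f' p w)"
    using orbit_function_derivative by blast
  have der: "((\<lambda>p. u + f p *\<^sub>R v) has_derivative (\<lambda>w. f' p w *\<^sub>R v)) (at p)" for p
    using has_derivative_add[OF has_derivative_const has_derivative_scaleR_left[OF f'(1)]] by simp
  have "frechet_derivative (\<lambda>p. u + f p *\<^sub>R v) (at p) = (\<lambda>w. f' p w *\<^sub>R v)" for p
    using frechet_derivative_at[OF der] by simp
  moreover have "Ck_on n UNIV (\<lambda>p. f' p w *\<^sub>R v)" for w
    using Suc.IH[OF f'(2), of 0] by simp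
  moreover have "(\<lambda>p. u + f p *\<^sub>R v) differentiable (at p)" for p
    by (rule differentiableI[OF der])
  ultimately show ?case by simp
qed

text \<open>\<open>Flow t\<close> contains the identity, so it is not a constant plus a multiple of
  \<open>v\<close>, but its first derivatives are. Hence the order zero is split off.\<close>

lemma smooth_on_Flow: "smooth_on UNIV (Flow t)"
  unfolding smooth_on_def
proof
  fix n
  have "frechet_derivative (Flow t) (at p) = (\<lambda>w. w + DS t p w *\<^sub>R v)" for p
    using frechet_derivative_at[OF Flow_has_derivative] by simp
  moreover have "continuous_on UNIV (Flow t)"
    using Flow_has_derivative has_derivative_continuous
    by (blast intro: continuous_at_imp_continuous_on)
  moreover have "Flow t differentiable (at p)" for p
    by (rule differentiableI[OF Flow_has_derivative])
  moreover have "Ck_on m UNIV (\<lambda>p. w + DS t p w *\<^sub>R v)" for m w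
    by (rule Ck_on_orbit_function[OF orbit_function_DS])
  ultimately show "Ck_on n UNIV (Flow t)" by (cases n) simp_all
qed

lemma continuous_on_Flow: "continuous_on A (Flow t)"
  using smooth_on_Flow[of t] unfolding smooth_on_def
  by (metis Ck_on.simps(1) continuous_on_subset subset_UNIV)

section \<open>The induced map of the torus and its invariant measure\<close>

definition torus_map :: "torus3 \<Rightarrow> torus3" where
  "torus_map z = to_torus3 (Flow 1 (rep_torus3 z))"

lemma torus_map_to_torus3: "torus_map (to_torus3 p) = to_torus3 (Flow 1 p)"
proof -
  have "rep_torus3 (to_torus3 p) - p \<in> int_vec" by (simp flip: to_torus3_eq_iff)
  from Flow_add_int[OF this, of 1 p] show ?thesis
    using \<open>rep_torus3 (to_torus3 p) - p \<in> int_vec\<close> by (simp add: torus_map_def to_torus3_eq_iff)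
qed

lemma torus_map_funpow: "(torus_map ^^ n) (to_torus3 p) = to_torus3 (Flow (real n) p)"
proof -
  have "(torus_map ^^ n) (to_torus3 p) = to_torus3 ((Flow 1 ^^ n) p)"
    by (induction n) (simp_all add: torus_map_to_torus3)
  then show ?thesis by (simp add: Flow_funpow)
qed

lemma smooth_torus_map: "smooth_torus3_map torus_map"
  unfolding smooth_torus3_map_def
  using smooth_on_Flow[of 1] torus_map_to_torus3 by (metis UNIV_I open_UNIV)

lemma borel_torus_map [measurable]: "torus_map \<in> borel_measurable borel"
proof (intro borel_measurable_continuous_onI continuous_on_torus3I)
  show "continuous_on UNIV (\<lambda>p. torus_map (to_torus3 p))"
    unfolding torus_map_to_torus3
    by (rule continuous_on_compose2[OF continuous_on_to_torus3[of UNIV] continuous_on_Flow]) auto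
qed

definition torus_density :: "torus3 \<Rightarrow> real" where
  "torus_density z = \<rho> (rep_torus3 z)"

definition \<mu> :: "torus3 measure" where
  "\<mu> = density torus3_lborel (\<lambda>z. ennreal (torus_density z))"

lemma torus_density_to_torus3: "torus_density (to_torus3 p) = \<rho> p"
  by (simp add: torus_density_def periodic_rep[OF periodic_\<rho>])

lemma \<rho>_has_derivative: "(\<rho> has_derivative (\<lambda>w. G (\<lambda>n. a n * (2 * pi * (k n \<bullet> w))) (pi / 2) (p, 0))) (at p)"
proof -
  have "((\<lambda>p. (p, 0::real)) has_derivative (\<lambda>w. (w, 0))) (at p)"
    by (auto intro!: derivative_eq_intros)
  from has_derivative_add[OF has_derivative_const has_derivative_compose[OF this G_has_derivative[OF rapid_a, of 0]], of 1]
  show ?thesis by (simp add: \<rho>_def[abs_def])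
qed

lemma continuous_on_\<rho>: "continuous_on A \<rho>"
  using \<rho>_has_derivative has_derivative_continuous by (blast intro: continuous_at_imp_continuous_on)

lemma borel_\<rho> [measurable]: "\<rho> \<in> borel_measurable borel"
  by (rule borel_measurable_continuous_onI[OF continuous_on_\<rho>])

lemma borel_Flow [measurable]: "Flow t \<in> borel_measurable borel"
  by (rule borel_measurable_continuous_onI[OF continuous_on_Flow])

lemma continuous_on_torus_density: "continuous_on UNIV torus_density"
  by (rule continuous_on_torus3I) (simp add: torus_density_to_torus3 continuous_on_\<rho>)

lemma borel_torus_density [measurable]: "torus_density \<in> borel_measurable borel"
  by (rule borel_measurable_continuous_onI[OF continuous_on_torus_density])

lemma torus_density_pos: "0 < torus_density z"
  by (simp add: torus_density_def \<rho>_pos)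

lemma sets_\<mu> [simp, measurable_cong]: "sets \<mu> = sets borel"
  by (simp add: \<mu>_def)

lemma space_\<mu> [simp]: "space \<mu> = UNIV"
  by (simp add: \<mu>_def)

lemma integral_\<mu>:
  fixes u :: "torus3 \<Rightarrow> real"
  assumes [measurable]: "u \<in> borel_measurable borel"
  shows "(\<integral>z. u z \<partial>\<mu>) = (\<integral>p. \<rho> p * u (to_torus3 p) \<partial>cube_measure)"
proof -
  have m: "g \<in> borel_measurable torus3_lborel" if "g \<in> borel_measurable borel" for g :: "torus3 \<Rightarrow> real"
    using that by (simp cong: measurable_cong_sets)
  have "(\<integral>z. u z \<partial>\<mu>) = (\<integral>z. torus_density z *\<^sub>R u z \<partial>torus3_lborel)"
    unfolding \<mu>_def
    by (rule integral_density) (auto intro!: m less_imp_le torus_density_pos)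
  also have "\<dots> = (\<integral>p. \<rho> p * u (to_torus3 p) \<partial>cube_measure)"
    by (subst integral_torus3_lborel) (auto simp: torus_density_to_torus3)
  finally show ?thesis .
qed

lemma integrable_\<rho>: "integrable cube_measure \<rho>"
  by (rule cube_integrable_bounded[where C = "3 / 2"])
     (use \<rho>_bounds less_imp_le[OF \<rho>_pos] in \<open>auto simp: abs_of_pos \<rho>_pos\<close>)

text \<open>Every term of the series has a nonzero frequency and integrates to zero.\<close>

lemma integral_\<rho>: "(\<integral>p. \<rho> p \<partial>cube_measure) = 1"
proof -
  let ?f = "\<lambda>n p. a n * cos (2 * pi * (k n \<bullet> p) + 0)"
  have bd: "\<bar>?f n p\<bar> \<le> a n" for n p
    using a_nonneg[of n] by (simp add: abs_mult mult_left_le)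
  have sa: "summable a" using a_rapid[of 0] by simp
  have int: "integrable cube_measure (?f n)" for n
    by (rule cube_integrable_bounded[OF _ bd]) simp
  have "(\<integral>p. (\<Sum>n. ?f n p) \<partial>cube_measure) = (\<Sum>n. \<integral>p. ?f n p \<partial>cube_measure)"
  proof (rule integral_suminf[OF int])
    show "AE p in cube_measure. summable (\<lambda>n. norm (?f n p))"
      by (intro AE_I2 summable_comparison_test'[OF sa, of 0]) (use bd in auto)
    have "(\<integral>p. norm (?f n p) \<partial>cube_measure) \<le> (\<integral>p. a n \<partial>cube_measure)" for n
      using bd by (intro integral_mono integrable_norm int) auto
    then have "norm (\<integral>p. norm (?f n p) \<partial>cube_measure) \<le> a n" for n
      using cube.prob_space by simp
    then show "summable (\<lambda>n. \<integral>p. norm (?f n p) \<partial>cube_measure)"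
      by (intro summable_comparison_test'[OF sa, of 0]) auto
  qed
  also have "\<dots> = 0"
    by (simp only: integral_mult_right_zero integral_cos_zero[OF k_int k_nz] mult_zero_right suminf_zero)
  finally have "(\<integral>p. G a 0 (p, 0) \<partial>cube_measure) = 0"
    by (simp add: G_def phase_def)
  moreover have "integrable cube_measure (\<lambda>p. G a 0 (p, 0))"
    using Bochner_Integration.integrable_diff[OF integrable_\<rho> cube.integrable_const[of "1::real"]]
    by (simp add: \<rho>_def)
  ultimately show ?thesis
    unfolding \<rho>_def using cube.prob_space by simp
qed

lemma prob_space_\<mu>: "prob_space \<mu>"
proof
  have "(\<integral>\<^sup>+z. ennreal (torus_density z) \<partial>torus3_lborel) = (\<integral>\<^sup>+p. ennreal (\<rho> p) \<partial>cube_measure)"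
    unfolding torus3_lborel_eq
    by (subst nn_integral_distr) (auto intro!: borel_measurable_cube_measure simp: torus_density_to_torus3)
  also have "\<dots> = ennreal (\<integral>p. \<rho> p \<partial>cube_measure)"
    by (rule nn_integral_eq_integral[OF integrable_\<rho>]) (auto simp: less_imp_le \<rho>_pos)
  finally have "(\<integral>\<^sup>+z. ennreal (torus_density z) \<partial>torus3_lborel) = 1" by (simp add: integral_\<rho>)
  then show "emeasure \<mu> (space \<mu>) = 1"
    unfolding \<mu>_def by (subst emeasure_density) (auto cong: measurable_cong_sets)
qed

lemma character_has_derivative:
  "((\<lambda>p. sin (2 * pi * (l \<bullet> Flow t p) + c)) has_derivative
     (\<lambda>w. cos (2 * pi * (l \<bullet> Flow t p) + c) * (2 * pi * (l \<bullet> w + DS t p w * (l \<bullet> v))))) (at p)"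
proof -
  have "((\<lambda>y. sin (2 * pi * (l \<bullet> y) + c)) has_derivative (\<lambda>h. cos (2 * pi * (l \<bullet> y) + c) * (2 * pi * (l \<bullet> h)))) (at y)" for y
    by (auto intro!: derivative_eq_intros)
  from has_derivative_compose[OF Flow_has_derivative[of t p] this]
  show ?thesis by (simp only: inner_add_right inner_scaleR_right)
qed

text \<open>The flow carries its own velocity field \<open>v / \<rho>\<close> to itself, so its
  derivative multiplies \<open>v\<close> by this ratio.\<close>

lemma DS_v: "1 + DS t p v = \<rho> p / \<rho> (Flow t p)"
proof -
  \<comment> \<open>The factors \<open>2 * pi * (k n \<bullet> v)\<close> are the
    \<open>\<omega> n\<close> and cancel the denominators in \<open>H\<close>.\<close>
  have "H (\<lambda>n. a n * (2 * pi * (k n \<bullet> v))) (pi / 2) (p, S t p)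
      = (\<Sum>n. a n * cos (phase n (p, S t p) + 0) - a n * cos (phase n (p, 0) + 0))"
    unfolding H_def
  proof (rule suminf_cong)
    fix n
    show "a n * (2 * pi * (k n \<bullet> v)) * ((sin (phase n (p, S t p) + pi / 2) - sin (phase n (fst (p, S t p), 0) + pi / 2)) / \<omega> n)
        = a n * cos (phase n (p, S t p) + 0) - a n * cos (phase n (p, 0) + 0)"
      unfolding \<omega>_def[symmetric] sin_shift_pi_half[of _ 0, simplified]
      using \<omega>_nz[of n] by (simp add: field_simps)
  qed
  also have "\<dots> = G a 0 (p, S t p) - G a 0 (p, 0)"
    unfolding G_def by (rule suminf_diff[symmetric]) (rule summable_G[OF rapid_a])+
  also have "\<dots> = \<rho> (Flow t p) - \<rho> p"
    unfolding \<rho>_Flow unfolding \<rho>_def by simp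
  finally show ?thesis using \<rho>_pos[of "Flow t p"] by (simp add: field_simps)
qed

lemma \<rho>_ratio_le: "\<bar>\<rho> p / \<rho> q\<bar> \<le> 3"
  using \<rho>_bounds[of p] \<rho>_bounds[of q] by (simp add: field_simps)

text \<open>By \<open>DS_v\<close> the integrand is, up to the nonzero factor
  \<open>2 * pi * (l \<bullet> v)\<close>, the derivative along \<open>v\<close> of a character
  composed with the flow. This takes the place of a change of variables.\<close>

lemma integral_character_invariant:
  assumes "l \<in> int_vec" "l \<noteq> 0"
  shows "(\<integral>p. \<rho> p * (cos (2 * pi * (l \<bullet> Flow t p) + c) / \<rho> (Flow t p)) \<partial>cube_measure) = 0"
proof -
  let ?f' = "\<lambda>p w. cos (2 * pi * (l \<bullet> Flow t p) + c) * (2 * pi * (l \<bullet> w + DS t p w * (l \<bullet> v)))"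
  have eq: "?f' p v = (2 * pi * (l \<bullet> v)) * (\<rho> p * (cos (2 * pi * (l \<bullet> Flow t p) + c) / \<rho> (Flow t p)))" for p
  proof -
    have "?f' p v = (2 * pi * (l \<bullet> v)) * (cos (2 * pi * (l \<bullet> Flow t p) + c) * (1 + DS t p v))"
      by (simp add: algebra_simps)
    then show ?thesis unfolding DS_v by simp
  qed
  have "(\<integral>p. ?f' p v \<partial>cube_measure) = 0"
  proof (rule integral_directional_derivative[where f' = ?f'])
    show "periodic (\<lambda>p. sin (2 * pi * (l \<bullet> Flow t p) + c))"
      by (rule periodic_comp_Flow[OF periodic_sin[OF assms(1)]])
    show "((\<lambda>p. sin (2 * pi * (l \<bullet> Flow t p) + c)) has_derivative ?f' p) (at p)" for p
      by (rule character_has_derivative)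
    show "\<bar>?f' p v\<bar> \<le> \<bar>2 * pi * (l \<bullet> v)\<bar> * (3 * 1)" for p
    proof -
      have "\<bar>?f' p v\<bar> = \<bar>2 * pi * (l \<bullet> v)\<bar> * (\<bar>\<rho> p / \<rho> (Flow t p)\<bar> * \<bar>cos (2 * pi * (l \<bullet> Flow t p) + c)\<bar>)"
        unfolding eq by (simp add: abs_mult)
      also have "\<dots> \<le> \<bar>2 * pi * (l \<bullet> v)\<bar> * (3 * 1)"
        by (intro mult_left_mono mult_mono \<rho>_ratio_le) auto
      finally show ?thesis .
    qed
    show "\<bar>sin (2 * pi * (l \<bullet> Flow t p) + c)\<bar> \<le> 1" for p by simp
  qed
  then have "(2 * pi * (l \<bullet> v)) *
      (\<integral>p. \<rho> p * (cos (2 * pi * (l \<bullet> Flow t p) + c) / \<rho> (Flow t p)) \<partial>cube_measure) = 0"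
    by (simp only: eq integral_mult_right_zero)
  then show ?thesis using nonresonant[OF assms] by (simp only: mult_eq_0_iff) auto
qed

lemma integral_trig_poly0_invariant:
  assumes "trig_poly0 g"
  shows "(\<integral>p. \<rho> p * (g (Flow t p) / \<rho> (Flow t p)) \<partial>cube_measure) = 0"
  using assms
proof induction
  case (cos l c d)
  have "(\<integral>p. \<rho> p * (c * cos (2 * pi * (l \<bullet> Flow t p) + d) / \<rho> (Flow t p)) \<partial>cube_measure)
      = (\<integral>p. c * (\<rho> p * (cos (2 * pi * (l \<bullet> Flow t p) + d) / \<rho> (Flow t p))) \<partial>cube_measure)"
    by (intro Bochner_Integration.integral_cong) auto
  then show ?case
    by (simp only: integral_mult_right_zero integral_character_invariant[OF cos] mult_zero_right)
next
  case (add f g)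
  have int: "integrable cube_measure (\<lambda>p. \<rho> p * (f (Flow t p) / \<rho> (Flow t p)))" if f: "trig_poly0 f" for f
  proof -
    obtain B where B: "\<And>p. \<bar>f p\<bar> \<le> B" using trig_poly_bounded[OF trig_poly0_imp_trig_poly[OF f]] by blast
    note [measurable] = borel_trig_poly[OF trig_poly0_imp_trig_poly[OF f]]
    show ?thesis
    proof (rule cube_integrable_bounded[where C = "3 * B"])
      fix p
      have "\<bar>\<rho> p * (f (Flow t p) / \<rho> (Flow t p))\<bar> = \<bar>\<rho> p / \<rho> (Flow t p)\<bar> * \<bar>f (Flow t p)\<bar>"
        by (simp add: abs_mult)
      also have "\<dots> \<le> 3 * B" by (intro mult_mono \<rho>_ratio_le B) auto
      finally show "\<bar>\<rho> p * (f (Flow t p) / \<rho> (Flow t p))\<bar> \<le> 3 * B" .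
    qed measurable
  qed
  have "(\<integral>p. \<rho> p * ((f (Flow t p) + g (Flow t p)) / \<rho> (Flow t p)) \<partial>cube_measure)
      = (\<integral>p. \<rho> p * (f (Flow t p) / \<rho> (Flow t p)) + \<rho> p * (g (Flow t p) / \<rho> (Flow t p)) \<partial>cube_measure)"
    by (intro Bochner_Integration.integral_cong) (auto simp: add_divide_distrib algebra_simps)
  also have "\<dots> = 0" using add int by simp
  finally show ?case .
qed

lemma bounded_continuous_torus3:
  fixes u :: "torus3 \<Rightarrow> real"
  assumes "continuous_on UNIV u"
  obtains B where "0 < B" "\<And>z. \<bar>u z\<bar> \<le> B"
proof -
  have "bounded (range u)"
    using compact_continuous_image[OF assms compact_torus3] by (rule compact_imp_bounded)
  then show ?thesis using that by (auto simp: bounded_pos)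
qed

lemma trig_poly0_approximation:
  fixes u :: "torus3 \<Rightarrow> real"
  assumes u: "continuous_on UNIV u" and e: "0 < e"
  obtains g where "trig_poly0 g" "\<And>p. \<bar>u (to_torus3 p) - (\<integral>z. u z \<partial>\<mu>) - g p / \<rho> p\<bar> \<le> e"
proof -
  have [measurable]: "u \<in> borel_measurable borel" using u by (rule borel_measurable_continuous_onI)
  define m where "m = (\<integral>z. u z \<partial>\<mu>)"
  define w where "w z = torus_density z * (u z - m)" for z
  have w: "continuous_on UNIV w"
    unfolding w_def by (intro continuous_intros u continuous_on_torus_density)
  obtain g where g: "trig_poly g" "\<And>p. \<bar>w (to_torus3 p) - g p\<bar> < e / 4"
    using trig_poly_dense[OF w, of "e / 4"] e by auto
  obtain g0 l where g0: "trig_poly0 g0" "g = (\<lambda>p. l + g0 p)" using trig_poly_split[OF g(1)] by blast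
  obtain B where B: "\<And>z. \<bar>w z\<bar> \<le> B" using bounded_continuous_torus3[OF w] by blast
  obtain C where C: "\<And>z. \<bar>u z\<bar> \<le> C" using bounded_continuous_torus3[OF u] by blast
  have [measurable]: "w \<in> borel_measurable borel" using w by (rule borel_measurable_continuous_onI)
  have iw: "integrable cube_measure (\<lambda>p. w (to_torus3 p))"
    by (rule cube_integrable_bounded[OF _ B]) measurable
  have ig: "integrable cube_measure g0"
    using trig_poly_bounded[OF trig_poly0_imp_trig_poly[OF g0(1)]] borel_trig_poly[OF trig_poly0_imp_trig_poly[OF g0(1)]] by (auto intro!: cube_integrable_bounded)
  have iu: "integrable cube_measure (\<lambda>p. \<rho> p * u (to_torus3 p))"
  proof (rule cube_integrable_bounded[where C = "3 / 2 * C"])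
    show "\<bar>\<rho> p * u (to_torus3 p)\<bar> \<le> 3 / 2 * C" for p
      using \<rho>_bounds[of p] \<rho>_pos[of p] unfolding abs_mult by (intro mult_mono C) auto
  qed measurable
  have "(\<integral>p. w (to_torus3 p) \<partial>cube_measure) = (\<integral>p. \<rho> p * u (to_torus3 p) - m * \<rho> p \<partial>cube_measure)"
    by (rule Bochner_Integration.integral_cong) (auto simp: w_def torus_density_to_torus3 algebra_simps)
  also have "\<dots> = 0"
    using iu integrable_\<rho> by (simp add: integral_\<mu> m_def integral_\<rho>)
  finally have "(\<integral>p. w (to_torus3 p) - g p \<partial>cube_measure) = - l"
    using iw ig cube.prob_space by (simp add: g0 integral_trig_poly0[OF g0(1)])
  moreover have "\<bar>\<integral>p. w (to_torus3 p) - g p \<partial>cube_measure\<bar> \<le> (\<integral>p. e / 4 \<partial>cube_measure)"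
  proof (rule order_trans[OF integral_abs_bound integral_mono])
    show "\<bar>w (to_torus3 p) - g p\<bar> \<le> e / 4" for p using g(2)[of p] by simp
  qed (use iw ig g0 in auto)
  ultimately have l: "\<bar>l\<bar> \<le> e / 4" using cube.prob_space by simp
  show ?thesis
  proof (rule that[OF g0(1)])
    fix p
    have "u (to_torus3 p) - m - g0 p / \<rho> p = (w (to_torus3 p) - g0 p) / \<rho> p"
      using \<rho>_pos[of p] by (simp add: w_def torus_density_to_torus3 field_simps)
    also have "\<bar>\<dots>\<bar> \<le> (e / 2) / (1 / 2)"
      unfolding abs_divide
    proof (rule frac_le)
      show "\<bar>w (to_torus3 p) - g0 p\<bar> \<le> e / 2"
        using l g(2)[of p] unfolding g0(2) by linarith
    qed (use \<rho>_bounds(1)[of p] e in auto)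
    finally show "\<bar>u (to_torus3 p) - (\<integral>z. u z \<partial>\<mu>) - g0 p / \<rho> p\<bar> \<le> e" by (simp add: m_def)
  qed
qed

text \<open>After subtracting its mean, \<open>u\<close> is uniformly close to some
  \<open>g / \<rho>\<close>, and for these the integral along the flow is exactly zero.\<close>

lemma integral_torus_map:
  fixes u :: "torus3 \<Rightarrow> real"
  assumes u: "continuous_on UNIV u"
  shows "(\<integral>z. u (torus_map z) \<partial>\<mu>) = (\<integral>z. u z \<partial>\<mu>)"
proof -
  have [measurable]: "u \<in> borel_measurable borel" using u by (rule borel_measurable_continuous_onI)
  define m where "m = (\<integral>z. u z \<partial>\<mu>)"
  obtain C where C: "\<And>z. \<bar>u z\<bar> \<le> C" using bounded_continuous_torus3[OF u] by blast
  have iu: "integrable cube_measure (\<lambda>p. \<rho> p * u (to_torus3 (Flow 1 p)))"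
  proof (rule cube_integrable_bounded[where C = "3 / 2 * C"])
    show "\<bar>\<rho> p * u (to_torus3 (Flow 1 p))\<bar> \<le> 3 / 2 * C" for p
      using \<rho>_bounds[of p] \<rho>_pos[of p] unfolding abs_mult by (intro mult_mono C) auto
  qed measurable
  have "\<bar>(\<integral>z. u (torus_map z) \<partial>\<mu>) - m\<bar> \<le> 2 * e" if e: "0 < e" for e
  proof -
    obtain g where g: "trig_poly0 g" "\<And>p. \<bar>u (to_torus3 p) - m - g p / \<rho> p\<bar> \<le> e"
      using trig_poly0_approximation[OF u e] by (auto simp: m_def)
    note [measurable] = borel_trig_poly[OF trig_poly0_imp_trig_poly[OF g(1)]]
    obtain B where B: "\<And>p. \<bar>g p\<bar> \<le> B" using trig_poly_bounded[OF trig_poly0_imp_trig_poly[OF g(1)]] by blast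
    let ?d = "\<lambda>p. u (to_torus3 (Flow 1 p)) - m - g (Flow 1 p) / \<rho> (Flow 1 p)"
    have ig: "integrable cube_measure (\<lambda>p. \<rho> p * (g (Flow 1 p) / \<rho> (Flow 1 p)))"
    proof (rule cube_integrable_bounded[where C = "3 * B"])
      fix p
      have "\<bar>\<rho> p * (g (Flow 1 p) / \<rho> (Flow 1 p))\<bar> = \<bar>\<rho> p / \<rho> (Flow 1 p)\<bar> * \<bar>g (Flow 1 p)\<bar>"
        by (simp add: abs_mult)
      also have "\<dots> \<le> 3 * B" by (intro mult_mono \<rho>_ratio_le B) auto
      finally show "\<bar>\<rho> p * (g (Flow 1 p) / \<rho> (Flow 1 p))\<bar> \<le> 3 * B" .
    qed measurable
    have "(\<integral>p. \<rho> p * ?d p \<partial>cube_measure)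
       = (\<integral>p. \<rho> p * u (to_torus3 (Flow 1 p)) - \<rho> p * m - \<rho> p * (g (Flow 1 p) / \<rho> (Flow 1 p)) \<partial>cube_measure)"
      by (intro Bochner_Integration.integral_cong) (auto simp: algebra_simps)
    also have "\<dots> = (\<integral>p. \<rho> p * u (to_torus3 (Flow 1 p)) \<partial>cube_measure) - m"
      using iu ig integrable_\<rho> integral_trig_poly0_invariant[OF g(1), of 1] by (simp add: integral_\<rho>)
    also have "(\<integral>p. \<rho> p * u (to_torus3 (Flow 1 p)) \<partial>cube_measure) = (\<integral>z. u (torus_map z) \<partial>\<mu>)"
      by (subst integral_\<mu>) (auto simp: torus_map_to_torus3)
    finally have "(\<integral>p. \<rho> p * ?d p \<partial>cube_measure) = (\<integral>z. u (torus_map z) \<partial>\<mu>) - m" .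
    moreover have "\<bar>\<integral>p. \<rho> p * ?d p \<partial>cube_measure\<bar> \<le> (\<integral>p. 3 / 2 * e \<partial>cube_measure)"
    proof (rule order_trans[OF integral_abs_bound integral_mono])
      show bd: "\<bar>\<rho> p * ?d p\<bar> \<le> 3 / 2 * e" for p
        using \<rho>_bounds[of p] \<rho>_pos[of p] g(2)[of "Flow 1 p"] unfolding abs_mult by (intro mult_mono) auto
      show "integrable cube_measure (\<lambda>p. \<bar>\<rho> p * ?d p\<bar>)"
        by (rule cube_integrable_bounded[where C = "3 / 2 * e"]) (use bd in auto)
    qed auto
    ultimately show ?thesis using cube.prob_space e by simp
  qed
  then have "\<bar>(\<integral>z. u (torus_map z) \<partial>\<mu>) - m\<bar> \<le> 0 + e" if "0 < e" for e
    using that by (metis add_0 half_gt_zero field_sum_of_halves mult_2)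
  then have "\<bar>(\<integral>z. u (torus_map z) \<partial>\<mu>) - m\<bar> \<le> 0" by (rule field_le_epsilon)
  then show ?thesis by (simp add: m_def)
qed

lemma invariant_\<mu>: "distr \<mu> \<mu> torus_map = \<mu>"
proof (rule distr_eqI_continuous)
  interpret prob_space \<mu> by (rule prob_space_\<mu>)
  show "finite_measure \<mu>" by unfold_locales
qed (auto intro: integral_torus_map)

end

subsection \<open>Mixing by uniform stretch\<close>

text \<open>Indicators are replaced by continuous functions in the mean; invariance makes the error
  for \<open>A\<close> composed with \<open>T ^^ n\<close> independent of \<open>n\<close>.\<close>

lemma mixingI_continuous:
  fixes M :: "'a::metric_space measure"
  assumes M: "prob_space M" "sets M = sets borel" and T: "T \<in> borel_measurable borel"
    and inv: "distr M M T = M"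
    and lim: "\<And>u g :: 'a \<Rightarrow> real. continuous_on UNIV u \<Longrightarrow> continuous_on UNIV g \<Longrightarrow>
      (\<lambda>n. \<integral>x. u ((T ^^ n) x) * g x \<partial>M) \<longlonglongrightarrow> (\<integral>x. u x \<partial>M) * (\<integral>x. g x \<partial>M)"
  shows "mixing T M"
  unfolding mixing_def
proof (intro ballI)
  interpret prob_space M by fact
  fix A B assume AB [measurable]: "A \<in> sets M" "B \<in> sets M"
  then have AB': "A \<in> sets borel" "B \<in> sets borel" by (simp_all add: M(2))
  have [measurable]: "T \<in> measurable M M"
    using T measurable_cong_sets[OF M(2) M(2)] by simp
  have [measurable]: "(T ^^ n) \<in> measurable M M" for n
    by (induction n) (auto simp: id_def intro: measurable_comp)
  have inv_n: "distr M M (T ^^ n) = M" for n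
  proof (induction n)
    case 0
    show ?case by (simp add: id_def distr_id)
  next
    case (Suc n)
    have "distr M M (T \<circ> (T ^^ n)) = distr (distr M M (T ^^ n)) M T"
      by (rule distr_distr[symmetric]) measurable
    then show ?case by (simp only: funpow.simps Suc inv)
  qed
  show "(\<lambda>n. measure M ((T ^^ n) -` A \<inter> B)) \<longlonglongrightarrow> measure M A * measure M B"
  proof (rule LIMSEQ_I)
    fix e :: real assume "0 < e"
    \<comment> \<open>Five errors: two for the correlation, one for its limit, two for the product
      of the measures.\<close>
    then have e: "0 < e / 5" by simp
    have fm: "finite_measure M" by unfold_locales
    obtain u where u: "continuous_on UNIV u" "\<And>x. 0 \<le> u x \<and> u x \<le> 1"
      "(\<integral>x. \<bar>indicator A x - u x\<bar> \<partial>M) < e / 5"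
      using continuous_L1_approximation[OF fm M(2) AB'(1) e] by blast
    obtain g where g: "continuous_on UNIV g" "\<And>x. 0 \<le> g x \<and> g x \<le> 1"
      "(\<integral>x. \<bar>indicator B x - g x\<bar> \<partial>M) < e / 5"
      using continuous_L1_approximation[OF fm M(2) AB'(2) e] by blast
    have [measurable]: "u \<in> borel_measurable M" "g \<in> borel_measurable M"
      using borel_measurable_continuous_onI[OF u(1)] borel_measurable_continuous_onI[OF g(1)]
        measurable_cong_sets[OF M(2) refl] by blast+
    have bnd: "integrable M h" if "h \<in> borel_measurable M" "\<And>x. \<bar>h x\<bar> \<le> 1" for h :: "'a \<Rightarrow> real"
      using that by (intro integrable_const_bound[where B = 1]) auto
    have le1: "\<bar>indicator C x - h x\<bar> \<le> 1" if "0 \<le> h x \<and> h x \<le> 1" for C :: "'a set" and h :: "'a \<Rightarrow> real" and x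
      using that by (auto simp: indicator_def abs_le_iff)
    have iA: "integrable M (indicator A :: 'a \<Rightarrow> real)" "integrable M u"
      and iB: "integrable M (indicator B :: 'a \<Rightarrow> real)" "integrable M g"
      using u(2) g(2) by (auto intro!: bnd simp: indicator_def abs_le_iff intro: order_trans[of "-1" 0])
    let ?a = "\<lambda>x. \<bar>indicator A x - u x\<bar>" and ?b = "\<lambda>x. \<bar>indicator B x - g x\<bar>"
    have ia: "integrable M ?a" "integrable M (\<lambda>x. ?a ((T ^^ n) x))" "integrable M ?b" for n
      using le1 u(2) g(2) by (auto intro!: bnd)
    have prod: "\<bar>\<alpha> * \<beta> - \<gamma> * \<delta>\<bar> \<le> \<bar>\<alpha> - \<gamma>\<bar> + \<bar>\<beta> - \<delta>\<bar>"
      if "0 \<le> \<beta>" "\<beta> \<le> 1" "0 \<le> \<gamma>" "\<gamma> \<le> 1" for \<alpha> \<beta> \<gamma> \<delta> :: real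
    proof -
      have "\<bar>\<alpha> * \<beta> - \<gamma> * \<delta>\<bar> = \<bar>(\<alpha> - \<gamma>) * \<beta> + \<gamma> * (\<beta> - \<delta>)\<bar>" by (simp add: algebra_simps)
      also have "\<dots> \<le> \<bar>\<alpha> - \<gamma>\<bar> * \<beta> + \<gamma> * \<bar>\<beta> - \<delta>\<bar>"
        using that abs_triangle_ineq[of "(\<alpha> - \<gamma>) * \<beta>" "\<gamma> * (\<beta> - \<delta>)"] by (simp add: abs_mult)
      also have "\<dots> \<le> \<bar>\<alpha> - \<gamma>\<bar> * 1 + 1 * \<bar>\<beta> - \<delta>\<bar>"
        using that by (intro add_mono mult_mono) auto
      finally show ?thesis by simp
    qed
    have A_u: "\<bar>measure M A - (\<integral>x. u x \<partial>M)\<bar> < e / 5"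
    proof -
      have "\<bar>measure M A - (\<integral>x. u x \<partial>M)\<bar> = \<bar>\<integral>x. indicator A x - u x \<partial>M\<bar>"
        using iA by simp
      also have "\<dots> \<le> (\<integral>x. ?a x \<partial>M)" by (rule integral_abs_bound)
      finally show ?thesis using u(3) by simp
    qed
    have B_g: "\<bar>measure M B - (\<integral>x. g x \<partial>M)\<bar> < e / 5"
    proof -
      have "\<bar>measure M B - (\<integral>x. g x \<partial>M)\<bar> = \<bar>\<integral>x. indicator B x - g x \<partial>M\<bar>"
        using iB by simp
      also have "\<dots> \<le> (\<integral>x. ?b x \<partial>M)" by (rule integral_abs_bound)
      finally show ?thesis using g(3) by simp
    qed
    have u01: "0 \<le> (\<integral>x. u x \<partial>M)" "(\<integral>x. u x \<partial>M) \<le> 1"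
      using u(2) integral_mono[OF iA(2) integrable_const[of 1]] prob_space by auto
    have close: "\<bar>measure M ((T ^^ n) -` A \<inter> B) - (\<integral>x. u ((T ^^ n) x) * g x \<partial>M)\<bar> < 2 * (e / 5)" for n
    proof -
      have m: "(T ^^ n) -` A \<inter> B \<in> sets M"
      proof -
        have "(T ^^ n) -` A \<inter> B = ((T ^^ n) -` A \<inter> space M) \<inter> B"
          using sets.sets_into_space[OF AB(2)] by auto
        also have "\<dots> \<in> sets M" by measurable
        finally show ?thesis .
      qed
      have iug: "integrable M (\<lambda>x. u ((T ^^ n) x) * g x)"
        using u(2) g(2) by (intro bnd) (auto simp: abs_mult abs_le_iff mult_le_one)
      have iAB: "integrable M (\<lambda>x. indicator A ((T ^^ n) x) * indicator B x :: real)"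
        by (intro bnd) (auto simp: indicator_def)
      have "measure M ((T ^^ n) -` A \<inter> B) = (\<integral>x. indicator ((T ^^ n) -` A \<inter> B) x \<partial>M)"
        using m sets.sets_into_space[OF m] by (simp add: Int_absorb2)
      also have "\<dots> = (\<integral>x. indicator A ((T ^^ n) x) * indicator B x \<partial>M)"
        by (rule Bochner_Integration.integral_cong) (auto simp: indicator_def)
      finally have "\<bar>measure M ((T ^^ n) -` A \<inter> B) - (\<integral>x. u ((T ^^ n) x) * g x \<partial>M)\<bar>
          = \<bar>\<integral>x. indicator A ((T ^^ n) x) * indicator B x - u ((T ^^ n) x) * g x \<partial>M\<bar>"
        using iug iAB by simp
      also have "\<dots> \<le> (\<integral>x. \<bar>indicator A ((T ^^ n) x) * indicator B x - u ((T ^^ n) x) * g x\<bar> \<partial>M)"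
        by (rule integral_abs_bound)
      also have "\<dots> \<le> (\<integral>x. ?a ((T ^^ n) x) + ?b x \<partial>M)"
        using iug iAB ia u(2) g(2) by (intro integral_mono prod) auto
      also have "\<dots> = (\<integral>x. ?a ((T ^^ n) x) \<partial>M) + (\<integral>x. ?b x \<partial>M)"
        using ia by simp
      also have "(\<integral>x. ?a ((T ^^ n) x) \<partial>M) = (\<integral>x. ?a x \<partial>distr M M (T ^^ n))"
        by (rule integral_distr[symmetric]) measurable
      finally show ?thesis using u(3) g(3) by (simp add: inv_n)
    qed
    obtain N where N: "\<And>n. n \<ge> N \<Longrightarrow>
        norm ((\<integral>x. u ((T ^^ n) x) * g x \<partial>M) - (\<integral>x. u x \<partial>M) * (\<integral>x. g x \<partial>M)) < e / 5"
      using LIMSEQ_D[OF lim[OF u(1) g(1)] e] by blast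
    have "\<bar>(\<integral>x. u x \<partial>M) * (\<integral>x. g x \<partial>M) - measure M A * measure M B\<bar> \<le> 
        \<bar>measure M A - (\<integral>x. u x \<partial>M)\<bar> + \<bar>measure M B - (\<integral>x. g x \<partial>M)\<bar>"
      using prod[of "measure M B" "\<integral>x. u x \<partial>M" "measure M A" "\<integral>x. g x \<partial>M"] u01
      by (simp add: abs_minus_commute)
    then have "norm (measure M ((T ^^ n) -` A \<inter> B) - measure M A * measure M B) < e" if "n \<ge> N" for n
      using N[OF that] close[of n] A_u B_g unfolding real_norm_def by linarith
    then show "\<exists>N. \<forall>n\<ge>N. norm (measure M ((T ^^ n) -` A \<inter> B) - measure M A * measure M B) < e" by blast
  qed
qed

section \<open>Decay of correlations from stretching\<close>

context time_changed_flow
begin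

text \<open>The derivative of the travel time \<open>R (p, s)\<close> in \<open>p\<close> along
  \<open>w\<close>, at \<open>s = S t p\<close>. A segment in the direction \<open>w\<close> is
  sheared along \<open>v\<close> by minus this, divided by the density at the end point.\<close>

definition stretch :: "real^3 \<Rightarrow> real \<Rightarrow> real^3 \<Rightarrow> real" where
  "stretch w t p = H (\<lambda>n. a n * (2 * pi * (k n \<bullet> w))) (pi / 2) (p, S t p)"

lemma stretch_has_derivative:
  obtains A' where "\<And>p. (stretch w t has_derivative A' p) (at p)"
    "\<And>p h. A' p h = H (\<lambda>n. a n * (2 * pi * (k n \<bullet> w)) * (2 * pi * (k n \<bullet> h))) (pi / 2 + pi / 2) (p, S t p)
      + DS t p h * G (\<lambda>n. a n * (2 * pi * (k n \<bullet> w))) (pi / 2) (p, S t p)"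
proof -
  note d = H_graph_has_derivative[OF rapid_inner[OF rapid_a, of w], of "pi / 2" t]
  show ?thesis
    by (rule that[OF _ refl]) (use d in \<open>simp only: stretch_def[abs_def]\<close>)
qed

lemma S_nonneg: "0 \<le> t \<Longrightarrow> 0 \<le> S t p"
  using S_bounds(1)[of t p] by simp

text \<open>Integration by parts in the direction \<open>w\<close> against the weight \<open>A / (A\<^sup>2 + K\<^sup>2)\<close>, where
  \<open>A = stretch w t\<close>; it replaces \<open>1 / A\<close>, which is singular where \<open>A\<close> vanishes.\<close>

lemma correlation_bound:
  fixes b :: "real^3 \<Rightarrow> real"
  assumes l: "l \<in> int_vec" and t: "0 \<le> t" and K: "0 < K"
    and b: "\<And>p. (b has_derivative b' p) (at p)" "periodic b" "\<And>p. \<bar>b p\<bar> \<le> B"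
      "(\<lambda>p. b' p w) \<in> borel_measurable borel" "\<And>p. \<bar>b' p w\<bar> \<le> B'"
  defines "C1 \<equiv> (\<Sum>n. \<bar>a n * (2 * pi * (k n \<bullet> w))\<bar>)"
    and "C2 \<equiv> (\<Sum>n. \<bar>a n * (2 * pi * (k n \<bullet> w)) * (2 * pi * (k n \<bullet> w))\<bar>)"
  shows "2 * pi * \<bar>l \<bullet> v\<bar> * \<bar>\<integral>p. cos (2 * pi * (l \<bullet> Flow t p) + c) / \<rho> (Flow t p) * b p \<partial>cube_measure\<bar>
    \<le> B * (2 * pi * \<bar>l \<bullet> w\<bar> + 2 * C1) / K + B * (2 * t * C2) / K\<^sup>2 + B' / K
      + 2 * pi * \<bar>l \<bullet> v\<bar> * (2 * B * (\<integral>p. K\<^sup>2 / ((stretch w t p)\<^sup>2 + K\<^sup>2) \<partial>cube_measure))"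
proof -
  define A where "A = stretch w t"
  obtain A' where A': "\<And>p. (A has_derivative A' p) (at p)"
    "\<And>p h. A' p h = H (\<lambda>n. a n * (2 * pi * (k n \<bullet> w)) * (2 * pi * (k n \<bullet> h))) (pi / 2 + pi / 2) (p, S t p)
      + DS t p h * G (\<lambda>n. a n * (2 * pi * (k n \<bullet> w))) (pi / 2) (p, S t p)"
    unfolding A_def using stretch_has_derivative[of w t] by blast
  define f where "f p = cos (2 * pi * (l \<bullet> Flow t p) + c)" for p
  define h where "h p = sin (2 * pi * (l \<bullet> Flow t p) + c)" for p
  define h' where "h' p u = cos (2 * pi * (l \<bullet> Flow t p) + c) * (2 * pi * (l \<bullet> u + DS t p u * (l \<bullet> v)))" for p u
  define N where "N p = (A p)\<^sup>2 + K\<^sup>2" for p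
  define Y where "Y p = A p / N p" for p
  define Y' where "Y' p u = A' p u * (K\<^sup>2 - (A p)\<^sup>2) / (N p)\<^sup>2" for p u
  \<comment> \<open>\<open>Z\<close> is \<open>1 - A * Y\<close>, the defect caused by regularising;
    it is close to 1 only where \<open>A\<close> is small compared with \<open>K\<close>.\<close>
  define Z where "Z p = K\<^sup>2 / N p" for p
  have N: "0 < N p" "K\<^sup>2 \<le> N p" for p using K by (auto simp: N_def add_nonneg_pos)
  have B0: "0 \<le> B" using b(3)[of 0] by linarith
  have B'0: "0 \<le> B'" using b(5)[of 0] by linarith
  have DSw: "DS t p w = - A p / \<rho> (Flow t p)" for p by (simp add: A_def stretch_def)
  have der_Y: "(Y has_derivative Y' p) (at p)" for p
  proof -
    have "((\<lambda>p. A p / ((A p)\<^sup>2 + K\<^sup>2)) has_derivative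
        (\<lambda>u. ((A' p u) * ((A p)\<^sup>2 + K\<^sup>2) - A p * (2 * A p * A' p u)) / (((A p)\<^sup>2 + K\<^sup>2) * ((A p)\<^sup>2 + K\<^sup>2)))) (at p)"
      using N(1)[of p] unfolding N_def
      by (auto intro!: derivative_eq_intros A' simp: mult_ac)
    then show ?thesis
      unfolding Y_def[abs_def] N_def Y'_def[abs_def]
      by (rule has_derivative_eq_rhs) (simp add: fun_eq_iff power2_eq_square algebra_simps)
  qed
  have der_h: "(h has_derivative h' p) (at p)" for p
    unfolding h_def[abs_def] h'_def[abs_def] by (rule character_has_derivative)
  have der_U: "((\<lambda>p. h p * Y p * b p) has_derivative
      (\<lambda>u. h p * Y p * b' p u + (h p * Y' p u + h' p u * Y p) * b p)) (at p)" for p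
    by (intro has_derivative_mult der_h der_Y b)
  \<comment> \<open>Inequality of arithmetic and geometric means. It bounds \<open>Y\<close>, and it
    absorbs the factor \<open>A\<close> that the derivative of \<open>S t\<close> brings into
    \<open>A'\<close>.\<close>
  have KA: "2 * K * \<bar>A p\<bar> \<le> N p" for p
    using zero_le_power2[of "\<bar>A p\<bar> - K"] by (simp add: N_def power2_eq_square algebra_simps)
  have absY: "\<bar>Y p\<bar> \<le> 1 / K" for p
  proof -
    have "0 \<le> K * \<bar>A p\<bar>" using K by simp
    then have "K * \<bar>A p\<bar> \<le> N p" using KA[of p] by linarith
    then show ?thesis using N(1)[of p] K by (simp add: Y_def field_simps)
  qed
  have absY': "\<bar>Y' p w\<bar> \<le> 2 * t * C2 / K\<^sup>2 + 2 * C1 / K" for p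
  proof -
    have r2: "rapid (\<lambda>n. a n * (2 * pi * (k n \<bullet> w)) * (2 * pi * (k n \<bullet> w)))" "rapid (\<lambda>n. a n * (2 * pi * (k n \<bullet> w)))"
      by (intro rapid_inner rapid_a)+
    have C: "0 \<le> C1" "0 \<le> C2" unfolding C1_def C2_def by (intro suminf_nonneg rapid_summable r2; simp)+
    have s: "\<bar>S t p\<bar> \<le> 2 * t" using S_bounds(2)[OF t] S_nonneg[OF t] by simp
    have "\<bar>H (\<lambda>n. a n * (2 * pi * (k n \<bullet> w)) * (2 * pi * (k n \<bullet> w))) (pi / 2 + pi / 2) (p, S t p)\<bar> \<le> 2 * t * C2"
      using abs_H_le[OF r2(1)] mult_right_mono[OF s C(2)] unfolding C2_def by (rule order_trans)
    moreover have "\<bar>DS t p w * G (\<lambda>n. a n * (2 * pi * (k n \<bullet> w))) (pi / 2) (p, S t p)\<bar> \<le> (2 * \<bar>A p\<bar>) * C1"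
    proof -
      have "\<bar>DS t p w\<bar> \<le> 2 * \<bar>A p\<bar>"
      proof -
        have "\<bar>A p\<bar> * 1 \<le> \<bar>A p\<bar> * (2 * \<rho> (Flow t p))"
          using \<rho>_bounds(1)[of "Flow t p"] by (intro mult_left_mono) auto
        then show ?thesis
          unfolding DSw using \<rho>_pos[of "Flow t p"] by (simp add: field_simps)
      qed
      then show ?thesis
        unfolding abs_mult C1_def
        by (rule mult_mono[OF _ abs_G_le[OF r2(2), unfolded abs_mult]]) (simp_all only: abs_ge_zero mult_nonneg_nonneg)
    qed
    ultimately have A'w: "\<bar>A' p w\<bar> \<le> 2 * t * C2 + 2 * \<bar>A p\<bar> * C1"
      unfolding A'(2) by linarith
    have "\<bar>K\<^sup>2 - (A p)\<^sup>2\<bar> \<le> N p" unfolding N_def by (simp add: abs_le_iff)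
    then have "\<bar>Y' p w\<bar> \<le> (2 * t * C2 + 2 * \<bar>A p\<bar> * C1) * N p / (N p)\<^sup>2"
      unfolding Y'_def abs_divide abs_mult using A'w N(1)[of p]
      by (intro divide_mono mult_mono) (auto simp: order_trans[OF abs_ge_zero A'w])
    also have "\<dots> = 2 * t * C2 / N p + (2 * \<bar>A p\<bar> * C1) / N p"
      using N(1)[of p] by (simp add: power2_eq_square add_divide_distrib)
    also have "\<dots> \<le> 2 * t * C2 / K\<^sup>2 + 2 * C1 / K"
    proof (intro add_mono)
      show "2 * t * C2 / N p \<le> 2 * t * C2 / K\<^sup>2"
        using N(2)[of p] K t C by (intro divide_left_mono) (auto intro!: mult_pos_pos N)
      have "(2 * K * \<bar>A p\<bar>) * C1 \<le> N p * C1" using KA C by (intro mult_right_mono)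
      moreover have "0 \<le> N p * C1" using N(1)[of p] C by simp
      ultimately show "2 * \<bar>A p\<bar> * C1 / N p \<le> 2 * C1 / K"
        using N(1)[of p] K by (simp add: field_simps)
    qed
    finally show ?thesis .
  qed
  \<comment> \<open>The part of the derivative of \<open>h * Y * b\<close> along \<open>w\<close>
    that is small for large \<open>K\<close>. The rest comes from the shear along \<open>v\<close>;
    it carries the factor \<open>A * Y = 1 - Z\<close> and reproduces the integrand of the
    correlation.\<close>
  define E where "E p = f p * (2 * pi * (l \<bullet> w)) * Y p * b p + h p * Y' p w * b p + h p * Y p * b' p w" for p
  define E0 where "E0 = (2 * pi * \<bar>l \<bullet> w\<bar>) * (1 / K) * B + (2 * t * C2 / K\<^sup>2 + 2 * C1 / K) * B + (1 / K) * B'"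
  define U' where "U' p u = h p * Y p * b' p u + (h p * Y' p u + h' p u * Y p) * b p" for p u
  define X where "X p = f p / \<rho> (Flow t p) * b p" for p
  have f1: "\<bar>f p\<bar> \<le> 1" "\<bar>h p\<bar> \<le> 1" for p by (auto simp: f_def h_def)
  have absE: "\<bar>E p\<bar> \<le> E0" for p
  proof -
    have "\<bar>f p * (2 * pi * (l \<bullet> w)) * Y p * b p\<bar> \<le> 1 * (2 * pi * \<bar>l \<bullet> w\<bar>) * (1 / K) * B"
      unfolding abs_mult using f1 absY[of p] b(3) K B0 by (intro mult_mono) auto
    moreover have "\<bar>h p * Y' p w * b p\<bar> \<le> 1 * (2 * t * C2 / K\<^sup>2 + 2 * C1 / K) * B"
      unfolding abs_mult using f1 b(3) B0 absY'[of p] by (intro mult_mono) auto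
    moreover have "\<bar>h p * Y p * b' p w\<bar> \<le> 1 * (1 / K) * B'"
      unfolding abs_mult using f1 absY[of p] b(5) K B'0 by (intro mult_mono) auto
    ultimately show ?thesis unfolding E_def E0_def by linarith
  qed
  have Z: "0 \<le> Z p" "Z p \<le> 1" for p using N[of p] K by (auto simp: Z_def field_simps)
  have AY: "A p * Y p = 1 - Z p" for p
    using N(1)[of p] by (simp add: Y_def Z_def field_simps) (simp add: N_def power2_eq_square)
  have ident: "U' p w = E p - 2 * pi * (l \<bullet> v) * (X p * (1 - Z p))" for p
  proof -
    have "h' p w = f p * (2 * pi * (l \<bullet> w)) - 2 * pi * (l \<bullet> v) * (f p / \<rho> (Flow t p)) * A p"
      unfolding h'_def f_def[symmetric] DSw by (simp add: algebra_simps)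
    then have "h' p w * Y p = f p * (2 * pi * (l \<bullet> w)) * Y p - 2 * pi * (l \<bullet> v) * (f p / \<rho> (Flow t p)) * (A p * Y p)"
      by (simp only: left_diff_distrib mult.assoc)
    moreover have "h p * Y p * b' p w + (h p * Y' p w + (x - y * q * z)) * b p
        = x * b p + h p * Y' p w * b p + h p * Y p * b' p w - y * (q * b p * z)" for x y q z :: real
      by (simp add: algebra_simps)
    ultimately show ?thesis
      unfolding U'_def E_def X_def AY by (simp only:)
  qed
  have absX: "\<bar>X p\<bar> \<le> 2 * B" for p
  proof -
    have "\<bar>f p / \<rho> (Flow t p)\<bar> \<le> 1 / (1 / 2)"
      unfolding abs_divide using f1 \<rho>_bounds(1)[of "Flow t p"] by (intro frac_le) auto
    then show ?thesis unfolding X_def abs_mult using b(3) by (intro mult_mono) auto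
  qed
  have contI: "continuous_on UNIV g" if "\<And>p. (g has_derivative g' p) (at p)" for g :: "real^3 \<Rightarrow> real" and g'
    using that has_derivative_continuous by (blast intro: continuous_at_imp_continuous_on)
  have [measurable]: "A \<in> borel_measurable borel" "b \<in> borel_measurable borel" "Y \<in> borel_measurable borel"
    "h \<in> borel_measurable borel"
    by (intro borel_measurable_continuous_onI contI; rule A' b der_Y der_h)+
  have [measurable]: "f \<in> borel_measurable borel" unfolding f_def[abs_def] by measurable
  have [measurable]: "(\<lambda>p. b' p w) \<in> borel_measurable borel" by fact
  have [measurable]: "(\<lambda>p. A' p w) \<in> borel_measurable borel"
  proof -
    obtain D where D: "\<And>p. ((\<lambda>p. A' p w) has_derivative D p) (at p)"
    proof -
      have "orbit_function t (\<lambda>p. A' p w)"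
        unfolding A'(2)
        by (rule orbit_function.add[OF orbit_function.H[OF rapid_inner[OF rapid_inner[OF rapid_a]]]
              orbit_function.mult[OF orbit_function_DS orbit_function.G[OF rapid_inner[OF rapid_a]]]])
      then show ?thesis using that orbit_function_derivative by blast
    qed
    then show ?thesis by (intro borel_measurable_continuous_onI contI)
  qed
  have [measurable]: "N \<in> borel_measurable borel" unfolding N_def[abs_def] by measurable
  have [measurable]: "(\<lambda>p. Y' p w) \<in> borel_measurable borel" unfolding Y'_def by measurable
  have [measurable]: "Z \<in> borel_measurable borel" unfolding Z_def[abs_def] by measurable
  have [measurable]: "E \<in> borel_measurable borel" unfolding E_def[abs_def] by measurable
  have [measurable]: "X \<in> borel_measurable borel" unfolding X_def[abs_def] by measurable
  have XZ: "\<bar>X p * Z p\<bar> \<le> 2 * B * Z p" "\<bar>X p * Z p\<bar> \<le> 2 * B" for p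
  proof -
    show "\<bar>X p * Z p\<bar> \<le> 2 * B * Z p"
      unfolding abs_mult using absX[of p] Z[of p] by (simp add: mult_right_mono)
    then show "\<bar>X p * Z p\<bar> \<le> 2 * B" using mult_left_mono[OF Z(2)[of p], of "2 * B"] B0 by simp
  qed
  have iE: "integrable cube_measure E" by (rule cube_integrable_bounded[OF _ absE]) measurable
  have iX: "integrable cube_measure X" by (rule cube_integrable_bounded[OF _ absX]) measurable
  have iXZ: "integrable cube_measure (\<lambda>p. X p * Z p)" by (rule cube_integrable_bounded[OF _ XZ(2)]) measurable
  have iZ: "integrable cube_measure Z" by (rule cube_integrable_bounded[where C = 1]) (use Z in auto)
  have U'0: "(\<integral>p. U' p w \<partial>cube_measure) = 0"
  proof (rule integral_directional_derivative[where f' = U'])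
    show "((\<lambda>p. h p * Y p * b p) has_derivative U' p) (at p)" for p
      unfolding U'_def[abs_def] by (rule der_U)
    have perA: "periodic A"
      by (simp add: periodic_def A_def stretch_def S_add_int H_add_int)
    have "periodic h"
      unfolding h_def by (rule periodic_comp_Flow[OF periodic_sin[OF l]])
    with perA b(2) show "periodic (\<lambda>p. h p * Y p * b p)"
      by (simp add: periodic_def Y_def N_def)
    show "\<bar>h p * Y p * b p\<bar> \<le> 1 * (1 / K) * B" for p
      unfolding abs_mult using f1 absY[of p] b(3) K by (intro mult_mono) auto
    show "\<bar>U' p w\<bar> \<le> E0 + 2 * pi * \<bar>l \<bullet> v\<bar> * (2 * B + 2 * B)" for p
    proof -
      have "\<bar>X p * (1 - Z p)\<bar> \<le> 2 * B + 2 * B"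
        using absX[of p] XZ(2)[of p] by (simp add: algebra_simps abs_le_iff)
      then have "\<bar>2 * pi * (l \<bullet> v) * (X p * (1 - Z p))\<bar> \<le> 2 * pi * \<bar>l \<bullet> v\<bar> * (2 * B + 2 * B)"
        unfolding abs_mult[of "2 * pi * (l \<bullet> v)"] by (intro mult_mono) (auto simp: abs_mult)
      then show ?thesis unfolding ident using absE[of p] by linarith
    qed
  qed
  have "0 = (\<integral>p. E p - (2 * pi * (l \<bullet> v)) * (X p - X p * Z p) \<partial>cube_measure)"
    using U'0 unfolding ident by (simp add: algebra_simps)
  also have "\<dots> = (\<integral>p. E p \<partial>cube_measure) -
      (2 * pi * (l \<bullet> v)) * ((\<integral>p. X p \<partial>cube_measure) - (\<integral>p. X p * Z p \<partial>cube_measure))"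
    using iE iX iXZ by simp
  finally have eq: "(2 * pi * (l \<bullet> v)) * (\<integral>p. X p \<partial>cube_measure)
      = (\<integral>p. E p \<partial>cube_measure) + (2 * pi * (l \<bullet> v)) * (\<integral>p. X p * Z p \<partial>cube_measure)"
    by (simp add: algebra_simps)
  have "\<bar>\<integral>p. E p \<partial>cube_measure\<bar> \<le> (\<integral>p. E0 \<partial>cube_measure)"
    using absE iE by (intro order_trans[OF integral_abs_bound integral_mono]) auto
  then have bE: "\<bar>\<integral>p. E p \<partial>cube_measure\<bar> \<le> E0" using cube.prob_space by simp
  have "\<bar>\<integral>p. X p * Z p \<partial>cube_measure\<bar> \<le> (\<integral>p. 2 * B * Z p \<partial>cube_measure)"
    using XZ(1) iXZ iZ by (intro order_trans[OF integral_abs_bound integral_mono]) auto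
  then have bXZ: "\<bar>\<integral>p. X p * Z p \<partial>cube_measure\<bar> \<le> 2 * B * (\<integral>p. Z p \<partial>cube_measure)" by simp
  have "2 * pi * \<bar>l \<bullet> v\<bar> * \<bar>\<integral>p. X p \<partial>cube_measure\<bar> = \<bar>(2 * pi * (l \<bullet> v)) * (\<integral>p. X p \<partial>cube_measure)\<bar>"
    by (simp add: abs_mult)
  also have "\<dots> \<le> \<bar>\<integral>p. E p \<partial>cube_measure\<bar> + \<bar>(2 * pi * (l \<bullet> v)) * (\<integral>p. X p * Z p \<partial>cube_measure)\<bar>"
    unfolding eq by (rule abs_triangle_ineq)
  also have "\<dots> \<le> E0 + 2 * pi * \<bar>l \<bullet> v\<bar> * (2 * B * (\<integral>p. Z p \<partial>cube_measure))"
  proof (rule add_mono[OF bE])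
    have "\<bar>(2 * pi * (l \<bullet> v)) * (\<integral>p. X p * Z p \<partial>cube_measure)\<bar>
        = 2 * pi * \<bar>l \<bullet> v\<bar> * \<bar>\<integral>p. X p * Z p \<partial>cube_measure\<bar>"
      by (simp add: abs_mult)
    also have "\<dots> \<le> 2 * pi * \<bar>l \<bullet> v\<bar> * (2 * B * (\<integral>p. Z p \<partial>cube_measure))"
      by (rule mult_left_mono[OF bXZ]) simp
    finally show "\<bar>(2 * pi * (l \<bullet> v)) * (\<integral>p. X p * Z p \<partial>cube_measure)\<bar>
        \<le> 2 * pi * \<bar>l \<bullet> v\<bar> * (2 * B * (\<integral>p. Z p \<partial>cube_measure))" .
  qed
  also have "E0 = B * (2 * pi * \<bar>l \<bullet> w\<bar> + 2 * C1) / K + B * (2 * t * C2) / K\<^sup>2 + B' / K"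
    by (simp add: E0_def add_divide_distrib algebra_simps)
  finally show ?thesis by (simp add: X_def f_def Z_def N_def A_def)
qed

end

context time_changed_flow
begin

text \<open>The integrand is at most 1 on \<open>E\<close>; off \<open>E\<close> it is at most
  \<open>K\<^sup>2 / (\<zeta> * M)\<^sup>2\<close>, which the choice of \<open>K\<close> makes equal
  to \<open>\<epsilon>\<close>.\<close>

lemma stretch_weight_integral_le:
  assumes "0 < \<zeta>" "0 < M" "0 < \<epsilon>" and E: "E \<in> sets borel" "measure cube_measure (E \<inter> cube3) \<le> \<epsilon>"
    and big: "\<And>p. p \<in> cube3 - E \<Longrightarrow> \<zeta> * M \<le> \<bar>stretch w t p\<bar>"
    and K: "K = \<zeta> * sqrt \<epsilon> * M"
  shows "(\<integral>p. K\<^sup>2 / ((stretch w t p)\<^sup>2 + K\<^sup>2) \<partial>cube_measure) \<le> 2 * \<epsilon>"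
proof -
  have K0: "0 < K" unfolding K using assms(1-3) by simp
  have "isCont (stretch w t) p" for p
    unfolding stretch_def[abs_def]
    by (rule has_derivative_continuous[OF H_graph_has_derivative[OF rapid_inner[OF rapid_a]]])
  then have "continuous_on UNIV (stretch w t)"
    by (blast intro: continuous_at_imp_continuous_on)
  then have [measurable]: "stretch w t \<in> borel_measurable borel"
    by (rule borel_measurable_continuous_onI)
  have Z1: "\<bar>K\<^sup>2 / ((stretch w t p)\<^sup>2 + K\<^sup>2)\<bar> \<le> 1" for p
    using K0 by (simp add: divide_le_eq add_nonneg_pos)
  have "(\<integral>p. K\<^sup>2 / ((stretch w t p)\<^sup>2 + K\<^sup>2) \<partial>cube_measure) \<le> (\<integral>p. indicator (E \<inter> cube3) p + \<epsilon> \<partial>cube_measure)"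
  proof (rule integral_mono)
    show "integrable cube_measure (\<lambda>p. K\<^sup>2 / ((stretch w t p)\<^sup>2 + K\<^sup>2))"
      by (rule cube_integrable_bounded[OF _ Z1]) measurable
    have [measurable]: "E \<in> sets borel" by fact
    show "integrable cube_measure (\<lambda>p. indicator (E \<inter> cube3) p + \<epsilon>)"
      by (intro cube_integrable_bounded[where C = "1 + \<epsilon>"]) (use assms in \<open>auto simp: indicator_def\<close>)
    fix p assume "p \<in> space cube_measure"
    then have p: "p \<in> cube3" by simp
    show "K\<^sup>2 / ((stretch w t p)\<^sup>2 + K\<^sup>2) \<le> indicator (E \<inter> cube3) p + \<epsilon>"
    proof (cases "p \<in> E")
      case True
      then show ?thesis using Z1[of p] p assms(3) by (simp add: abs_le_iff)
    next
      case False
      have "(\<zeta> * M)\<^sup>2 \<le> \<bar>stretch w t p\<bar>\<^sup>2"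
        using big[of p] p False assms by (intro power_mono) auto
      then have sq: "(\<zeta> * M)\<^sup>2 \<le> (stretch w t p)\<^sup>2 + K\<^sup>2" by (simp add: add_increasing2)
      have pos: "0 < (\<zeta> * M)\<^sup>2" using assms by simp
      have "K\<^sup>2 / ((stretch w t p)\<^sup>2 + K\<^sup>2) \<le> K\<^sup>2 / (\<zeta> * M)\<^sup>2"
        by (rule divide_left_mono[OF sq _ mult_pos_pos[OF less_le_trans[OF pos sq] pos]]) simp
      also have "K\<^sup>2 / (\<zeta> * M)\<^sup>2 = \<epsilon>"
      proof -
        have "K\<^sup>2 = \<epsilon> * (\<zeta> * M)\<^sup>2"
          using assms(3) by (simp add: K power_mult_distrib)
        then show ?thesis using pos by simp
      qed
      finally show ?thesis using False by simp
    qed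
  qed
  also have "\<dots> = measure cube_measure (E \<inter> cube3) + \<epsilon>"
  proof -
    have "E \<inter> cube3 \<in> sets cube_measure"
      using E(1) unfolding cube_measure_def by (subst sets_restrict_space_iff) auto
    then show ?thesis using cube.prob_space by (subst Bochner_Integration.integral_add)
      (auto simp: Int_assoc cube.emeasure_eq_measure intro!: integrable_real_indicator)
  qed
  finally show ?thesis using E(2) by simp
qed

text \<open>The hypotheses say that the time-\<open>n\<close> map stretches uniformly in the direction \<open>w n\<close>, at
  the rate \<open>M n\<close>, outside a set of small measure.\<close>

context
  fixes w :: "nat \<Rightarrow> real^3" and W :: real and M :: "nat \<Rightarrow> real"
  assumes w_le: "\<And>n. norm (w n) \<le> W"
    and M_top: "filterlim M at_top sequentially"
    and M_sq: "(\<lambda>n. real n / (M n)\<^sup>2) \<longlonglongrightarrow> 0"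
    and stretch_large: "\<And>\<epsilon>. 0 < \<epsilon> \<Longrightarrow> \<exists>\<zeta>>0. \<forall>\<^sub>F n in sequentially. \<exists>E\<in>sets borel.
      measure cube_measure (E \<inter> cube3) \<le> \<epsilon> \<and> (\<forall>p\<in>cube3 - E. \<zeta> * M n \<le> \<bar>stretch (w n) (real n) p\<bar>)"
begin

text \<open>Take \<open>K\<close> as a fixed multiple of \<open>M n\<close> in
  \<open>correlation_bound\<close>. The terms with \<open>1 / K\<close> vanish since
  \<open>M n\<close> tends to infinity, the one with \<open>n / K\<^sup>2\<close> (the derivative of
  the stretch grows linearly in time) by \<open>M_sq\<close>, and the integral that remains is of
  order \<open>\<epsilon>\<close>.\<close>

lemma correlation_character:
  assumes l: "l \<in> int_vec" "l \<noteq> 0" and b: "trig_poly b"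
  shows "(\<lambda>n. \<integral>p. cos (2 * pi * (l \<bullet> Flow (real n) p) + c) / \<rho> (Flow (real n) p) * b p \<partial>cube_measure) \<longlonglongrightarrow> 0"
proof -
  define J where "J n = (\<integral>p. cos (2 * pi * (l \<bullet> Flow (real n) p) + c) / \<rho> (Flow (real n) p) * b p \<partial>cube_measure)" for n
  obtain b' where b': "\<And>p. (b has_derivative b' p) (at p)" "\<And>w. trig_poly (\<lambda>p. b' p w)"
    using trig_poly_derivative[OF b] by blast
  obtain B where B: "\<And>p. \<bar>b p\<bar> \<le> B" using trig_poly_bounded[OF b] by blast
  have "\<forall>i. \<exists>B'. \<forall>p. \<bar>b' p (axis i 1)\<bar> \<le> B'" using trig_poly_bounded[OF b'(2)] by blast
  then obtain Bi where Bi: "\<And>i p. \<bar>b' p (axis i 1)\<bar> \<le> Bi i" by metis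
  have W0: "0 \<le> W" using order_trans[OF norm_ge_zero w_le[of 0]] .
  define B' where "B' = (\<Sum>i\<in>UNIV. W * Bi i)"
  have B': "\<bar>b' p (w n)\<bar> \<le> B'" for p n
  proof -
    interpret bl: bounded_linear "b' p" by (rule has_derivative_bounded_linear[OF b'(1)])
    have "w n = (\<Sum>i\<in>UNIV. (w n $ i) *\<^sub>R axis i 1)"
      using basis_expansion[of "w n"] by (simp add: scalar_mult_eq_scaleR)
    then have "b' p (w n) = b' p (\<Sum>i\<in>UNIV. (w n $ i) *\<^sub>R axis i 1)" by (rule arg_cong)
    also have "\<dots> = (\<Sum>i\<in>UNIV. (w n $ i) * b' p (axis i 1))"
      by (simp add: bl.sum bl.scaleR)
    finally have "\<bar>b' p (w n)\<bar> \<le> (\<Sum>i\<in>UNIV. \<bar>w n $ i\<bar> * \<bar>b' p (axis i 1)\<bar>)"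
      using sum_abs[of "\<lambda>i. (w n $ i) * b' p (axis i 1)" UNIV] by (simp add: abs_mult)
    also have "\<dots> \<le> B'"
      unfolding B'_def
    proof (intro sum_mono mult_mono Bi)
      show "\<bar>w n $ i\<bar> \<le> W" for i using component_le_norm_cart[of "w n" i] w_le[of n] by linarith
    qed (use W0 in auto)
    finally show ?thesis .
  qed
  have wk: "\<bar>2 * pi * (k j \<bullet> w n)\<bar> \<le> 2 * pi * W * (1 + norm (k j))" for j n
  proof -
    have "2 * pi * norm (w n) * (1 + norm (k j)) \<le> 2 * pi * W * (1 + norm (k j))"
      using w_le by (intro mult_right_mono mult_left_mono) auto
    with inner_k_le[of j "w n"] show ?thesis by linarith
  qed
  \<comment> \<open>Bounds for the constants \<open>C1\<close> and \<open>C2\<close> of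
    \<open>correlation_bound\<close> that are uniform in the direction \<open>w n\<close>.\<close>
  define D1 where "D1 = (\<Sum>j. a j * (1 + norm (k j)) ^ 1 * (2 * pi * W))"
  define D2 where "D2 = (\<Sum>j. a j * (1 + norm (k j)) ^ 2 * (2 * pi * W)\<^sup>2)"
  have C1: "(\<Sum>j. \<bar>a j * (2 * pi * (k j \<bullet> w n))\<bar>) \<le> D1" for n
    unfolding D1_def
  proof (rule suminf_le)
    show "\<bar>a j * (2 * pi * (k j \<bullet> w n))\<bar> \<le> a j * (1 + norm (k j)) ^ 1 * (2 * pi * W)" for j
    proof -
      have "\<bar>a j * (2 * pi * (k j \<bullet> w n))\<bar> = a j * \<bar>2 * pi * (k j \<bullet> w n)\<bar>"
        using a_nonneg[of j] by (simp add: abs_mult)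
      also have "\<dots> \<le> a j * (2 * pi * W * (1 + norm (k j)))"
        by (rule mult_left_mono[OF wk a_nonneg])
      finally show ?thesis by (simp add: mult_ac)
    qed
  qed (intro rapid_summable rapid_inner rapid_a summable_mult2 a_rapid)+
  have C2: "(\<Sum>j. \<bar>a j * (2 * pi * (k j \<bullet> w n)) * (2 * pi * (k j \<bullet> w n))\<bar>) \<le> D2" for n
    unfolding D2_def
  proof (rule suminf_le)
    show "\<bar>a j * (2 * pi * (k j \<bullet> w n)) * (2 * pi * (k j \<bullet> w n))\<bar> \<le> a j * (1 + norm (k j)) ^ 2 * (2 * pi * W)\<^sup>2" for j
    proof -
      have "\<bar>a j * (2 * pi * (k j \<bullet> w n)) * (2 * pi * (k j \<bullet> w n))\<bar>
          = a j * (\<bar>2 * pi * (k j \<bullet> w n)\<bar> * \<bar>2 * pi * (k j \<bullet> w n)\<bar>)"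
        using a_nonneg[of j] by (simp add: abs_mult)
      also have "\<dots> \<le> a j * ((2 * pi * W * (1 + norm (k j))) * (2 * pi * W * (1 + norm (k j))))"
        using W0 by (intro mult_left_mono[OF _ a_nonneg] mult_mono wk) auto
      also have "\<dots> = a j * (1 + norm (k j)) ^ 2 * (2 * pi * W)\<^sup>2"
        by (simp only: power2_eq_square mult_ac)
      finally show ?thesis .
    qed
  qed (intro rapid_summable rapid_inner rapid_a summable_mult2 a_rapid)+
  have B0: "0 \<le> B" using B[of 0] by linarith
  define L where "L = 2 * pi * \<bar>l \<bullet> v\<bar>"
  have L: "0 < L" using nonresonant[OF l] by (simp add: L_def)
  have lw: "2 * pi * \<bar>l \<bullet> w n\<bar> \<le> 2 * pi * (norm l * W)" for n
    using order_trans[OF Cauchy_Schwarz_ineq2[of l "w n"] mult_left_mono[OF w_le norm_ge_zero]]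
    by simp
  define Q where "Q = B * (2 * pi * (norm l * W) + 2 * D1) + B'"
  have "\<forall>\<^sub>F n in sequentially. L * \<bar>J n\<bar> < e" if e: "0 < e" for e
  proof -
    \<comment> \<open>The summand 1 keeps \<open>D\<close> positive if \<open>B = 0\<close>.\<close>
    define D where "D = 4 * L * B + 1"
    have LB: "0 < D" using L B0 by (simp add: D_def add_nonneg_pos)
    define \<epsilon> where "\<epsilon> = e / (2 * D)"
    have \<epsilon>: "0 < \<epsilon>" using e LB by (simp add: \<epsilon>_def)
    have \<epsilon>e: "L * (2 * B * (2 * \<epsilon>)) < e / 2"
    proof -
      have "L * (2 * B * (2 * \<epsilon>)) = (4 * L * B) * \<epsilon>" by simp
      also have "\<dots> < D * \<epsilon>" using \<epsilon> by (simp add: D_def)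
      also have "\<dots> = e / 2" using LB by (simp add: \<epsilon>_def)
      finally show ?thesis .
    qed
    obtain \<zeta> where \<zeta>: "0 < \<zeta>" and ev: "\<forall>\<^sub>F n in sequentially. \<exists>E\<in>sets borel.
      measure cube_measure (E \<inter> cube3) \<le> \<epsilon> \<and> (\<forall>p\<in>cube3 - E. \<zeta> * M n \<le> \<bar>stretch (w n) (real n) p\<bar>)"
      using stretch_large[OF \<epsilon>] by blast
    define \<eta> where "\<eta> = \<zeta> * sqrt \<epsilon>"
    have \<eta>: "0 < \<eta>" using \<zeta> \<epsilon> by (simp add: \<eta>_def)
    have lim: "(\<lambda>n. Q / \<eta> * inverse (M n) + 2 * B * D2 / \<eta>\<^sup>2 * (real n / (M n)\<^sup>2)) \<longlonglongrightarrow> Q / \<eta> * 0 + 2 * B * D2 / \<eta>\<^sup>2 * 0"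
      by (intro tendsto_intros M_sq tendsto_inverse_0_at_top M_top)
    then have "\<forall>\<^sub>F n in sequentially. Q / \<eta> * inverse (M n) + 2 * B * D2 / \<eta>\<^sup>2 * (real n / (M n)\<^sup>2) < e / 2"
      using e by (intro order_tendstoD(2)[OF lim]) simp
    moreover have "\<forall>\<^sub>F n in sequentially. 0 < M n"
      using M_top by (simp add: filterlim_at_top_dense)
    ultimately show ?thesis using ev
    proof eventually_elim
      case (elim n)
      let ?K = "\<eta> * M n"
      have K: "0 < ?K" using elim \<eta> by simp
      obtain E where E: "E \<in> sets borel" "measure cube_measure (E \<inter> cube3) \<le> \<epsilon>"
        "\<And>p. p \<in> cube3 - E \<Longrightarrow> \<zeta> * M n \<le> \<bar>stretch (w n) (real n) p\<bar>" using elim by blast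
      have Z: "(\<integral>p. ?K\<^sup>2 / ((stretch (w n) (real n) p)\<^sup>2 + ?K\<^sup>2) \<partial>cube_measure) \<le> 2 * \<epsilon>"
        by (rule stretch_weight_integral_le[OF \<zeta> _ \<epsilon> E]) (use elim in \<open>simp_all add: \<eta>_def\<close>)
      let ?C1 = "\<Sum>j. \<bar>a j * (2 * pi * (k j \<bullet> w n))\<bar>"
      let ?C2 = "\<Sum>j. \<bar>a j * (2 * pi * (k j \<bullet> w n)) * (2 * pi * (k j \<bullet> w n))\<bar>"
      have "L * \<bar>J n\<bar> \<le> B * (2 * pi * \<bar>l \<bullet> w n\<bar> + 2 * ?C1) / ?K + B * (2 * real n * ?C2) / ?K\<^sup>2 + B' / ?K
          + L * (2 * B * (\<integral>p. ?K\<^sup>2 / ((stretch (w n) (real n) p)\<^sup>2 + ?K\<^sup>2) \<partial>cube_measure))"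
        unfolding L_def J_def
        by (rule correlation_bound[OF l(1) _ K b'(1) trig_poly_periodic[OF b] B borel_trig_poly[OF b'(2)] B']) simp
      also have "\<dots> \<le> B * (2 * pi * (norm l * W) + 2 * D1) / ?K + B * (2 * real n * D2) / ?K\<^sup>2 + B' / ?K
          + L * (2 * B * (2 * \<epsilon>))"
        by (intro add_mono divide_right_mono mult_left_mono order_refl lw C1 C2 Z) (use K B0 L in auto)
      also have "\<dots> = Q / \<eta> * inverse (M n) + 2 * B * D2 / \<eta>\<^sup>2 * (real n / (M n)\<^sup>2) + L * (2 * B * (2 * \<epsilon>))"
        by (simp add: Q_def divide_inverse power_mult_distrib power_inverse algebra_simps)
      also have "\<dots> < e / 2 + e / 2" using elim \<epsilon>e by (intro add_strict_mono) auto
      finally show ?case by simp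
    qed
  qed
  then have "(\<lambda>n. L * \<bar>J n\<bar>) \<longlonglongrightarrow> 0"
    by (intro tendstoI) (use L in \<open>auto simp: dist_real_def abs_mult\<close>)
  then have "(\<lambda>n. inverse L * (L * \<bar>J n\<bar>)) \<longlonglongrightarrow> inverse L * 0" by (intro tendsto_intros)
  then have "(\<lambda>n. \<bar>J n\<bar>) \<longlonglongrightarrow> 0" using L by (simp add: mult.assoc[symmetric])
  then show ?thesis unfolding J_def by (rule tendsto_rabs_zero_cancel)
qed

lemma correlation_trig_poly0:
  assumes "trig_poly0 g" and b: "trig_poly b"
  shows "(\<lambda>n. \<integral>p. g (Flow (real n) p) / \<rho> (Flow (real n) p) * b p \<partial>cube_measure) \<longlonglongrightarrow> 0"
  using assms(1)
proof induction
  case (cos l c d)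
  have eq: "(\<integral>p. c * cos (2 * pi * (l \<bullet> Flow (real n) p) + d) / \<rho> (Flow (real n) p) * b p \<partial>cube_measure)
      = c * (\<integral>p. cos (2 * pi * (l \<bullet> Flow (real n) p) + d) / \<rho> (Flow (real n) p) * b p \<partial>cube_measure)" for n
    unfolding integral_mult_right_zero[symmetric] by (intro Bochner_Integration.integral_cong) auto
  have "(\<lambda>n. c * (\<integral>p. cos (2 * pi * (l \<bullet> Flow (real n) p) + d) / \<rho> (Flow (real n) p) * b p \<partial>cube_measure)) \<longlonglongrightarrow> c * 0"
    by (intro tendsto_intros correlation_character[OF cos b])
  then show ?case by (simp only: eq mult_zero_right)
next
  case (add f g)
  obtain B where B: "\<And>p. \<bar>b p\<bar> \<le> B" using trig_poly_bounded[OF b] by blast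
  note [measurable] = borel_trig_poly[OF b]
  have int: "integrable cube_measure (\<lambda>p. f (Flow t p) / \<rho> (Flow t p) * b p)" if f: "trig_poly0 f" for f t
  proof -
    note [measurable] = borel_trig_poly[OF trig_poly0_imp_trig_poly[OF f]]
    obtain C where C: "\<And>p. \<bar>f p\<bar> \<le> C" using trig_poly_bounded[OF trig_poly0_imp_trig_poly[OF f]] by blast
    show ?thesis
    proof (rule cube_integrable_bounded[where C = "C / (1 / 2) * B"])
      fix p
      have "\<bar>f (Flow t p) / \<rho> (Flow t p)\<bar> \<le> C / (1 / 2)"
        unfolding abs_divide using C[of "Flow t p"] \<rho>_bounds(1)[of "Flow t p"] by (intro frac_le) auto
      then show "\<bar>f (Flow t p) / \<rho> (Flow t p) * b p\<bar> \<le> C / (1 / 2) * B"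
        unfolding abs_mult[of "f (Flow t p) / \<rho> (Flow t p)"] using B[of p] order_trans[OF abs_ge_zero C[of 0]]
        by (intro mult_mono) auto
    qed measurable
  qed
  have eq: "(\<integral>p. (f (Flow (real n) p) + g (Flow (real n) p)) / \<rho> (Flow (real n) p) * b p \<partial>cube_measure)
      = (\<integral>p. f (Flow (real n) p) / \<rho> (Flow (real n) p) * b p \<partial>cube_measure)
      + (\<integral>p. g (Flow (real n) p) / \<rho> (Flow (real n) p) * b p \<partial>cube_measure)" for n
    unfolding add_divide_distrib distrib_right
    by (rule Bochner_Integration.integral_add[OF int[OF add.hyps(1)] int[OF add.hyps(2)]])
  have "(\<lambda>n. (\<integral>p. f (Flow (real n) p) / \<rho> (Flow (real n) p) * b p \<partial>cube_measure)
      + (\<integral>p. g (Flow (real n) p) / \<rho> (Flow (real n) p) * b p \<partial>cube_measure)) \<longlonglongrightarrow> 0 + 0"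
    by (intro tendsto_add add.IH)
  then show ?case by (simp only: eq add_0_left)
qed

text \<open>The density is absorbed into the second observable, giving \<open>y\<close>. Replacing
  \<open>u\<close> minus its mean by \<open>h / \<rho>\<close> and \<open>y\<close> by a
  trigonometric polynomial then costs at most \<open>e / 4\<close> each, uniformly in time.\<close>

theorem mixing_torus_map: "mixing torus_map \<mu>"
proof (rule mixingI_continuous)
  show "prob_space \<mu>" by (rule prob_space_\<mu>)
  show "distr \<mu> \<mu> torus_map = \<mu>" by (rule invariant_\<mu>)
  fix u g :: "torus3 \<Rightarrow> real" assume u: "continuous_on UNIV u" and g: "continuous_on UNIV g"
  have [measurable]: "u \<in> borel_measurable borel" "g \<in> borel_measurable borel"
    using u g by (auto intro: borel_measurable_continuous_onI)
  have pow [measurable]: "(torus_map ^^ n) \<in> borel_measurable borel" for n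
    by (induction n) (auto simp: id_def intro: measurable_comp)
  define m where "m = (\<integral>z. u z \<partial>\<mu>)"
  define y where "y z = torus_density z * g z" for z
  have y: "continuous_on UNIV y"
    unfolding y_def by (intro continuous_intros g continuous_on_torus_density)
  have [measurable]: "y \<in> borel_measurable borel" using y by (rule borel_measurable_continuous_onI)
  obtain Bu where Bu: "0 < Bu" "\<And>z. \<bar>u z\<bar> \<le> Bu" using bounded_continuous_torus3[OF u] by blast
  obtain By where By: "0 < By" "\<And>z. \<bar>y z\<bar> \<le> By" using bounded_continuous_torus3[OF y] by blast
  have yp: "y (to_torus3 p) = \<rho> p * g (to_torus3 p)" for p by (simp add: y_def torus_density_to_torus3)
  let ?F = "\<lambda>n. Flow (real n)"
  have iy: "integrable cube_measure (\<lambda>p. y (to_torus3 p))"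
    by (rule cube_integrable_bounded[OF _ By(2)]) measurable
  have iuy: "integrable cube_measure (\<lambda>p. u (to_torus3 (?F n p)) * y (to_torus3 p))" for n
  proof (rule cube_integrable_bounded[where C = "Bu * By"])
    show "\<bar>u (to_torus3 (?F n p)) * y (to_torus3 p)\<bar> \<le> Bu * By" for p
      unfolding abs_mult using Bu By by (intro mult_mono) auto
  qed measurable
  have corr: "(\<integral>z. u ((torus_map ^^ n) z) * g z \<partial>\<mu>) = (\<integral>p. u (to_torus3 (?F n p)) * y (to_torus3 p) \<partial>cube_measure)" for n
    by (subst integral_\<mu>) (auto simp: torus_map_funpow yp mult_ac)
  have gy: "(\<integral>z. g z \<partial>\<mu>) = (\<integral>p. y (to_torus3 p) \<partial>cube_measure)"
    by (subst integral_\<mu>) (auto simp: yp)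
  have diff: "(\<integral>z. u ((torus_map ^^ n) z) * g z \<partial>\<mu>) - (\<integral>z. u z \<partial>\<mu>) * (\<integral>z. g z \<partial>\<mu>)
      = (\<integral>p. (u (to_torus3 (?F n p)) - m) * y (to_torus3 p) \<partial>cube_measure)" for n
  proof -
    have "(\<integral>p. (u (to_torus3 (?F n p)) - m) * y (to_torus3 p) \<partial>cube_measure)
        = (\<integral>p. u (to_torus3 (?F n p)) * y (to_torus3 p) - m * y (to_torus3 p) \<partial>cube_measure)"
      by (simp add: left_diff_distrib)
    also have "\<dots> = (\<integral>p. u (to_torus3 (?F n p)) * y (to_torus3 p) \<partial>cube_measure) - m * (\<integral>p. y (to_torus3 p) \<partial>cube_measure)"
      using iuy iy by simp
    finally show ?thesis by (simp add: corr gy m_def)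
  qed
  show "(\<lambda>n. \<integral>z. u ((torus_map ^^ n) z) * g z \<partial>\<mu>) \<longlonglongrightarrow> (\<integral>z. u z \<partial>\<mu>) * (\<integral>z. g z \<partial>\<mu>)"
  proof (rule LIMSEQ_I)
    fix e :: real assume e: "0 < e"
    obtain h where h: "trig_poly0 h" "\<And>p. \<bar>u (to_torus3 p) - m - h p / \<rho> p\<bar> \<le> e / (4 * By)"
      using trig_poly0_approximation[OF u, of "e / (4 * By)"] e By(1) by (auto simp: m_def)
    note [measurable] = borel_trig_poly[OF trig_poly0_imp_trig_poly[OF h(1)]]
    define C where "C = Bu + \<bar>m\<bar> + e / (4 * By)"
    have C: "0 < C" using Bu e By by (simp add: C_def add_pos_nonneg add_nonneg_pos)
    have hC: "\<bar>h p / \<rho> p\<bar> \<le> C" for p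
      using h(2)[of p] Bu(2)[of "to_torus3 p"] unfolding C_def by linarith
    obtain b where b: "trig_poly b" "\<And>p. \<bar>y (to_torus3 p) - b p\<bar> < e / (4 * C)"
      using trig_poly_dense[OF y, of "e / (4 * C)"] e C by auto
    note [measurable] = borel_trig_poly[OF b(1)]
    obtain Bb where Bb: "\<And>p. \<bar>b p\<bar> \<le> Bb" using trig_poly_bounded[OF b(1)] by blast
    obtain N where N: "\<And>n. n \<ge> N \<Longrightarrow> \<bar>\<integral>p. h (?F n p) / \<rho> (?F n p) * b p \<partial>cube_measure\<bar> < e / 4"
      using LIMSEQ_D[OF correlation_trig_poly0[OF h(1) b(1)], of "e / 4"] e by auto
    have "\<bar>(\<integral>p. (u (to_torus3 (?F n p)) - m) * y (to_torus3 p) \<partial>cube_measure)\<bar> < e" if "n \<ge> N" for n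
    proof -
      let ?q = "\<lambda>p. h (?F n p) / \<rho> (?F n p)"
      have ihb: "integrable cube_measure (\<lambda>p. ?q p * b p)"
      proof (rule cube_integrable_bounded[where C = "C * Bb"])
        show "\<bar>?q p * b p\<bar> \<le> C * Bb" for p
          unfolding abs_mult[of "?q p"] using C by (intro mult_mono hC Bb) auto
      qed measurable
      have iall: "integrable cube_measure (\<lambda>p. (u (to_torus3 (?F n p)) - m) * y (to_torus3 p))"
        using iuy[of n] iy by (simp add: left_diff_distrib)
      have "\<bar>(\<integral>p. (u (to_torus3 (?F n p)) - m) * y (to_torus3 p) \<partial>cube_measure) - (\<integral>p. ?q p * b p \<partial>cube_measure)\<bar>
          = \<bar>\<integral>p. (u (to_torus3 (?F n p)) - m) * y (to_torus3 p) - ?q p * b p \<partial>cube_measure\<bar>"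
        using ihb iall by simp
      also have "\<dots> \<le> (\<integral>p. e / 2 \<partial>cube_measure)"
      proof (rule order_trans[OF integral_abs_bound integral_mono])
        show "integrable cube_measure (\<lambda>p. \<bar>(u (to_torus3 (?F n p)) - m) * y (to_torus3 p) - ?q p * b p\<bar>)"
          by (intro integrable_abs Bochner_Integration.integrable_diff iall ihb)
        show "\<bar>(u (to_torus3 (?F n p)) - m) * y (to_torus3 p) - ?q p * b p\<bar> \<le> e / 2" for p
        proof -
          have "(u (to_torus3 (?F n p)) - m) * y (to_torus3 p) - ?q p * b p
              = (u (to_torus3 (?F n p)) - m - ?q p) * y (to_torus3 p) + ?q p * (y (to_torus3 p) - b p)"
            by (simp only: ring_distribs)
          moreover have "\<bar>(u (to_torus3 (?F n p)) - m - ?q p) * y (to_torus3 p)\<bar> \<le> e / (4 * By) * By"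
            unfolding abs_mult using h(2)[of "?F n p"] By e by (intro mult_mono) auto
          moreover have "\<bar>?q p * (y (to_torus3 p) - b p)\<bar> \<le> C * (e / (4 * C))"
            unfolding abs_mult[of "?q p"]
            by (rule mult_mono[OF hC less_imp_le[OF b(2)]]) (use C in auto)
          moreover have "e / (4 * By) * By = e / 4" "C * (e / (4 * C)) = e / 4" using By C by auto
          ultimately show ?thesis by linarith
        qed
      qed auto
      also have "\<dots> = e / 2" using cube.prob_space by simp
      finally show ?thesis using N[OF that] e by linarith
    qed
    then show "\<exists>N. \<forall>n\<ge>N. norm ((\<integral>z. u ((torus_map ^^ n) z) * g z \<partial>\<mu>) - (\<integral>z. u z \<partial>\<mu>) * (\<integral>z. g z \<partial>\<mu>)) < e"
      unfolding diff real_norm_def by blast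
  qed
qed (rule sets_\<mu> borel_torus_map)+

end

end

subsection \<open>A Liouville direction with alternating resonances\<close>

text \<open>The factor \<open>5\<close> keeps \<open>\<delta> n\<close>, about \<open>q n / q (n + 2)\<close>, negligible against \<open>2 ^ (-3 q (n + 1))\<close>, the
  inverse of the time at which the resonance \<open>n + 1\<close> takes over from \<open>n\<close>.\<close>

primrec q :: "nat \<Rightarrow> nat" where
  "q 0 = 4"
| "q (Suc n) = 2 ^ (5 * q n)"

lemma q_pow2: "\<exists>e. q n = 2 ^ e"
  by (cases n) (auto intro: exI[of _ 2])

lemma q_ge: "n + 4 \<le> q n"
proof (induction n)
  case (Suc n)
  have "Suc (q n) \<le> 2 ^ q n" by (simp add: Suc_leI)
  also have "\<dots> \<le> q (Suc n)" by simp
  finally show ?case using Suc by simp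
qed simp

lemma q_pos: "0 < q n" using q_ge[of n] by simp

text \<open>In order: for the geometric bound on the tails, for the rational independence of the
  frequencies, for the contribution of later terms to the stretch, and for the hitting
  times.\<close>

lemma q_growth: "2 * q n \<le> q (Suc n)" "q n * q n \<le> q (Suc n)" "7 * q n + n \<le> q (Suc n)"
  "4 * q n ^ 3 \<le> q (Suc n)"
proof -
  have le: "q n \<le> 2 ^ q n" by (simp add: less_imp_le)
  have "q n * q n \<le> 2 ^ q n * 2 ^ q n" using le by (intro mult_mono) auto
  also have "\<dots> = 2 ^ (2 * q n)" by (simp add: power_add[symmetric] mult_2)
  also have "\<dots> \<le> q (Suc n)" by simp
  finally show sq: "q n * q n \<le> q (Suc n)" .
  have "2 * q n \<le> q n * q n" using q_ge[of n] by simp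
  with sq show "2 * q n \<le> q (Suc n)" by linarith
  have p3: "q n ^ 3 \<le> (2 ^ q n) ^ 3" using le by (rule power_mono) simp
  have "4 * q n ^ 3 \<le> 2 ^ 2 * (2 ^ q n) ^ 3" using p3 by simp
  also have "\<dots> = 2 ^ (2 + 3 * q n)" by (simp add: power_add power_mult[symmetric] mult.commute)
  also have "\<dots> \<le> 2 ^ (5 * q n)" using q_ge[of n] by (intro power_increasing) auto
  finally show c: "4 * q n ^ 3 \<le> q (Suc n)" by simp
  have "4 * 4 \<le> q n * q n" using q_ge[of n] by (intro mult_mono) auto
  then have "(4 * 4) * q n \<le> (q n * q n) * q n" by (rule mult_right_mono) simp
  then have "16 * q n \<le> q n ^ 3" by (simp add: power3_eq_cube)
  with c q_ge[of n] show "7 * q n + n \<le> q (Suc n)" by linarith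
qed

declare q.simps(2) [simp del]

lemma q_mono: "i \<le> j \<Longrightarrow> q i \<le> q j"
proof (rule lift_Suc_mono_le[of q])
  show "q n \<le> q (Suc n)" for n using q_growth(1)[of n] by linarith
qed

text \<open>Among powers of two, being smaller means being a divisor.\<close>

lemma q_dvd: assumes "i \<le> j" shows "q i dvd q j"
proof -
  obtain e e' where e: "q i = 2 ^ e" "q j = 2 ^ e'" using q_pow2 by metis
  with q_mono[OF assms] have "e \<le> e'" by simp
  then show ?thesis unfolding e by (rule le_imp_power_dvd)
qed

lemma q_geometric: "2 ^ i * q n \<le> q (n + i)"
proof (induction i)
  case (Suc i)
  then show ?case using q_growth(1)[of "n + i"] by simp
qed simp

lemma inverse_q_le: "1 / real (q (n + i)) \<le> (1 / 2) ^ i * (1 / real (q n))"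
proof -
  have "real (2 ^ i * q n) \<le> real (q (n + i))" using q_geometric by (rule of_nat_mono)
  then have "2 ^ i * real (q n) \<le> real (q (n + i))" by simp
  then have "1 / real (q (n + i)) \<le> 1 / (2 ^ i * real (q n))"
    using q_pos by (intro divide_left_mono) auto
  then show ?thesis by (simp add: power_divide)
qed

lemma inverse_q_step_le: "1 / real (q (n + 2 * i)) \<le> (1 / 2) ^ i * (1 / real (q n))"
proof -
  have "(1 / 2 :: real) ^ (2 * i) \<le> (1 / 2) ^ i" by (intro power_decreasing) auto
  then have "(1 / 2) ^ (2 * i) * (1 / real (q n)) \<le> (1 / 2) ^ i * (1 / real (q n))"
    by (intro mult_right_mono) auto
  with inverse_q_le[of n "2 * i"] show ?thesis by linarith
qed

lemma summable_half: "summable (\<lambda>i. (1 / 2 :: real) ^ i * c)"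
  by (intro summable_mult2 summable_geometric) simp

lemma suminf_half: "(\<Sum>i. (1 / 2 :: real) ^ i * c) = 2 * c"
  using suminf_mult2[of "\<lambda>i. (1 / 2 :: real) ^ i" c] suminf_geometric[of "1 / 2 :: real"]
  by (simp add: summable_geometric)

lemma summable_inverse_q: "summable (\<lambda>i. 1 / real (q (n + 2 * i)))"
  by (rule summable_comparison_test'[OF summable_half[of "1 / real (q n)"], of 0])
     (use inverse_q_step_le[of n] in auto)

lemma suminf_inverse_q: "1 / real (q n) \<le> (\<Sum>i. 1 / real (q (n + 2 * i)))"
  "(\<Sum>i. 1 / real (q (n + 2 * i))) \<le> 2 / real (q n)"
proof -
  have "(\<Sum>i\<in>{0}. 1 / real (q (n + 2 * i))) \<le> (\<Sum>i. 1 / real (q (n + 2 * i)))"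
    by (rule sum_le_suminf[OF summable_inverse_q]) auto
  then show "1 / real (q n) \<le> (\<Sum>i. 1 / real (q (n + 2 * i)))" by simp
  have "(\<Sum>i. 1 / real (q (n + 2 * i))) \<le> (\<Sum>i. (1 / 2) ^ i * (1 / real (q n)))"
    by (rule suminf_le[OF inverse_q_step_le summable_inverse_q summable_half])
  then show "(\<Sum>i. 1 / real (q (n + 2 * i))) \<le> 2 / real (q n)" unfolding suminf_half by simp
qed

text \<open>\<open>freq 0\<close> and \<open>freq 1\<close> are the numbers \<alpha> and \<beta> of
  the overview; for larger \<open>b\<close> this is a tail of one of the two series.\<close>

definition freq :: "nat \<Rightarrow> real" where "freq b = (\<Sum>i. 1 / real (q (b + 2 * i)))"

text \<open>\<open>\<delta> n\<close> is the difference between \<open>q n * freq (n mod 2)\<close> and the integer \<open>num n\<close> below: the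
  terms of \<open>freq (n mod 2)\<close> with index up to \<open>n\<close> have denominators dividing \<open>q n\<close>.\<close>

definition \<delta> :: "nat \<Rightarrow> real" where "\<delta> n = real (q n) * freq (n + 2)"

lemma freq_bounds: "0 < freq b" "freq b \<le> 1 / 2"
proof -
  have "0 < 1 / real (q b)" using q_pos[of b] by simp
  then show "0 < freq b" unfolding freq_def using suminf_inverse_q(1)[of b] by (rule less_le_trans)
  have "2 / real (q b) \<le> 2 / 4" using q_ge[of b] by (intro divide_left_mono) auto
  then show "freq b \<le> 1 / 2" unfolding freq_def using suminf_inverse_q(2)[of b] by linarith
qed

lemma \<delta>_bounds: "real (q n) / real (q (n + 2)) \<le> \<delta> n" "\<delta> n \<le> 2 * real (q n) / real (q (n + 2))"
  unfolding \<delta>_def freq_def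
  using mult_left_mono[OF suminf_inverse_q(1)[of "n + 2"], of "real (q n)"]
    mult_left_mono[OF suminf_inverse_q(2)[of "n + 2"], of "real (q n)"]
  by (simp_all add: mult.commute)

lemma \<delta>_pos: "0 < \<delta> n"
  using freq_bounds(1) q_pos by (simp add: \<delta>_def)

lemma q_mult_freq: "real (q (2 * j + b)) * freq b - \<delta> (2 * j + b) \<in> \<int>"
proof -
  let ?n = "2 * j + b"
  have "freq b = (\<Sum>i. 1 / real (q (b + 2 * (i + Suc j)))) + (\<Sum>i<Suc j. 1 / real (q (b + 2 * i)))"
    unfolding freq_def by (rule suminf_split_initial_segment[OF summable_inverse_q])
  also have "(\<Sum>i. 1 / real (q (b + 2 * (i + Suc j)))) = freq (?n + 2)"
    unfolding freq_def by (intro suminf_cong) (simp add: algebra_simps)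
  finally have "real (q ?n) * freq b - \<delta> ?n = (\<Sum>i<Suc j. real (q ?n) / real (q (b + 2 * i)))"
    by (simp add: \<delta>_def distrib_left sum_distrib_left del: sum.lessThan_Suc)
  also have "\<dots> \<in> \<int>"
  proof (rule Ints_sum)
    fix i assume "i \<in> {..<Suc j}"
    then have "q (b + 2 * i) dvd q ?n" by (intro q_dvd) auto
    then have "real (q ?n) / real (q (b + 2 * i)) = real (q ?n div q (b + 2 * i))"
      by (simp add: real_of_nat_div)
    then show "real (q ?n) / real (q (b + 2 * i)) \<in> \<int>" by simp
  qed
  finally show ?thesis .
qed

section \<open>The direction, the resonant vectors and the amplitudes\<close>

definition idx :: "nat \<Rightarrow> 3" where "idx n = (if even n then 2 else 3)"

definition dir :: "real^3" where "dir = vector [1, freq 0, freq 1]"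

definition num :: "nat \<Rightarrow> real" where "num n = real (q n) * dir $ idx n - \<delta> n"

text \<open>The first coordinate of \<open>dir\<close> is 1, so subtracting \<open>num n\<close>
  there leaves \<open>res n \<bullet> dir = \<delta> n\<close>. Coordinates other than 1 and
  \<open>idx n\<close> vanish, so that the stretch in the direction of one axis does not see the
  terms of the other parity.\<close>

definition res :: "nat \<Rightarrow> real^3" where
  "res n = real (q n) *\<^sub>R axis (idx n) 1 - num n *\<^sub>R axis 1 1"

definition amp :: "nat \<Rightarrow> real" where "amp n = 1 / 2 ^ q n"

lemma dir_nth: "dir $ 1 = 1" "dir $ idx n = freq (n mod 2)"
  by (simp_all add: dir_def idx_def vector_3 odd_iff_mod_2_eq_one[symmetric] even_iff_mod_2_eq_zero)

lemma num_Ints: "num n \<in> \<int>"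
  using q_mult_freq[of "n div 2" "n mod 2"] by (simp add: num_def dir_nth)

lemma idx_neq_1: "idx n \<noteq> 1" by (simp add: idx_def)

lemma num_le: "\<bar>num n\<bar> \<le> real (q n)"
proof -
  have "real (q n) * freq (n mod 2) \<le> real (q n) * 1" "0 \<le> real (q n) * freq (n mod 2)"
    using freq_bounds[of "n mod 2"] by (intro mult_left_mono mult_nonneg_nonneg; simp)+
  moreover have "\<delta> n \<le> real (q n) * 1"
    unfolding \<delta>_def using freq_bounds[of "n + 2"] by (intro mult_left_mono) auto
  ultimately show ?thesis using \<delta>_pos[of n] unfolding num_def dir_nth by linarith
qed

lemma res_nth: "res n $ i = (if i = idx n then real (q n) else if i = 1 then - num n else 0)"
  using idx_neq_1[of n] by (auto simp: res_def axis_def)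

lemma res_inner_axis: "res n \<bullet> axis (idx m) 1 = (if idx n = idx m then real (q n) else 0)"
  using idx_neq_1[of m] by (simp add: inner_axis res_nth)

lemma inner_res: "res n \<bullet> x = real (q n) * x $ idx n - num n * x $ 1"
  by (simp add: res_def inner_diff_left inner_axis')

lemma res_inner_dir: "res n \<bullet> dir = \<delta> n"
  by (simp add: inner_res dir_nth(1)) (simp add: num_def)

lemma res_int: "res n \<in> int_vec"
  using num_Ints by (auto simp: int_vec_def res_nth)

lemma res_nz: "res n \<noteq> 0"
proof
  assume "res n = 0"
  then have "res n $ idx n = 0" by simp
  then show False using q_pos[of n] by (simp add: res_nth)
qed

lemma norm_res_le: "norm (res n) \<le> 2 * real (q n)"
proof -
  have "norm (res n) \<le> norm (real (q n) *\<^sub>R axis (idx n) (1::real)) + norm (num n *\<^sub>R axis 1 (1::real) :: real^3)"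
    unfolding res_def by (rule norm_triangle_ineq4)
  then show ?thesis using num_le[of n] by (simp add: norm_axis_1)
qed

lemma power_le_pow2: "\<forall>\<^sub>F x in sequentially. real x ^ m \<le> 2 ^ x"
proof -
  have "((\<lambda>x. x ^ m / exp x) \<longlongrightarrow> (0::real)) at_top" by (rule tendsto_power_div_exp_0)
  then have "\<forall>\<^sub>F x in at_top. x ^ m / exp x < (ln 2 :: real) ^ m"
    by (rule order_tendstoD) simp
  moreover have "filterlim (\<lambda>x. real x * ln 2) at_top sequentially"
    by (rule filterlim_at_top_mult_tendsto_pos[OF tendsto_const _ filterlim_real_sequentially]) simp
  ultimately have "\<forall>\<^sub>F x in sequentially. (real x * ln 2) ^ m / exp (real x * ln 2) < (ln 2 :: real) ^ m"
    by (rule eventually_compose_filterlim)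
  then show ?thesis
  proof eventually_elim
    case (elim x)
    have "exp (real x * ln 2) = (2::real) ^ x" by (simp add: exp_of_nat_mult)
    with elim have "(real x ^ m / 2 ^ x) * ln 2 ^ m < 1 * (ln 2 :: real) ^ m"
      by (simp add: power_mult_distrib)
    then have "real x ^ m / 2 ^ x < 1" by (rule mult_right_less_imp_less) simp
    then show ?case by simp
  qed
qed

lemma q_at_top: "filterlim q at_top sequentially"
proof (rule filterlim_at_top_mono[OF filterlim_ident])
  show "\<forall>\<^sub>F n in sequentially. n \<le> q n"
    using q_ge by (intro always_eventually allI) (metis add_leD1)
qed

lemma amp_rapid: "summable (\<lambda>n. amp n * (1 + norm (res n)) ^ m)"
proof -
  \<comment> \<open>Each factor \<open>1 + norm (res n)\<close> is at most \<open>3 * q n\<close>,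
    hence at most \<open>q n * q n\<close>; one more power of \<open>q n\<close> makes the terms
    summable.\<close>
  have ev: "\<forall>\<^sub>F n in sequentially. real (q n) ^ (2 * m + 1) \<le> 2 ^ q n"
    by (rule eventually_compose_filterlim[OF power_le_pow2 q_at_top])
  have "\<forall>\<^sub>F n in sequentially. norm (amp n * (1 + norm (res n)) ^ m) \<le> (1 / 2) ^ n * (1 / 4)"
    using ev
  proof eventually_elim
    case (elim n)
    have q4: "4 \<le> real (q n)" using q_ge[of n] by simp
    have "1 + norm (res n) \<le> 3 * real (q n)" using norm_res_le[of n] q4 by linarith
    also have "\<dots> \<le> real (q n) * real (q n)" using q4 by (intro mult_right_mono) auto
    finally have "(1 + norm (res n)) ^ m \<le> (real (q n) * real (q n)) ^ m"
      by (intro power_mono) auto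
    then have "(1 + norm (res n)) ^ m * real (q n) \<le> (real (q n) * real (q n)) ^ m * real (q n)"
      by (rule mult_right_mono) simp
    also have "\<dots> = real (q n) ^ (2 * m + 1)"
      by (simp add: power_mult_distrib power_add mult_2)
    also note elim
    finally have "(1 + norm (res n)) ^ m * real (q n) \<le> 2 ^ q n" .
    then have "amp n * (1 + norm (res n)) ^ m \<le> 1 / real (q n)"
      using q4 by (simp add: amp_def field_simps)
    also have "\<dots> \<le> (1 / 2) ^ n * (1 / 4)" using inverse_q_le[of 0 n] by simp
    finally show ?case by (simp add: amp_def)
  qed
  then show ?thesis by (rule summable_comparison_test_ev[OF _ summable_half])
qed

lemma amp_le: "amp n \<le> (1 / 2) ^ n * (1 / 16)"
proof -
  have "(2::real) ^ (n + 4) \<le> 2 ^ q n" using q_ge by (intro power_increasing) auto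
  then have "1 / (2::real) ^ q n \<le> 1 / 2 ^ (n + 4)" by (intro divide_left_mono) auto
  then show ?thesis by (simp add: amp_def power_add power_divide)
qed

lemma suminf_amp: "suminf amp \<le> 1 / 2"
proof -
  have s: "summable amp" using amp_rapid[of 0] by simp
  have "suminf amp \<le> (\<Sum>n. (1 / 2) ^ n * (1 / 16))"
    by (rule suminf_le[OF amp_le s summable_half])
  then show ?thesis unfolding suminf_half by simp
qed

text \<open>Multiplied by \<open>q n\<close>, the relation says that
  \<open>y * \<gamma> + z * \<delta> n\<close> is an integer; being smaller than 1 it is 0. But at
  this scale the error \<open>\<gamma>\<close> of \<open>freq c\<close> is of another order of
  magnitude than the error \<open>\<delta> n\<close> of the other frequency.\<close>

lemma freq_nonresonant:
  assumes "x \<in> \<int>" "y \<in> \<int>" "z \<in> \<int>" and y: "y \<noteq> 0" and c: "c < 2"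
    and eq: "x + y * freq c + z * freq (1 - c) = 0"
  shows False
proof -
  have "\<forall>\<^sub>F n in sequentially. 2 * \<bar>y\<bar> + 2 * \<bar>z\<bar> + 1 \<le> real n"
    using filterlim_real_sequentially by (simp add: filterlim_at_top)
  then obtain N where N: "\<And>n. n \<ge> N \<Longrightarrow> 2 * \<bar>y\<bar> + 2 * \<bar>z\<bar> + 1 \<le> real n"
    by (auto simp: eventually_sequentially)
  \<comment> \<open>\<open>n\<close> has the parity of \<open>1 - c\<close>, so that \<open>freq c\<close> is the worse approximated of the two at scale \<open>q n\<close>.\<close>
  define n' where "n' = 2 * N + c"
  define n where "n = Suc n'"
  define d where "d = 1 - c"
  obtain j where j: "n = 2 * j + d" using c by (cases c) (auto simp: n_def n'_def d_def intro: that[of "N"] that[of "Suc N"])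
  have big: "2 * \<bar>y\<bar> + 2 * \<bar>z\<bar> + 1 \<le> real (q n)"
  proof -
    have "2 * \<bar>y\<bar> + 2 * \<bar>z\<bar> + 1 \<le> real n" by (rule N) (simp add: n_def n'_def)
    also have "\<dots> \<le> real (q n)" using q_ge[of n] by simp
    finally show ?thesis .
  qed
  obtain r :: nat where r: "q n = q n' * r" using q_dvd[of n' n] by (auto simp: n_def dvd_def)
  \<comment> \<open>The last good approximation of \<open>freq c\<close> is at \<open>n'\<close>;
    \<open>\<gamma>\<close> is its error after multiplication by the larger \<open>q n\<close>
    instead of \<open>q n'\<close>.\<close>
  define \<gamma> where "\<gamma> = real r * \<delta> n'"
  have \<gamma>: "real (q n) / real (q (Suc n)) \<le> \<gamma>" "\<gamma> \<le> 2 * real (q n) / real (q (Suc n))"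
  proof -
    have "real (q n) = real r * real (q n')" unfolding r by simp
    moreover have "n' + 2 = Suc n" by (simp add: n_def)
    ultimately
    show "real (q n) / real (q (Suc n)) \<le> \<gamma>" "\<gamma> \<le> 2 * real (q n) / real (q (Suc n))"
      using mult_left_mono[OF \<delta>_bounds(1)[of n'], of "real r"] mult_left_mono[OF \<delta>_bounds(2)[of n'], of "real r"]
      by (simp_all add: \<gamma>_def mult_ac)
  qed
  have i1: "real (q n) * freq c - \<gamma> \<in> \<int>"
  proof -
    have "real r * (real (q n') * freq c - \<delta> n') \<in> \<int>"
      unfolding n'_def by (intro Ints_mult q_mult_freq) auto
    then show ?thesis by (simp add: \<gamma>_def r algebra_simps)
  qed
  have i2: "real (q n) * freq d - \<delta> n \<in> \<int>" unfolding j by (rule q_mult_freq)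
  have q1: "real (q n) * real (q n) \<le> real (q (Suc n))" "real (q (Suc n)) * real (q (Suc n)) \<le> real (q (n + 2))"
    using of_nat_mono[OF q_growth(2)[of n]] of_nat_mono[OF q_growth(2)[of "Suc n"]] by simp_all
  have qp: "0 < real (q n)" "0 < real (q (Suc n))" "0 < real (q (n + 2))" using q_pos by (auto simp only: of_nat_0_less_iff)
  have qmono: "real (q n) \<le> real (q (Suc n))" by (simp add: q_mono del: q.simps)
  have "q n * q n \<le> q (n + 2)" using le_trans[OF q_growth(2)[of n] q_mono[of "Suc n" "n + 2"]] by simp
  then have q2: "real (q n) * real (q n) \<le> real (q (n + 2))" by (metis of_nat_le_iff of_nat_mult)
  have gle: "\<gamma> \<le> 2 / real (q n)"
  proof -
    have "2 * real (q n) / real (q (Suc n)) \<le> 2 * real (q n) / (real (q n) * real (q n))"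
      using q1 qp by (intro divide_left_mono) auto
    with \<gamma>(2) qp show ?thesis by simp
  qed
  have dle: "\<delta> n \<le> 2 / real (q n)"
  proof -
    have "2 * real (q n) / real (q (n + 2)) \<le> 2 * real (q n) / (real (q n) * real (q n))"
      using q2 qp by (intro divide_left_mono) auto
    with \<delta>_bounds(2)[of n] qp show ?thesis by simp
  qed
  have g0: "0 < \<gamma>" using \<gamma>(1) qp by (meson divide_pos_pos less_le_trans)
  have "real (q n) * (x + y * freq c + z * freq d)
      = (real (q n) * x + y * (real (q n) * freq c - \<gamma>) + z * (real (q n) * freq d - \<delta> n)) + (y * \<gamma> + z * \<delta> n)"
    by (simp add: algebra_simps)
  then have "y * \<gamma> + z * \<delta> n = - (real (q n) * x + y * (real (q n) * freq c - \<gamma>) + z * (real (q n) * freq d - \<delta> n))"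
    using eq by (simp add: d_def)
  also have "\<dots> \<in> \<int>"
    by (intro Ints_minus Ints_add Ints_mult i1 i2 assms Ints_of_nat)
  finally have int: "y * \<gamma> + z * \<delta> n \<in> \<int>" .
  have "\<bar>y * \<gamma>\<bar> \<le> \<bar>y\<bar> * (2 / real (q n))" "\<bar>z * \<delta> n\<bar> \<le> \<bar>z\<bar> * (2 / real (q n))"
    unfolding abs_mult using gle dle g0 \<delta>_pos[of n] by (intro mult_left_mono; simp)+
  then have "\<bar>y * \<gamma> + z * \<delta> n\<bar> \<le> (2 * \<bar>y\<bar> + 2 * \<bar>z\<bar>) / real (q n)"
    using abs_triangle_ineq[of "y * \<gamma>" "z * \<delta> n"] by (simp add: add_divide_distrib mult.commute)
  also have "\<dots> < 1" using big qp by simp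
  finally have "y * \<gamma> + z * \<delta> n = 0" using int Ints_nonzero_abs_less1 by blast
  \<comment> \<open>The two errors would have to balance, yet \<open>\<gamma>\<close> exceeds
    \<open>\<delta> n\<close> by a factor of at least \<open>q (Suc n) / 2\<close>.\<close>
  then have e: "\<bar>y\<bar> * \<gamma> = \<bar>z\<bar> * \<delta> n"
    using g0 \<delta>_pos[of n] by (metis abs_minus_cancel abs_mult abs_of_pos add_eq_0_iff)
  have "1 \<le> \<bar>y\<bar>" using Ints_nonzero_abs_ge1[OF assms(2) y] .
  then have "1 * (real (q n) / real (q (Suc n))) \<le> \<bar>y\<bar> * \<gamma>"
    using \<gamma>(1) qp by (intro mult_mono) auto
  also have "\<dots> \<le> \<bar>z\<bar> * (2 * real (q n) / real (q (n + 2)))"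
    unfolding e by (intro mult_left_mono \<delta>_bounds) auto
  also have "\<dots> \<le> \<bar>z\<bar> * (2 * real (q n) / (real (q (Suc n)) * real (q (Suc n))))"
    using q1 qp by (intro mult_left_mono divide_left_mono) auto
  finally have "real (q (Suc n)) \<le> 2 * \<bar>z\<bar>" using qp by (simp add: field_simps)
  with big qmono show False by linarith
qed

lemma inner_dir: "l \<bullet> dir = l $ 1 + l $ 2 * freq 0 + l $ 3 * freq 1"
  by (simp add: dir_def inner_vec_def sum_3 vector_3)

lemma dir_nonresonant:
  assumes "l \<in> int_vec" "l \<noteq> 0"
  shows "l \<bullet> dir \<noteq> 0"
proof
  assume "l \<bullet> dir = 0"
  then have eq: "l $ 1 + l $ 2 * freq 0 + l $ 3 * freq 1 = 0" by (simp add: inner_dir)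
  have int: "l $ i \<in> \<int>" for i using assms(1) by (simp add: int_vec_def)
  have "l $ 2 = 0" using freq_nonresonant[OF int[of 1] int[of 2] int[of 3], of 0] eq by auto
  moreover have "l $ 3 = 0" using freq_nonresonant[OF int[of 1] int[of 3] int[of 2], of 1] eq by auto
  ultimately have "l = 0" using eq by (simp add: vec_eq_iff forall_3)
  with assms(2) show False by simp
qed

section \<open>Lower bounds for the stretch of the Liouville flow\<close>

interpretation liouville: time_changed_flow dir res amp
proof
  show "0 \<le> amp n" for n by (simp add: amp_def)
qed (rule res_int res_nz dir_nonresonant amp_rapid suminf_amp; assumption?)+

text \<open>Mean value theorem: within distance \<open>x\<close> of \<open>b\<close> the sine has
  changed by at most \<open>x\<close>.\<close>

lemma abs_cos_diff_ge:
  fixes b x :: real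
  assumes "0 < x"
  shows "x * (\<bar>sin b\<bar> - x) \<le> \<bar>cos (b + x) - cos b\<bar>"
proof -
  obtain z where z: "b < z" "z < b + x" "cos (b + x) - cos b = (b + x - b) * (- sin z)"
    using MVT2[of b "b + x" cos "\<lambda>z. - sin z"] assms by (auto intro!: derivative_eq_intros)
  have "\<bar>sin b\<bar> - x \<le> \<bar>sin z\<bar>" using abs_sin_diff_le[of z b] z by linarith
  then have "x * (\<bar>sin b\<bar> - x) \<le> x * \<bar>sin z\<bar>" using assms by (intro mult_left_mono) auto
  then show ?thesis using z(3) assms by (simp add: abs_mult)
qed

lemma liouville_\<omega>: "liouville.\<omega> n = 2 * pi * \<delta> n"
  by (simp add: liouville.\<omega>_def res_inner_dir)

lemma q_two_steps: "real (q (n + 2)) = 2 ^ (5 * q (Suc n))"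
  by (simp add: q.simps(2))

text \<open>Bounds what the terms after \<open>j\<close> add to the stretch per unit of time; the
  \<open>j\<close>-th adds about \<open>q j / 2 ^ q j\<close>. With
  \<open>q i = 2 ^ (5 * q y)\<close>, the 7 in \<open>q_growth(3)\<close> is this 5 plus the 2 in
  \<open>2 ^ (2 * q j)\<close>.\<close>

lemma amp_q_small:
  assumes "j < i"
  shows "amp i * real (q i) \<le> (1 / 2) ^ i * (2 / 2 ^ (2 * q j))"
proof -
  obtain y where y: "i = Suc y" using assms by (cases i) auto
  have jy: "q j \<le> q y" using assms y by (intro q_mono) auto
  have "(2::real) ^ (5 * q y) * 2 ^ (2 * q j + y) \<le> 2 ^ (5 * q y) * 2 ^ (2 * q y + y)"
    using jy by (intro mult_left_mono power_increasing) auto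
  also have "\<dots> = 2 ^ (7 * q y + y)" by (simp add: power_add[symmetric])
  also have "\<dots> \<le> 2 ^ q i" using q_growth(3)[of y] unfolding y by (intro power_increasing) auto
  finally have "(2::real) ^ (5 * q y) * 2 ^ (2 * q j + y) \<le> 2 ^ q i" .
  moreover have "real (q i) = 2 ^ (5 * q y)" by (simp add: y q.simps(2))
  ultimately have "real (q i) * (2 ^ (2 * q j) * 2 ^ y) \<le> 2 ^ q i" by (simp add: power_add)
  then have "amp i * real (q i) \<le> 1 / (2 ^ (2 * q j) * 2 ^ y)"
    by (simp add: amp_def field_simps)
  also have "\<dots> = (1 / 2) ^ i * (2 / 2 ^ (2 * q j))"
    by (simp add: y power_divide)
  finally show ?thesis .
qed

lemma power_three_times: "(2::real) ^ (3 * m) = 2 ^ m * 2 ^ m * 2 ^ m"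
  by (simp add: power_add[symmetric])

text \<open>In this direction only the terms with the parity of \<open>j\<close> count. Earlier ones
  have saturated, later ones have tiny amplitudes, and the \<open>j\<close>-th has hardly rotated,
  so that its sine quotient is nearly \<open>s\<close> times the sine at the starting point, up to
  sign.\<close>

lemma stretch_lower_bound:
  assumes t: "2 ^ (3 * q j) \<le> t" "t \<le> 2 ^ (3 * q (Suc j))" and \<sigma>: "0 \<le> \<sigma>" "\<sigma> \<le> \<bar>sin (2 * pi * (res j \<bullet> p))\<bar>"
  shows "amp j * real (q j) * t * (4 * \<sigma> - 400 / 2 ^ q j) \<le> \<bar>liouville.stretch (axis (idx j) 1) t p\<bar>"
proof -
  define s where "s = liouville.S t p"
  have t0: "0 < t" using t(1) by (rule less_le_trans[rotated]) simp
  have s: "2 / 3 * t \<le> s" "s \<le> 2 * t" "0 < s"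
    using liouville.S_bounds[of t p] t0 by (auto simp: s_def)
  define c where "c i = amp i * (2 * pi * (res i \<bullet> axis (idx j) 1))" for i
  define D where "D i = (sin (liouville.phase i (p, s) + pi / 2) - sin (liouville.phase i (p, 0) + pi / 2)) / liouville.\<omega> i" for i
  have st: "liouville.stretch (axis (idx j) 1) t p = (\<Sum>i. c i * D i)"
    by (simp add: liouville.stretch_def liouville.H_def c_def D_def s_def)
  have sm: "summable (\<lambda>i. c i * D i)"
    using liouville.summable_H[OF liouville.rapid_inner[OF liouville.rapid_a], of "axis (idx j) 1" "(p, s)" "pi / 2"]
    by (simp add: c_def D_def)
  have D_le: "\<bar>D i\<bar> \<le> s" "\<bar>D i\<bar> \<le> 1 / (pi * \<delta> i)" for i
  proof -
    show "\<bar>D i\<bar> \<le> s" unfolding D_def using liouville.sin_quotient_le[of i p s "pi / 2" 0] s by simp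
    have "\<bar>sin (liouville.phase i (p, s) + pi / 2) - sin (liouville.phase i (p, 0) + pi / 2)\<bar> \<le> 2"
      using abs_sin_le_one[of "liouville.phase i (p, s) + pi / 2"]
        abs_sin_le_one[of "liouville.phase i (p, 0) + pi / 2"] by linarith
    then have "\<bar>D i\<bar> \<le> 2 / \<bar>liouville.\<omega> i\<bar>"
      unfolding D_def abs_divide by (rule divide_right_mono) simp
    then show "\<bar>D i\<bar> \<le> 1 / (pi * \<delta> i)" using \<delta>_pos[of i] by (simp add: liouville_\<omega> abs_mult)
  qed
  \<comment> \<open>A common bound for the other terms, up to \<open>(1 / 2) ^ i\<close>: the first
    summand serves the terms before \<open>j\<close>, the second those after it.\<close>
  define E where "E = real (q j) / 8 + 8 * pi * t / 2 ^ (2 * q j)"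
  have qj: "0 < real (q j)" using q_pos by simp
  have E0: "0 \<le> E" using t0 qj by (simp add: E_def)
  have rest: "\<bar>c i * D i\<bar> \<le> (1 / 2) ^ i * E" if "i \<noteq> j" for i
  proof (cases "idx i = idx j")
    case False
    then show ?thesis using E0 by (simp add: c_def res_inner_axis)
  next
    case True
    then have c: "c i = amp i * (2 * pi * real (q i))" by (simp add: c_def res_inner_axis)
    have amp0: "0 < amp i" by (simp add: amp_def)
    have qi: "0 < real (q i)" using q_pos by simp
    show ?thesis
    proof (cases "i < j")
      case True
      with \<open>idx i = idx j\<close> have "i + 2 \<le> j"
        by (cases "j = Suc i") (auto simp: idx_def split: if_splits)
      then have qle: "real (q (i + 2)) \<le> real (q j)" by (simp add: q_mono)
      \<comment> \<open>Saturation: the quotient never exceeds \<open>1 / (pi * \<delta> i)\<close>,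
        and \<open>q i / \<delta> i\<close> is at most \<open>q (i + 2)\<close>, hence at most
        \<open>q j\<close>.\<close>
      have "\<bar>c i * D i\<bar> \<le> amp i * (2 * pi * real (q i)) * (1 / (pi * \<delta> i))"
        using D_le(2)[of i] amp0 qi by (simp only: abs_mult c) (intro mult_mono, auto)
      also have "\<dots> = amp i * (2 * real (q i) / \<delta> i)" by simp
      also have "\<dots> \<le> amp i * (2 * real (q j))"
      proof (intro mult_left_mono)
        have "real (q i) / real (q (i + 2)) * real (q (i + 2)) \<le> \<delta> i * real (q j)"
          using \<delta>_bounds(1)[of i] qle \<delta>_pos[of i] by (intro mult_mono) auto
        then have "real (q i) \<le> \<delta> i * real (q j)" using q_pos[of "i + 2"] by simp
        then show "2 * real (q i) / \<delta> i \<le> 2 * real (q j)" using \<delta>_pos[of i] by (simp add: field_simps)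
      qed (use amp0 in simp)
      also have "\<dots> \<le> ((1 / 2) ^ i * (1 / 16)) * (2 * real (q j))"
        by (intro mult_right_mono amp_le) simp
      also have "\<dots> = (1 / 2) ^ i * (real (q j) / 8)" by simp
      also have "\<dots> \<le> (1 / 2) ^ i * E" using t0 by (intro mult_left_mono) (auto simp: E_def)
      finally show ?thesis .
    next
      case False
      with that have "j < i" by simp
      have "\<bar>c i * D i\<bar> \<le> amp i * (2 * pi * real (q i)) * (2 * t)"
        using D_le(1)[of i] s(2) amp0 qi by (simp only: abs_mult c) (intro mult_mono, auto)
      also have "\<dots> = (amp i * real (q i)) * (4 * pi * t)" by simp
      also have "\<dots> \<le> ((1 / 2) ^ i * (2 / 2 ^ (2 * q j))) * (4 * pi * t)"
        using t0 by (intro mult_right_mono amp_q_small \<open>j < i\<close>) auto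
      also have "\<dots> = (1 / 2) ^ i * (8 * pi * t / 2 ^ (2 * q j))" by simp
      also have "\<dots> \<le> (1 / 2) ^ i * E" using qj by (intro mult_left_mono) (auto simp: E_def)
      finally show ?thesis .
    qed
  qed
  define e where "e i = (if i = j then 0 else c i * D i)" for i
  have sums_j: "(\<lambda>i. if i = j then c j * D j else 0) sums (c j * D j)"
    using sums_single[of j "\<lambda>i. c i * D i"] by (simp cong: if_cong)
  have e_le: "norm (e i) \<le> (1 / 2) ^ i * E" for i using rest[of i] E0 by (simp add: e_def)
  have sum_e: "summable (\<lambda>i. norm (e i))"
    by (rule summable_comparison_test'[OF summable_half[of E], of 0]) (use e_le in auto)
  have "(\<Sum>i. c i * D i) = (\<Sum>i. (if i = j then c j * D j else 0) + e i)"
    by (intro suminf_cong) (simp add: e_def)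
  also have "\<dots> = c j * D j + suminf e"
    using sums_j summable_norm_cancel[OF sum_e] by (simp add: suminf_add[symmetric] sums_iff)
  finally have split: "(\<Sum>i. c i * D i) = c j * D j + suminf e" .
  have "\<bar>suminf e\<bar> \<le> (\<Sum>i. norm (e i))" using summable_norm[OF sum_e] by simp
  also have "\<dots> \<le> (\<Sum>i. (1 / 2) ^ i * E)" by (rule suminf_le[OF e_le sum_e summable_half])
  finally have se: "\<bar>suminf e\<bar> \<le> 2 * E" by (simp only: suminf_half)
  define M where "M = amp j * real (q j) * t"
  have amp0: "0 < amp j" by (simp add: amp_def)
  have M0: "0 < M" using amp0 qj t0 by (simp add: M_def)
  have cj: "c j = 2 * pi * (amp j * real (q j))" by (simp add: c_def res_inner_axis)
  have pow: "(1::real) \<le> 2 ^ q j" "real (q j) \<le> 2 ^ q j" "1 \<le> real (q j)"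
    using q_pos[of j] by (auto simp: less_imp_le Suc_leI)
  let ?x = "liouville.\<omega> j * s"
  have x0: "0 < ?x" using \<delta>_pos[of j] s by (simp add: liouville_\<omega>)
  \<comment> \<open>\<open>?x\<close> is the angle by which the \<open>j\<close>-th term turns. The
    exponents 5 in \<open>\<delta> j\<close> and 3 in the bound on \<open>t\<close> leave
    \<open>2 ^ (2 * q (Suc j))\<close> in the denominator.\<close>
  have x_le: "?x \<le> 8 * pi / 2 ^ q j"
  proof -
    have "?x \<le> 2 * pi * (2 * real (q j) / real (q (j + 2))) * (2 * 2 ^ (3 * q (Suc j)))"
      unfolding liouville_\<omega> using s t \<delta>_bounds(2)[of j] \<delta>_pos[of j]
      by (intro mult_mono mult_left_mono) auto
    also have "\<dots> = 8 * pi * (real (q j) / 2 ^ (2 * q (Suc j)))"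
    proof -
      have "(2::real) ^ (5 * q (Suc j)) = 2 ^ (3 * q (Suc j)) * 2 ^ (2 * q (Suc j))"
        by (simp add: power_add[symmetric])
      then show ?thesis unfolding q_two_steps by simp
    qed
    also have "\<dots> \<le> 8 * pi * (1 / 2 ^ q j)"
    proof (intro mult_left_mono)
      have "real (q j) * 2 ^ q j \<le> 2 ^ q j * 2 ^ q j" using pow by (intro mult_right_mono) auto
      also have "\<dots> = 2 ^ (2 * q j)" by (simp add: power_add[symmetric] mult_2)
      also have "\<dots> \<le> 2 ^ (2 * q (Suc j))" by (intro power_increasing) (auto simp: q_mono)
      finally show "real (q j) / 2 ^ (2 * q (Suc j)) \<le> 1 / 2 ^ q j" by (simp add: field_simps)
    qed simp
    finally show ?thesis by simp
  qed
  have "s * (\<sigma> - ?x) \<le> \<bar>D j\<bar>"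
  proof -
    let ?b = "2 * pi * (res j \<bullet> p)"
    have ph: "liouville.phase j (p, s) = ?b + ?x" "liouville.phase j (p, 0) = ?b"
      by (simp_all add: liouville.phase_def)
    have "?x * (\<sigma> - ?x) \<le> ?x * (\<bar>sin ?b\<bar> - ?x)" using x0 \<sigma> by (intro mult_left_mono) auto
    also have "\<dots> \<le> \<bar>cos (?b + ?x) - cos ?b\<bar>" by (rule abs_cos_diff_ge[OF x0])
    also have "\<dots> = liouville.\<omega> j * \<bar>D j\<bar>"
      using \<delta>_pos[of j]
      by (simp add: D_def ph sin_shift_pi_half[of _ 0, simplified] liouville_\<omega> abs_mult)
    finally have "liouville.\<omega> j * (s * (\<sigma> - ?x)) \<le> liouville.\<omega> j * \<bar>D j\<bar>" by (simp add: mult_ac)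
    then show ?thesis using \<delta>_pos[of j] by (simp add: liouville_\<omega>)
  qed
  moreover have "2 / 3 * t * \<sigma> - 2 * t * (8 * pi / 2 ^ q j) \<le> s * (\<sigma> - ?x)"
  proof -
    have "2 / 3 * t * \<sigma> \<le> s * \<sigma>" using s \<sigma> by (intro mult_right_mono) auto
    moreover have "s * ?x \<le> 2 * t * (8 * pi / 2 ^ q j)" using s x0 x_le t0 by (intro mult_mono) auto
    ultimately show ?thesis by (simp add: right_diff_distrib)
  qed
  ultimately have Dj: "2 / 3 * t * \<sigma> - 2 * t * (8 * pi / 2 ^ q j) \<le> \<bar>D j\<bar>" by linarith
  \<comment> \<open>Hence \<open>4 * pi / 3\<close> is at least 4 and \<open>32 * (pi * pi)\<close>
    at most 328; \<open>2 * E\<close> costs at most another 72, which makes 400.\<close>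
  have pi: "3 \<le> pi" "pi \<le> 3.2" using pi_approx by simp_all
  have "\<bar>c j * D j\<bar> = 2 * pi * (amp j * real (q j)) * \<bar>D j\<bar>"
    using amp0 by (simp add: cj abs_mult)
  moreover have "2 * pi * (amp j * real (q j)) * (2 / 3 * t * \<sigma> - 2 * t * (8 * pi / 2 ^ q j))
      \<le> 2 * pi * (amp j * real (q j)) * \<bar>D j\<bar>"
    using amp0 Dj by (intro mult_left_mono) auto
  moreover have "2 * pi * (amp j * real (q j)) * (2 / 3 * t * \<sigma> - 2 * t * (8 * pi / 2 ^ q j))
      = M * (4 * pi / 3 * \<sigma> - 32 * (pi * pi) / 2 ^ q j)"
    by (simp add: M_def field_simps)
  moreover have "M * (4 * \<sigma> - 328 / 2 ^ q j) \<le> M * (4 * pi / 3 * \<sigma> - 32 * (pi * pi) / 2 ^ q j)"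
  proof (intro mult_left_mono diff_mono divide_right_mono)
    show "4 * \<sigma> \<le> 4 * pi / 3 * \<sigma>" using pi \<sigma> by (intro mult_right_mono) auto
    have "pi * pi \<le> 3.2 * 3.2" using pi by (intro mult_mono) auto
    then show "32 * (pi * pi) \<le> 328" by simp
  qed (use M0 in auto)
  moreover have "2 * E \<le> M * (72 / 2 ^ q j)"
  proof -
    have "real (q j) / 8 * 2 \<le> M * (1 / 2 ^ q j)"
    proof -
      have "(2::real) ^ q j * 2 ^ q j * 1 \<le> 2 ^ q j * 2 ^ q j * 2 ^ q j"
        using pow(1) by (intro mult_left_mono) auto
      also have "\<dots> \<le> t" using t(1) by (simp only: power_three_times)
      finally have "2 ^ q j * 2 ^ q j \<le> t" by simp
      then have "real (q j) * (2 ^ q j * 2 ^ q j) \<le> real (q j) * t" using qj by (intro mult_left_mono) auto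
      then have "real (q j) \<le> M * (1 / 2 ^ q j)"
        by (simp add: M_def amp_def field_simps)
      then show ?thesis using qj by linarith
    qed
    moreover have "8 * pi * t / 2 ^ (2 * q j) * 2 \<le> M * (52 / 2 ^ q j)"
    proof -
      have "16 * pi * 1 \<le> 52 * real (q j)" using pi pow by (intro mult_mono) auto
      then have "16 * pi * t \<le> 52 * real (q j) * t" using t0 by (intro mult_right_mono) auto
      then have "16 * pi * t / (2 ^ q j * 2 ^ q j) \<le> 52 * real (q j) * t / (2 ^ q j * 2 ^ q j)"
        by (rule divide_right_mono) simp
      moreover have "(2::real) ^ (2 * q j) = 2 ^ q j * 2 ^ q j" by (simp add: power_add[symmetric] mult_2)
      ultimately show ?thesis by (simp only: M_def amp_def) (simp add: mult_ac)
    qed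
    moreover have "M * (1 / 2 ^ q j) + M * (52 / 2 ^ q j) \<le> M * (72 / 2 ^ q j)"
      unfolding distrib_left[symmetric] add_divide_distrib[symmetric]
      using M0 by (intro mult_left_mono divide_right_mono) auto
    ultimately have "real (q j) / 8 * 2 + 8 * pi * t / 2 ^ (2 * q j) * 2 \<le> M * (72 / 2 ^ q j)"
      by (meson add_mono order_trans)
    then show ?thesis unfolding E_def mult.commute[of 2 "_ + _"] by (simp only: distrib_right)
  qed
  moreover have "M * (4 * \<sigma> - 328 / 2 ^ q j) - M * (72 / 2 ^ q j) = M * (4 * \<sigma> - 400 / 2 ^ q j)"
    by (simp add: algebra_simps)
  ultimately have "M * (4 * \<sigma> - 400 / 2 ^ q j) \<le> \<bar>c j * D j\<bar> - 2 * E" by linarith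
  also have "\<dots> \<le> \<bar>c j * D j + suminf e\<bar>" using se by linarith
  finally show ?thesis unfolding st split M_def .
qed

text \<open>At time \<open>n \<ge> 2 ^ 12\<close>, the resonance \<open>win n\<close> dominates the stretching.\<close>

definition win :: "nat \<Rightarrow> nat" where
  "win n = (LEAST j. n < 2 ^ (3 * q (Suc j)))"

lemma win_upper: "n < 2 ^ (3 * q (Suc (win n)))"
  unfolding win_def
proof (rule LeastI)
  have "n < 2 ^ n" by simp
  also have "\<dots> \<le> 2 ^ (3 * q (Suc n))" using q_ge[of "Suc n"] by (intro power_increasing) auto
  finally show "n < 2 ^ (3 * q (Suc n))" .
qed

text \<open>The exponent 12 is \<open>3 * q 0\<close>, the start of the first window.\<close>

lemma win_lower: assumes "2 ^ 12 \<le> n" shows "2 ^ (3 * q (win n)) \<le> n"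
proof (cases "win n")
  case 0
  then show ?thesis using assms by simp
next
  case (Suc j)
  then have "\<not> n < 2 ^ (3 * q (Suc j))" unfolding win_def by (intro not_less_Least) simp
  with Suc show ?thesis by simp
qed

lemma win_at_top: "filterlim win at_top sequentially"
  unfolding filterlim_at_top
proof
  fix J
  show "\<forall>\<^sub>F n in sequentially. J \<le> win n"
    using eventually_ge_at_top[of "2 ^ (3 * q J)"]
  proof eventually_elim
    case (elim n)
    show ?case
    proof (rule ccontr)
      assume "\<not> J \<le> win n"
      then have "(2::nat) ^ (3 * q (Suc (win n))) \<le> 2 ^ (3 * q J)"
        by (intro power_increasing mult_left_mono q_mono) auto
      with elim win_upper[of n] show False by linarith
    qed
  qed
qed

text \<open>The factor in \<open>stretch_lower_bound\<close> at time \<open>n\<close>, for the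
  resonance in charge.\<close>

definition rate :: "nat \<Rightarrow> real" where
  "rate n = amp (win n) * real (q (win n)) * real n"

text \<open>With \<open>q\<close> taken at \<open>win n\<close>, the quotient
  \<open>n / (rate n)\<^sup>2\<close> equals \<open>2 ^ (2 * q) / (q\<^sup>2 * n)\<close>; the
  exponent 3 at the start of the window beats this 2.\<close>

lemma rate_ge:
  assumes "2 ^ 12 \<le> n"
  shows "real (win n) \<le> rate n" "real n / (rate n)\<^sup>2 \<le> 1 / real (q (win n))"
proof -
  let ?q = "q (win n)"
  have q: "1 \<le> real ?q" using q_ge[of "win n"] by simp
  have "real (2 ^ (3 * ?q)) \<le> real n" using win_lower[OF assms] by (rule of_nat_mono)
  then have n: "2 ^ ?q * 2 ^ ?q * 2 ^ ?q \<le> real n" by (simp add: power_three_times)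
  have one: "(1::real) \<le> 2 ^ ?q * 2 ^ ?q" by (simp add: power_add[symmetric])
  have "1 * 2 ^ ?q \<le> 2 ^ ?q * 2 ^ ?q * (2 ^ ?q :: real)" by (rule mult_right_mono[OF one]) simp
  also note n
  finally have n1: "2 ^ ?q \<le> real n" by simp
  then have n0: "0 < real n" by (rule less_le_trans[rotated]) simp
  have "real ?q * 2 ^ ?q \<le> real ?q * real n" using n1 by (intro mult_left_mono) auto
  then have "real ?q \<le> rate n" by (simp add: rate_def amp_def field_simps)
  then show "real (win n) \<le> rate n" using q_ge[of "win n"] by linarith
  have "real n / (rate n)\<^sup>2 = (2 ^ ?q * 2 ^ ?q) / (real ?q * real ?q * real n)"
    using n0 by (simp add: rate_def amp_def power2_eq_square field_simps)
  also have "\<dots> \<le> 1 / real ?q"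
  proof -
    have "real ?q * (2 ^ ?q * 2 ^ ?q) \<le> real ?q * (real ?q * real n)"
    proof (intro mult_left_mono)
      have "2 ^ ?q * 2 ^ ?q * 1 \<le> 2 ^ ?q * 2 ^ ?q * (2 ^ ?q :: real)" by (intro mult_left_mono) auto
      also have "\<dots> \<le> 1 * real n" using n by simp
      also have "\<dots> \<le> real ?q * real n" using q by (intro mult_right_mono) auto
      finally show "2 ^ ?q * 2 ^ ?q \<le> real ?q * real n" by simp
    qed simp
    then show ?thesis using q n0 by (simp add: field_simps)
  qed
  finally show "real n / (rate n)\<^sup>2 \<le> 1 / real ?q" .
qed

lemma inverse_q_tendsto: "(\<lambda>n. 1 / real (q n)) \<longlonglongrightarrow> 0"
proof -
  have "filterlim (\<lambda>n. real (q n)) at_top sequentially"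
    by (rule filterlim_compose[OF filterlim_real_sequentially q_at_top])
  from tendsto_inverse_0_at_top[OF this] show ?thesis by (simp add: divide_inverse)
qed

text \<open>Modulo 1, \<open>y\<close> reduces to a number of size at most \<open>1 / 2\<close>, and
  the sine increases on the first quarter period.\<close>

lemma abs_sin_ge:
  assumes "0 \<le> \<epsilon>" "\<epsilon> \<le> dist_int y"
  shows "sin (pi * \<epsilon>) \<le> \<bar>sin (pi * y)\<bar>"
proof -
  let ?m = "round y" and ?r = "y - of_int (round y)"
  have r: "\<epsilon> \<le> \<bar>?r\<bar>" "\<bar>?r\<bar> \<le> 1 / 2"
    using assms of_int_round_abs_le[of y] by (auto simp: dist_int_def abs_minus_commute)
  have "\<bar>sin (pi * y)\<bar> = \<bar>sin (pi * ?r + pi * of_int ?m)\<bar>" by (simp add: algebra_simps)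
  also have "\<dots> = \<bar>sin (pi * ?r)\<bar>"
  proof -
    have s: "sin (pi * of_int ?m) = 0" by (simp add: sin_times_pi_eq_0 mult.commute[of pi])
    then have "\<bar>cos (pi * of_int ?m)\<bar> = 1" using sin_zero_abs_cos_one by blast
    with s show ?thesis by (simp only: sin_add) (simp add: abs_mult)
  qed
  also have "\<dots> = sin (pi * \<bar>?r\<bar>)"
  proof -
    have "\<bar>sin (pi * ?r)\<bar> = \<bar>sin (pi * \<bar>?r\<bar>)\<bar>"
      by (cases "0 \<le> ?r") (simp_all only: abs_of_nonneg abs_of_neg not_le mult_minus_right sin_minus abs_minus_cancel)
    moreover have "pi * \<bar>?r\<bar> \<le> pi * 1" using r by (intro mult_left_mono) auto
    then have "0 \<le> sin (pi * \<bar>?r\<bar>)" by (intro sin_ge_zero) auto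
    ultimately show ?thesis by linarith
  qed
  also have "\<dots> \<ge> sin (pi * \<epsilon>)"
    using r assms by (intro sin_monotone_2pi_le) (auto intro: order_trans[of _ 0])
  finally show ?thesis .
qed

theorem mixing_liouville: "mixing liouville.torus_map liouville.\<mu>"
proof (rule liouville.mixing_torus_map[where w = "\<lambda>n. axis (idx (win n)) 1" and W = 1 and M = rate])
  show "norm (axis (idx (win n)) (1::real)) \<le> 1" for n by (simp add: norm_axis_1)
  have big: "\<forall>\<^sub>F n in sequentially. 2 ^ 12 \<le> (n::nat)" by (rule eventually_ge_at_top)
  have "filterlim (\<lambda>n. real (win n)) at_top sequentially"
    by (rule filterlim_compose[OF filterlim_real_sequentially win_at_top])
  then show "filterlim rate at_top sequentially"
    by (rule filterlim_at_top_mono) (rule eventually_mono[OF big rate_ge(1)])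
  have "(\<lambda>n. 1 / real (q (win n))) \<longlonglongrightarrow> 0"
    by (rule filterlim_compose[OF inverse_q_tendsto win_at_top])
  then show "(\<lambda>n. real n / (rate n)\<^sup>2) \<longlonglongrightarrow> 0"
    by (rule Lim_null_comparison[rotated]) (rule eventually_mono[OF big], use rate_ge(2) in auto)
  fix \<epsilon> :: real assume "0 < \<epsilon>"
  \<comment> \<open>The 6 compensates the factor in \<open>measure_strip_le\<close>; the bound
    \<open>1 / 4\<close> keeps \<open>pi * \<epsilon>'\<close> where the sine is positive.\<close>
  define \<epsilon>' where "\<epsilon>' = min (\<epsilon> / 6) (1 / 4)"
  have \<epsilon>': "0 < \<epsilon>'" "\<epsilon>' \<le> 1 / 4" "6 * \<epsilon>' \<le> \<epsilon>" using \<open>0 < \<epsilon>\<close> by (auto simp: \<epsilon>'_def)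
  define \<sigma> where "\<sigma> = sin (pi * \<epsilon>')"
  have \<sigma>: "0 < \<sigma>" unfolding \<sigma>_def using \<epsilon>' by (intro sin_gt_zero) auto
  show "\<exists>\<zeta>>0. \<forall>\<^sub>F n in sequentially. \<exists>E\<in>sets borel. measure cube_measure (E \<inter> cube3) \<le> \<epsilon> \<and>
      (\<forall>p\<in>cube3 - E. \<zeta> * rate n \<le> \<bar>liouville.stretch (axis (idx (win n)) 1) (real n) p\<bar>)"
  proof (intro exI conjI)
    \<comment> \<open>Then \<open>4 * \<sigma> - 400 / 2 ^ q m\<close> is at least
      \<open>\<sigma>\<close>.\<close>
    have "\<forall>\<^sub>F m in sequentially. 1 / real (q m) < 3 * \<sigma> / 400"
      using inverse_q_tendsto \<sigma> by (intro order_tendstoD) auto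
    then have "\<forall>\<^sub>F n in sequentially. 1 / real (q (win n)) < 3 * \<sigma> / 400"
      by (rule eventually_compose_filterlim[OF _ win_at_top])
    then show "\<forall>\<^sub>F n in sequentially. \<exists>E\<in>sets borel. measure cube_measure (E \<inter> cube3) \<le> \<epsilon> \<and>
      (\<forall>p\<in>cube3 - E. \<sigma> * rate n \<le> \<bar>liouville.stretch (axis (idx (win n)) 1) (real n) p\<bar>)"
      using big
    proof eventually_elim
      case (elim n)
      let ?j = "win n"
      \<comment> \<open>\<open>sin (2 * pi * y)\<close> vanishes at the half-integers too, so the
        strips are taken for the doubled vector.\<close>
      let ?k = "2 *\<^sub>R res ?j"
      have k: "?k \<in> int_vec" "?k \<noteq> 0"
        using res_int[of ?j] res_nz[of ?j] by (auto simp: int_vec_def)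
      define E where "E = {p. dist_int (?k \<bullet> p - 0) \<le> \<epsilon>'}"
      have E: "E \<in> sets borel"
      proof -
        have "E = {p \<in> space borel. dist_int (?k \<bullet> p - 0) \<le> \<epsilon>'}" by (simp add: E_def)
        also have "\<dots> \<in> sets borel" by measurable
        finally show ?thesis .
      qed
      have "measure cube_measure (E \<inter> cube3) \<le> 6 * \<epsilon>'"
        using measure_strip_le[OF k \<epsilon>'(1), of 0] by (simp add: E_def Int_def conj_commute)
      then have mE: "measure cube_measure (E \<inter> cube3) \<le> \<epsilon>" using \<epsilon>'(3) by linarith
      have small: "400 / 2 ^ q ?j \<le> 3 * \<sigma>"
      proof -
        have "real (q ?j) \<le> 2 ^ q ?j" by (simp add: less_imp_le)
        then have "1 / 2 ^ q ?j \<le> 1 / real (q ?j)" using q_pos[of ?j] by (intro divide_left_mono) auto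
        with elim show ?thesis by simp
      qed
      have "real (2 ^ (3 * q ?j)) \<le> real n" using elim by (intro of_nat_mono win_lower) simp
      then have t1: "2 ^ (3 * q ?j) \<le> real n" by simp
      have "real n \<le> real (2 ^ (3 * q (Suc ?j)))" using win_upper[of n] by (intro of_nat_mono) simp
      then have t2: "real n \<le> 2 ^ (3 * q (Suc ?j))" by simp
      have "\<sigma> * rate n \<le> \<bar>liouville.stretch (axis (idx ?j) 1) (real n) p\<bar>" if "p \<in> cube3 - E" for p
      proof -
        have "\<epsilon>' \<le> dist_int (2 * (res ?j \<bullet> p))" using that by (simp add: E_def)
        then have "\<sigma> \<le> \<bar>sin (pi * (2 * (res ?j \<bullet> p)))\<bar>"
          unfolding \<sigma>_def using \<epsilon>' by (intro abs_sin_ge) auto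
        then have "\<sigma> \<le> \<bar>sin (2 * pi * (res ?j \<bullet> p))\<bar>" by (simp add: mult_ac)
        from stretch_lower_bound[OF t1 t2 less_imp_le[OF \<sigma>] this]
        have "rate n * (4 * \<sigma> - 400 / 2 ^ q ?j) \<le> \<bar>liouville.stretch (axis (idx ?j) 1) (real n) p\<bar>"
          by (simp add: rate_def)
        moreover have "rate n * \<sigma> \<le> rate n * (4 * \<sigma> - 400 / 2 ^ q ?j)"
          using small by (intro mult_left_mono) (auto simp: rate_def amp_def)
        ultimately show ?thesis by (simp add: mult.commute)
      qed
      with E mE show ?case by blast
    qed
  qed (rule \<sigma>)
qed

subsection \<open>Hitting times\<close>

lemma dist_int_mult_Ints:
  assumes "z \<in> \<int>"
  shows "dist_int (z * x) \<le> \<bar>z\<bar> * dist_int x"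
proof -
  obtain m where m: "z = of_int m" using assms by (rule Ints_cases)
  have "dist_int (z * x) \<le> \<bar>z * x - of_int (m * round x)\<bar>" by (rule dist_int_le)
  also have "\<dots> = \<bar>z * (x - of_int (round x))\<bar>" by (simp add: m algebra_simps)
  finally show ?thesis by (simp add: dist_int_def abs_mult)
qed

text \<open>The two nonzero coordinates of \<open>res m\<close> are integers of size at most
  \<open>q m\<close>, and each multiplies the error \<open>r\<close> by at most that. The
  displacement along \<open>dir\<close>, at most \<open>2 * n\<close>, contributes the term with
  \<open>\<delta> m\<close>.\<close>

lemma dist_int_of_hit:
  assumes "(liouville.torus_map ^^ n) (to_torus3 p) \<in> ball (to_torus3 p0) r"
  shows "dist_int (res m \<bullet> p - res m \<bullet> p0) \<le> 2 * real (q m) * r + 2 * real n * \<delta> m"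
proof -
  define s where "s = liouville.S (real n) p"
  define y where "y = liouville.Flow (real n) p"
  have s: "0 \<le> s" "s \<le> 2 * real n"
    using liouville.S_nonneg[of "real n" p] liouville.S_bounds(2)[of "real n" p] by (auto simp: s_def)
  have y: "y = p + s *\<^sub>R dir" by (simp add: y_def s_def liouville.Flow_def)
  have "dist (to_torus3 y) (to_torus3 p0) < r"
    using assms by (simp add: liouville.torus_map_funpow y_def dist_commute)
  then have d: "dist_int (y $ i - p0 $ i) \<le> r" for i
    using dist_int_le_dist_torus3[of y i p0] by linarith
  have r0: "0 \<le> r" using d[of 1] dist_int_nonneg[of "y $ 1 - p0 $ 1"] by linarith
  have "res m \<bullet> p - res m \<bullet> p0
      = real (q m) * (y $ idx m - p0 $ idx m) + (- num m) * (y $ 1 - p0 $ 1) + - (s * \<delta> m)"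
  proof -
    have "res m \<bullet> y - res m \<bullet> p0 = real (q m) * (y $ idx m - p0 $ idx m) + (- num m) * (y $ 1 - p0 $ 1)"
      by (simp add: inner_res algebra_simps)
    moreover have "res m \<bullet> y = res m \<bullet> p + s * \<delta> m"
      by (simp add: y inner_add_right res_inner_dir)
    ultimately show ?thesis by simp
  qed
  then have "dist_int (res m \<bullet> p - res m \<bullet> p0) \<le> dist_int (real (q m) * (y $ idx m - p0 $ idx m))
      + dist_int ((- num m) * (y $ 1 - p0 $ 1)) + dist_int (- (s * \<delta> m))"
    by (metis dist_int_triangle add_right_mono order_trans)
  also have "\<dots> \<le> real (q m) * r + real (q m) * r + 2 * real n * \<delta> m"
  proof (intro add_mono)
    have "dist_int (real (q m) * (y $ idx m - p0 $ idx m)) \<le> \<bar>real (q m)\<bar> * dist_int (y $ idx m - p0 $ idx m)"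
      by (rule dist_int_mult_Ints) simp
    also have "\<dots> \<le> real (q m) * r" using d by (simp add: mult_left_mono)
    finally show "dist_int (real (q m) * (y $ idx m - p0 $ idx m)) \<le> real (q m) * r" .
    have "dist_int ((- num m) * (y $ 1 - p0 $ 1)) \<le> \<bar>- num m\<bar> * dist_int (y $ 1 - p0 $ 1)"
      by (rule dist_int_mult_Ints) (simp add: num_Ints)
    also have "\<dots> \<le> real (q m) * r"
      using num_le[of m] d[of 1] by (intro mult_mono) (auto simp: dist_int_nonneg)
    finally show "dist_int ((- num m) * (y $ 1 - p0 $ 1)) \<le> real (q m) * r" .
    have "dist_int (- (s * \<delta> m)) \<le> s * \<delta> m"
      using dist_int_le_abs[of "- (s * \<delta> m)"] s(1) \<delta>_pos[of m] by (simp add: abs_mult)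
    also have "\<dots> \<le> 2 * real n * \<delta> m" using s(2) \<delta>_pos[of m] by (intro mult_right_mono) auto
    finally show "dist_int (- (s * \<delta> m)) \<le> 2 * real n * \<delta> m" .
  qed
  finally show ?thesis by (simp add: mult_ac)
qed

text \<open>Borel-Cantelli, with strips of Lebesgue measure at most
  \<open>18 / (q m)\<^sup>2\<close> and a density of at most \<open>3 / 2\<close>. Of the numerator
  3, a hit at radius at most \<open>1 / q m ^ 3\<close> uses up 2, which leaves 1 to be covered by
  the elapsed time.\<close>

lemma AE_eventually_far:
  "AE z in liouville.\<mu>. \<forall>\<^sub>F m in sequentially. 3 / (real (q m))\<^sup>2 < dist_int (res m \<bullet> rep_torus3 z - c m)"
proof -
  interpret prob_space liouville.\<mu> by (rule liouville.prob_space_\<mu>)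
  define g where "g m z = dist_int (res m \<bullet> rep_torus3 z - c m)" for m z
  have per: "periodic (\<lambda>p. dist_int (res m \<bullet> p - c m))" for m
    unfolding periodic_def
  proof (intro allI ballI)
    fix x l assume "l \<in> int_vec"
    then have "dist_int (res m \<bullet> x - c m + res m \<bullet> l) = dist_int (res m \<bullet> x - c m)"
      by (intro dist_int_add_Ints int_vec_inner res_int)
    then show "dist_int (res m \<bullet> (x + l) - c m) = dist_int (res m \<bullet> x - c m)"
      by (simp add: inner_add_right algebra_simps)
  qed
  have g: "g m (to_torus3 p) = dist_int (res m \<bullet> p - c m)" for m p
    unfolding g_def by (rule periodic_rep[OF per])
  have "continuous_on UNIV (g m)" for m
  proof (rule continuous_on_torus3I)
    show "continuous_on UNIV (\<lambda>p. g m (to_torus3 p))"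
      unfolding g
      by (rule continuous_on_compose2[OF continuous_on_dist_int]) (auto intro!: continuous_intros)
  qed
  then have [measurable]: "g m \<in> borel_measurable borel" for m
    by (rule borel_measurable_continuous_onI)
  define E where "E m = {z. g m z \<le> 3 / (real (q m))\<^sup>2}" for m
  have E [measurable]: "E m \<in> sets borel" for m
  proof -
    have "E m = {z \<in> space borel. g m z \<le> 3 / (real (q m))\<^sup>2}" by (simp add: E_def)
    also have "\<dots> \<in> sets borel" by measurable
    finally show ?thesis .
  qed
  have measE: "measure liouville.\<mu> (E m) \<le> (1 / 2) ^ m * 27" for m
  proof -
    let ?S = "{p \<in> cube3. dist_int (res m \<bullet> p - c m) \<le> 3 / (real (q m))\<^sup>2}"
    have q4: "4 \<le> real (q m)" using q_ge[of m] by simp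
    have S: "?S \<in> sets cube_measure"
    proof -
      have "?S = {p \<in> space cube_measure. dist_int (res m \<bullet> p - c m) \<le> 3 / (real (q m))\<^sup>2}" by simp
      also have "\<dots> \<in> sets cube_measure"
        by (rule borel_measurable_le) (auto intro!: borel_measurable_cube_measure)
      finally show ?thesis .
    qed
    have "measure liouville.\<mu> (E m) = (\<integral>z. indicator (E m) z \<partial>liouville.\<mu>)" by simp
    also have "\<dots> = (\<integral>p. liouville.\<rho> p * indicator (E m) (to_torus3 p) \<partial>cube_measure)"
      by (rule liouville.integral_\<mu>) simp
    also have "\<dots> \<le> (\<integral>p. 3 / 2 * (indicator ?S p :: real) \<partial>cube_measure)"
    proof (rule integral_mono)
      show "integrable cube_measure (\<lambda>p. liouville.\<rho> p * indicator (E m) (to_torus3 p))"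
        by (rule cube_integrable_bounded[where C = "3 / 2"])
          (use liouville.\<rho>_bounds liouville.\<rho>_pos in \<open>auto simp: indicator_def abs_of_pos\<close>)
      show "integrable cube_measure (\<lambda>p. 3 / 2 * (indicator ?S p :: real))"
        using S by (intro integrable_mult_right integrable_real_indicator) (auto simp: cube.emeasure_eq_measure)
      show "liouville.\<rho> p * indicator (E m) (to_torus3 p) \<le> 3 / 2 * indicator ?S p" if "p \<in> space cube_measure" for p
        using that liouville.\<rho>_bounds(2)[of p] by (auto simp: indicator_def E_def g)
    qed
    also have "\<dots> = 3 / 2 * measure cube_measure ?S"
      using sets.sets_into_space[OF S] by (simp add: Int_absorb2)
    also have "\<dots> \<le> 3 / 2 * (6 * (3 / (real (q m))\<^sup>2))"
      using q4 by (intro mult_left_mono measure_strip_le res_int res_nz) auto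
    also have "\<dots> \<le> 27 * (1 / real (q m))"
      using q4 by (simp add: field_simps power2_eq_square)
    also have "\<dots> \<le> 27 * ((1 / 2) ^ m * (1 / 4))"
      using inverse_q_le[of 0 m] by (intro mult_left_mono) auto
    also have "\<dots> \<le> (1 / 2) ^ m * 27" by simp
    finally show ?thesis .
  qed
  have "summable (\<lambda>m. measure liouville.\<mu> (E m))"
    by (rule summable_comparison_test'[OF summable_half[of 27], of 0]) (use measE in auto)
  then have "AE z in liouville.\<mu>. \<forall>\<^sub>F m in sequentially. z \<in> space liouville.\<mu> - E m"
    by (intro borel_cantelli_AE1) (auto simp: emeasure_eq_measure)
  then show ?thesis
  proof eventually_elim
    case (elim z)
    then show ?case by eventually_elim (simp add: E_def g_def)
  qed
qed

text \<open>Stated for every visit, so that it applies to the first one without using that it is the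
  first.\<close>

lemma hitting_time_superpolynomial:
  assumes far: "\<forall>\<^sub>F m in sequentially. 3 / (real (q m))\<^sup>2 < dist_int (res m \<bullet> p - res m \<bullet> p0)"
  shows "\<forall>\<^sub>F r in at_right 0. \<forall>n. (liouville.torus_map ^^ n) (to_torus3 p) \<in> ball (to_torus3 p0) r \<longrightarrow>
    (1 / r) ^ N \<le> real n"
proof -
  have "\<forall>\<^sub>F x in sequentially. real x ^ (3 * N) \<le> 2 ^ x" by (rule power_le_pow2)
  then have "\<forall>\<^sub>F m in sequentially. real (q (Suc m)) ^ (3 * N) \<le> 2 ^ q (Suc m)"
    by (rule eventually_compose_filterlim[OF _ filterlim_compose[OF q_at_top filterlim_Suc]])
  with far have "\<forall>\<^sub>F m in sequentially. 3 / (real (q m))\<^sup>2 < dist_int (res m \<bullet> p - res m \<bullet> p0) \<and>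
      real (q (Suc m)) ^ (3 * N) \<le> 2 ^ q (Suc m)"
    by (rule eventually_conj)
  then obtain m1 where m1: "\<And>m. m1 \<le> m \<Longrightarrow> 3 / (real (q m))\<^sup>2 < dist_int (res m \<bullet> p - res m \<bullet> p0)"
    "\<And>m. m1 \<le> m \<Longrightarrow> real (q (Suc m)) ^ (3 * N) \<le> 2 ^ q (Suc m)"
    by (auto simp: eventually_sequentially)
  show ?thesis
    unfolding eventually_at_right_field
  proof (intro exI conjI allI impI)
    show "0 < 1 / (real (q m1)) ^ 3" using q_pos[of m1] by simp
    fix r n
    assume r: "0 < r" "r < 1 / (real (q m1)) ^ 3"
      and hit: "(liouville.torus_map ^^ n) (to_torus3 p) \<in> ball (to_torus3 p0) r"
    define P where "P m \<longleftrightarrow> 1 / (real (q m)) ^ 3 < r" for m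
    have "(\<lambda>m. (1 / real (q m)) ^ 3) \<longlonglongrightarrow> 0 ^ 3" by (intro tendsto_power inverse_q_tendsto)
    then have "\<forall>\<^sub>F m in sequentially. (1 / real (q m)) ^ 3 < r"
      using r(1) by (intro order_tendstoD(2)[where y = "0 ^ 3"]) auto
    then obtain m' where m': "P m'" by (auto simp: eventually_sequentially P_def power_divide)
    \<comment> \<open>The first scale below \<open>r\<close>. At its predecessor \<open>m\<close>
      the radius is small enough for \<open>dist_int_of_hit\<close> to be effective, while
      \<open>1 / r\<close> is still bounded by \<open>q (Suc m) ^ 3\<close>.\<close>
    define l where "l = (LEAST m. P m)"
    have l: "P l" unfolding l_def using m' by (rule LeastI[of P])
    have "m1 < l"
    proof (rule ccontr)
      assume "\<not> m1 < l"
      then have "real (q l) ^ 3 \<le> real (q m1) ^ 3" by (intro power_mono) (auto simp: q_mono)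
      then have "1 / real (q m1) ^ 3 \<le> 1 / real (q l) ^ 3"
        using q_pos by (intro divide_left_mono) auto
      with l r(2) show False unfolding P_def by linarith
    qed
    then obtain m where m: "l = Suc m" by (cases l) auto
    have "\<not> P m" using m unfolding l_def by (intro not_less_Least) simp
    then have rm: "r \<le> 1 / real (q m) ^ 3" by (simp add: P_def)
    have mm: "m1 \<le> m" using \<open>m1 < l\<close> m by simp
    have q0: "0 < real (q m)" "0 < real (q (Suc m))" using q_pos by auto
    have "3 / (real (q m))\<^sup>2 < 2 * real (q m) * r + 2 * real n * \<delta> m"
      using m1(1)[OF mm] dist_int_of_hit[OF hit, of m] by linarith
    also have "2 * real (q m) * r \<le> 2 * real (q m) * (1 / real (q m) ^ 3)"
      using rm by (intro mult_left_mono) auto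
    also have "2 * real (q m) * (1 / real (q m) ^ 3) = 2 / (real (q m))\<^sup>2"
      using q0 by (simp add: power2_eq_square power3_eq_cube)
    finally have "1 / (real (q m))\<^sup>2 < 2 * real n * \<delta> m" by (simp add: diff_divide_distrib[symmetric])
    also have "\<dots> \<le> 2 * real n * (2 * real (q m) / 2 ^ (5 * q (Suc m)))"
      using \<delta>_bounds(2)[of m] unfolding q_two_steps by (intro mult_left_mono) auto
    finally have "2 ^ (5 * q (Suc m)) < real n * (4 * real (q m) ^ 3)"
      using q0 by (simp add: field_simps power2_eq_square power3_eq_cube)
    also have "\<dots> \<le> real n * 2 ^ q (Suc m)"
    proof (intro mult_left_mono)
      have "4 * real (q m) ^ 3 = real (4 * q m ^ 3)" by simp
      also have "\<dots> \<le> real (q (Suc m))" by (intro of_nat_mono q_growth)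
      also have "\<dots> \<le> 2 ^ q (Suc m)" by (simp add: less_imp_le)
      finally show "4 * real (q m) ^ 3 \<le> 2 ^ q (Suc m)" .
    qed simp
    finally have "2 ^ (5 * q (Suc m)) < real n * 2 ^ q (Suc m)" .
    moreover have "(2::real) ^ q (Suc m) * 2 ^ q (Suc m) \<le> 2 ^ (5 * q (Suc m))"
      unfolding power_add[symmetric] by (intro power_increasing) auto
    ultimately have "2 ^ q (Suc m) * 2 ^ q (Suc m) < real n * 2 ^ q (Suc m)" by linarith
    \<comment> \<open>The time is exponential in \<open>q (Suc m)\<close>, whereas
      \<open>(1 / r) ^ N\<close> is polynomial in it.\<close>
    then have n: "2 ^ q (Suc m) < real n" by (rule mult_right_less_imp_less) simp
    have "1 / r \<le> real (q (Suc m)) ^ 3"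
      using l r(1) q0 unfolding P_def m by (simp add: field_simps)
    then have "(1 / r) ^ N \<le> (real (q (Suc m)) ^ 3) ^ N"
      using r(1) by (intro power_mono) auto
    also have "\<dots> = real (q (Suc m)) ^ (3 * N)" by (simp add: power_mult)
    also have "\<dots> \<le> 2 ^ q (Suc m)" by (rule m1(2)[OF mm])
    finally show "(1 / r) ^ N \<le> real n" using n by linarith
  qed
qed

lemma lower_hitting_exponent_infinite:
  assumes far: "\<forall>\<^sub>F m in sequentially. 3 / (real (q m))\<^sup>2 < dist_int (res m \<bullet> p - res m \<bullet> p0)"
  shows "lower_hitting_exponent liouville.torus_map (to_torus3 p) (to_torus3 p0) = \<infinity>"
proof (cases "\<forall>r>0. hits liouville.torus_map r (to_torus3 p) (to_torus3 p0)")
  \<comment> \<open>If some ball is never visited, the exponent is infinite by convention.\<close>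
  case False
  then show ?thesis unfolding lower_hitting_exponent_def by (simp only: if_False)
next
  case True
  let ?\<tau> = "\<lambda>r. hitting_time liouville.torus_map r (to_torus3 p) (to_torus3 p0)"
  let ?f = "\<lambda>r. ereal (ln (real (?\<tau> r)) / (- ln r))"
  have "Liminf (at_right 0) ?f = \<infinity>"
  proof (rule ereal_top)
    fix C :: real
    obtain N :: nat where N: "C \<le> real N" using real_arch_simple by blast
    have "\<forall>\<^sub>F r in at_right 0. r < (1::real)"
      unfolding eventually_at_right_field by (intro exI[of _ 1]) auto
    moreover have "\<forall>\<^sub>F r in at_right 0. 0 < (r::real)"
      unfolding eventually_at_right_field by (intro exI[of _ 1]) auto
    ultimately have "\<forall>\<^sub>F r in at_right 0. ereal C \<le> ?f r"
      using hitting_time_superpolynomial[OF far, of N]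
    proof eventually_elim
      case (elim r)
      obtain n where "1 \<le> n \<and> (liouville.torus_map ^^ n) (to_torus3 p) \<in> ball (to_torus3 p0) r"
        using True elim(2) unfolding hits_def by blast
      then have "1 \<le> ?\<tau> r \<and> (liouville.torus_map ^^ ?\<tau> r) (to_torus3 p) \<in> ball (to_torus3 p0) r"
        unfolding hitting_time_def by (rule LeastI)
      then have \<tau>: "1 \<le> ?\<tau> r" "(1 / r) ^ N \<le> real (?\<tau> r)" using elim(3) by auto
      have "ln ((1 / r) ^ N) \<le> ln (real (?\<tau> r))"
        using \<tau> elim by (subst ln_le_cancel_iff) auto
      then have "real N * (- ln r) \<le> ln (real (?\<tau> r))"
        using elim by (simp add: ln_realpow ln_div)
      moreover have "0 < - ln r" using elim by simp
      ultimately have "real N \<le> ln (real (?\<tau> r)) / (- ln r)" by (simp only: pos_le_divide_eq)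
      with N show ?case by simp
    qed
    then show "ereal C \<le> Liminf (at_right 0) ?f" by (rule Liminf_bounded)
  qed
  with True show ?thesis unfolding lower_hitting_exponent_def by simp
qed

theorem theoremB:
  shows "\<exists>(T :: torus3 \<Rightarrow> torus3) (\<mu> :: torus3 measure).
    smooth_torus3_map T \<and>
    prob_space \<mu> \<and>
    invariant_measure T \<mu> \<and>
    (\<exists>\<rho> :: torus3 \<Rightarrow> real. continuous_on UNIV \<rho> \<and> (\<forall>x. 0 < \<rho> x) \<and>
        \<mu> = density torus3_lborel (\<lambda>x. ennreal (\<rho> x))) \<and>
    mixing T \<mu> \<and>
    (\<forall>x0. AE x in \<mu>. lower_hitting_exponent T x x0 = \<infinity>)"
proof (intro exI conjI allI)
  show "smooth_torus3_map liouville.torus_map" by (rule liouville.smooth_torus_map)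
  show "prob_space liouville.\<mu>" by (rule liouville.prob_space_\<mu>)
  show "invariant_measure liouville.torus_map liouville.\<mu>"
    unfolding invariant_measure_def
    using liouville.invariant_\<mu> measurable_cong_sets[OF liouville.sets_\<mu> liouville.sets_\<mu>] liouville.borel_torus_map
    by simp
  show "continuous_on UNIV liouville.torus_density" by (rule liouville.continuous_on_torus_density)
  show "0 < liouville.torus_density x" for x by (rule liouville.torus_density_pos)
  show "liouville.\<mu> = density torus3_lborel (\<lambda>x. ennreal (liouville.torus_density x))"
    by (rule liouville.\<mu>_def)
  show "mixing liouville.torus_map liouville.\<mu>" by (rule mixing_liouville)
  show "AE x in liouville.\<mu>. lower_hitting_exponent liouville.torus_map x x0 = \<infinity>" for x0
    \<comment> \<open>The strips are centred at the target, so the exceptional null set depends on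
      \<open>x0\<close>.\<close>
    using AE_eventually_far[of "\<lambda>m. res m \<bullet> rep_torus3 x0"]
  proof eventually_elim
    case (elim x)
    from lower_hitting_exponent_infinite[OF this] show ?case by simp
  qed
qed

end
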